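(* Let $T\ge 1$, let $A_1,\dots,A_T\in\mathcal A$ be global states and $p_1,\dots,p_T>0$ payments. There are constants $C,\alpha>0$ such that $$\frac1T\sum_{t=1}^T\big(u_{A_t}(p_t)-u_{A_t}(p_t,\zeta)\big)\le C\zeta^2\qquad\text{for all }0\le\zeta<\alpha .$$ Here $u_a(p,\zeta)$ is the mean-field (limit $n\to\infty$) expected utility per supplier when payments are $\zeta$-perturbed from $p$, and $u_a(p)=u_a(p,0)$, as defined in the context.
   Context: Notation: $\mathbb R_+=[0,\infty)$. A sequence of systems is indexed by the market size $n\in\mathbb N$. $T$ denotes the time horizon. Demand: the global state $A$ takes values in a finite set $\mathcal A$. Conditionally on $A=a$, the demand $D\ge 0$ (depending on $n$) satisfies, for some $d_a>0$: $\mathbb E[D/n\mid A=a]=d_a$ for all $n$; $\lim_{n\to\infty}\mathbb E[(D/n-d_a)^2\mid A=a]=0$; $\mathbb P(D/n\notin[d_a/2,2d_a]\mid A=a)=o(1/n)$. Suppliers: there are $n$ suppliers. Given a payment distribution $\pi$ on $\mathbb R_+$, payments $P_1,\dots,P_n$ are i.i.d. from $\pi$. Private features $B_1,\dots,B_n\in\mathcal B$ are i.i.d. given $A$, with law depending only on $A$. Conditionally on $A$, the variables $D$, $(B_i)$, $(P_i)$ are independent. $Z_i\in\{0,1\}$ indicates that supplier $i$ is active; $T_{\rm act}=\sum_i Z_i$. $S_i$ is the demand an active supplier $i$ serves (demand is randomly matched, irrespective of payments) and $\Omega(d,t)=\mathbb E[S_i\mid D=d,T_{\rm act}=t]$. Regular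 allocation function: $\omega:\mathbb R_+\to[0,1]$ smooth, concave, non-decreasing, with $\lim_{x\to0}\omega(x)=0$, $\lim_{x\to\infty}\omega(x)\le1$, $\lim_{x\to0}\omega'(x)\le1$. Assumption on $\Omega$: $\Omega:\mathbb R_+^2\to\mathbb R_+$ is non-decreasing in $d$, non-increasing in $t$, and $\Omega(d,t)=\omega(d/t)+l(d,t)$ with $\omega$ a regular allocation function and $l$ bounded with $|l(d,t)|=o(1/\sqrt t+1/\sqrt d)$ (at $t=0$, $\omega(d/t)$ is read as $\lim_{x\to\infty}\omega(x)$). Choice model: suppliers know $a$ and $\pi$. Conditionally on $A=a$, supplier $i$ becomes active independently with probability $f_{B_i}\big(P_i\,\mathbb E_\pi[\Omega(D,T_{\rm act})\mid A=a]\big)$, where $T_{\rm act}$ is the equilibrium number of active suppliers, i.e. a random variable (independent of $D$ given $A$) whose law coincides with that of the number of active suppliers resulting from these choices (conditionally on $A=a$ this equilibrium exists, is unique in law and binomial). For every $b\in\mathcal B$, $f_b$ takes values in $[0,1]$, is non-decreasing and twice differentiable, with second derivative bounded uniformly in $b$. Revenue and utility: the platform's utility is $U=R(D,T_{\rm act})-\sum_iP_iZ_iS_i$, where $R(d,t)=(r(d/t)-l_R(d,t))\,t$ for $d,t\in\mathbb R_+$ (read as $0$ at $t=0$), $r:\mathbb R_+\to\mathbb R$ is smooth with bounded derivatives and $l_R$ is bounded with $|l_R(d,t)|=o(1/\sqrt t+1/\sqrt d)$. Put $u_a^{(n)}(\pi)=\frac1n\mathbb E[U\mid A=a]$ in the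 $n$-th system with payment distribution $\pi$. Perturbed payments: for $p>\zeta\ge0$, $\pi_{p,\zeta}$ is the law of $p+\zeta\varepsilon$ with $\varepsilon$ uniform on $\{-1,+1\}$; $u_a^{(n)}(p,\zeta)=u_a^{(n)}(\pi_{p,\zeta})$, and $u_a(p,\zeta)=\lim_{n\to\infty}u_a^{(n)}(p,\zeta)$, $u_a(p)=u_a(p,0)$.
   Formalization: Added assumption: r is bounded, or at each payment p_t the choice probability f_B(p_t·lim ω) is not almost surely 0 given A_t (mean-field activity nonzero). If "bounded derivatives" only covers orders ≥ 1, the claim fails without it, e.g. r(x) = −x with f vanishing exactly up to p·lim ω. *)

theory Defs
  imports "HOL-Probability.Probability" "HOL-Library.Landau_Symbols"
begin

text \<open>
  Derivatives on the closed half line are one-sided at the boundary point, so a smooth function on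
  a set \<open>S\<close> is described by the sequence \<open>g 0, g 1, g 2, \<dots>\<close> of its successive derivatives within \<open>S\<close>.
\<close>

definition derivative_sequence :: "real set \<Rightarrow> (nat \<Rightarrow> real \<Rightarrow> real) \<Rightarrow> bool" where
  "derivative_sequence S g \<longleftrightarrow>
     (\<forall>k. \<forall>x\<in>S. (g k has_real_derivative g (Suc k) x) (at x within S))"

definition smooth_on :: "real set \<Rightarrow> (real \<Rightarrow> real) \<Rightarrow> bool" where
  "smooth_on S h \<longleftrightarrow> (\<exists>g. g 0 = h \<and> derivative_sequence S g)"

definition smooth_bounded_derivatives_on :: "real set \<Rightarrow> (real \<Rightarrow> real) \<Rightarrow> bool" where
  "smooth_bounded_derivatives_on S h \<longleftrightarrow>
     (\<exists>g. g 0 = h \<and> derivative_sequence S g \<and> (\<forall>k\<ge>1. bounded (g k ` S)))"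

definition regular_allocation :: "(real \<Rightarrow> real) \<Rightarrow> bool" where
  "regular_allocation \<omega> \<longleftrightarrow>
     \<omega> ` {0..} \<subseteq> {0..1} \<and> smooth_on {0..} \<omega> \<and> concave_on {0..} \<omega> \<and> mono_on {0..} \<omega> \<and>
     (\<omega> \<longlongrightarrow> 0) (at_right 0) \<and>
     (\<exists>L\<le>1. (\<omega> \<longlongrightarrow> L) at_top) \<and>
     (\<exists>L\<le>1. (deriv \<omega> \<longlongrightarrow> L) (at_right 0))"

text \<open>
  The error terms are bounded on the quadrant, and the little-o is taken as both arguments tend to
  infinity, i.e. as the comparison function tends to 0.
\<close>

definition lower_order :: "(real \<Rightarrow> real \<Rightarrow> real) \<Rightarrow> bool" where
  "lower_order l \<longleftrightarrow>
     (\<exists>K. \<forall>d\<ge>0. \<forall>t\<ge>0. \<bar>l d t\<bar> \<le> K) \<and>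
     (\<lambda>(d, t). l d t) \<in> o[at_top \<times>\<^sub>F at_top](\<lambda>(d, t). 1 / sqrt t + 1 / sqrt d)"

definition mean_field_allocation :: "(real \<Rightarrow> real) \<Rightarrow> real \<Rightarrow> real \<Rightarrow> real" where
  "mean_field_allocation \<omega> d t = (if t = 0 then Lim at_top \<omega> else \<omega> (d / t))"

text \<open>At \<open>t = 0\<close> the factor \<open>t\<close> makes the revenue vanish.\<close>

definition revenue :: "(real \<Rightarrow> real) \<Rightarrow> (real \<Rightarrow> real \<Rightarrow> real) \<Rightarrow> real \<Rightarrow> real \<Rightarrow> real" where
  "revenue r l\<^sub>R d t = (r (d / t) - l\<^sub>R d t) * t"

definition payment_distribution :: "real measure \<Rightarrow> bool" where
  "payment_distribution \<pi> \<longleftrightarrow> prob_space \<pi> \<and> sets \<pi> = sets borel \<and> (AE x in \<pi>. 0 \<le> x)"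

definition perturbed_payment :: "real \<Rightarrow> real \<Rightarrow> real measure" where
  "perturbed_payment p \<zeta> =
     distr (measure_pmf (pmf_of_set {-1, 1})) borel (\<lambda>\<epsilon>. p + \<zeta> * \<epsilon>)"

text \<open>
  One system of the sequence: its probability space and random variables, suppliers being numbered
  from 0. The value of \<open>active\<close> is 0 or 1; \<open>served\<close> is relevant for active suppliers only.
\<close>

record ('w, 's, 'b) system =
  sample :: "'w measure"
  state :: "'w \<Rightarrow> 's"
  demand :: "'w \<Rightarrow> real"
  feature :: "nat \<Rightarrow> 'w \<Rightarrow> 'b"
  payment :: "nat \<Rightarrow> 'w \<Rightarrow> real"
  active :: "nat \<Rightarrow> 'w \<Rightarrow> real"
  served :: "nat \<Rightarrow> 'w \<Rightarrow> real"

definition conditional_law :: "('w, 's, 'b) system \<Rightarrow> 's \<Rightarrow> 'w measure" where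
  "conditional_law X a = uniform_measure (sample X) {w \<in> space (sample X). state X w = a}"

definition num_active :: "nat \<Rightarrow> ('w, 's, 'b) system \<Rightarrow> 'w \<Rightarrow> real" where
  "num_active n X w = (\<Sum>i<n. active X i w)"

definition expected_allocation ::
    "(real \<Rightarrow> real \<Rightarrow> real) \<Rightarrow> nat \<Rightarrow> ('w, 's, 'b) system \<Rightarrow> 's \<Rightarrow> real" where
  "expected_allocation \<Omega> n X a =
     (\<integral>w. \<Omega> (demand X w) (num_active n X w) \<partial>conditional_law X a)"

definition primitives :: "nat \<Rightarrow> ('w, 's, 'b) system \<Rightarrow> 'w \<Rightarrow> real \<times> (nat \<Rightarrow> 'b) \<times> (nat \<Rightarrow> real)" where
  "primitives n X w = (demand X w, (\<lambda>i\<in>{..<n}. feature X i w), (\<lambda>i\<in>{..<n}. payment X i w))"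

definition primitives_space :: "'b measure \<Rightarrow> nat \<Rightarrow> (real \<times> (nat \<Rightarrow> 'b) \<times> (nat \<Rightarrow> real)) measure" where
  "primitives_space \<B> n =
     borel \<Otimes>\<^sub>M ((\<Pi>\<^sub>M i\<in>{..<n}. \<B>) \<Otimes>\<^sub>M (\<Pi>\<^sub>M i\<in>{..<n}. borel))"

definition sigma_primitives :: "'b measure \<Rightarrow> nat \<Rightarrow> ('w, 's, 'b) system \<Rightarrow> 'w measure" where
  "sigma_primitives \<B> n X =
     vimage_algebra (space (sample X)) (primitives n X) (primitives_space \<B> n)"

definition sigma_matching :: "nat \<Rightarrow> ('w, 's, 'b) system \<Rightarrow> 'w measure" where
  "sigma_matching n X =
     vimage_algebra (space (sample X))
       (\<lambda>w. (demand X w, (\<lambda>i\<in>{..<n}. payment X i w), (\<lambda>i\<in>{..<n}. active X i w)))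
       (borel \<Otimes>\<^sub>M ((\<Pi>\<^sub>M i\<in>{..<n}. borel) \<Otimes>\<^sub>M (\<Pi>\<^sub>M i\<in>{..<n}. borel)))"

text \<open>
  The system with \<open>n\<close> suppliers and payment distribution \<open>\<pi>\<close>, in equilibrium. Here \<open>\<nu> a\<close> is the law of
  a private feature and \<open>\<delta> n a\<close> the law of the demand, both conditional on state \<open>a\<close>.

  The assumption \<open>primitives_law\<close> says that, given \<open>A = a\<close>, the demand, the vector of features and
  the vector of payments are independent with i.i.d. entries in the two vectors.

  The assumption \<open>choices\<close> gives the conditional probability, given \<open>A = a\<close> and the demand, features
  and payments, that \<open>J\<close> is the set of active suppliers. The expected allocation in it is computed
  from the number of active suppliers that results from these very choices, so it is the equilibrium
  one. Independence of this number and the demand follows, as the choice probabilities do not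
  involve the demand.

  The assumption \<open>matching\<close> is \<open>E[S\<^sub>i | D, P, Z] = \<Omega> D T\<close> on the event that supplier \<open>i\<close> is
  active: demand is matched randomly, without regard to payments or to who is active.
\<close>

locale equilibrium_system =
  fixes \<A> :: "'s set"
    and \<B> :: "'b measure"
    and \<delta> :: "nat \<Rightarrow> 's \<Rightarrow> real measure"
    and \<nu> :: "'s \<Rightarrow> 'b measure"
    and f :: "'b \<Rightarrow> real \<Rightarrow> real"
    and \<Omega> :: "real \<Rightarrow> real \<Rightarrow> real"
    and n :: nat
    and \<pi> :: "real measure"
    and X :: "('w, 's, 'b) system"
  assumes prob_space: "prob_space (sample X)"
    and state_measurable: "state X \<in> sample X \<rightarrow>\<^sub>M count_space \<A>"
    and state_pos: "\<And>a. a \<in> \<A> \<Longrightarrow>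
      0 < measure (sample X) {w \<in> space (sample X). state X w = a}"
    and demand_measurable: "demand X \<in> borel_measurable (sample X)"
    and demand_nonneg: "\<And>w. w \<in> space (sample X) \<Longrightarrow> 0 \<le> demand X w"
    and feature_measurable: "\<And>i. i < n \<Longrightarrow> feature X i \<in> sample X \<rightarrow>\<^sub>M \<B>"
    and payment_measurable: "\<And>i. i < n \<Longrightarrow> payment X i \<in> borel_measurable (sample X)"
    and active_measurable: "\<And>i. i < n \<Longrightarrow> active X i \<in> borel_measurable (sample X)"
    and served_measurable: "\<And>i. i < n \<Longrightarrow> served X i \<in> borel_measurable (sample X)"
    and active_binary: "\<And>i w. i < n \<Longrightarrow> w \<in> space (sample X) \<Longrightarrow> active X i w \<in> {0, 1}"
    and served_nonneg: "\<And>i w. i < n \<Longrightarrow> w \<in> space (sample X) \<Longrightarrow> 0 \<le> served X i w"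
    and primitives_law: "\<And>a. a \<in> \<A> \<Longrightarrow>
      distr (conditional_law X a) (primitives_space \<B> n) (primitives n X) =
        \<delta> n a \<Otimes>\<^sub>M ((\<Pi>\<^sub>M i\<in>{..<n}. \<nu> a) \<Otimes>\<^sub>M (\<Pi>\<^sub>M i\<in>{..<n}. \<pi>))"
    and choices: "\<And>a J. a \<in> \<A> \<Longrightarrow> J \<subseteq> {..<n} \<Longrightarrow>
      AE w in conditional_law X a.
        real_cond_exp (conditional_law X a) (sigma_primitives \<B> n X)
          (indicat_real {v \<in> space (sample X). {i\<in>{..<n}. active X i v = 1} = J}) w =
        (\<Prod>i<n. let q = f (feature X i w) (payment X i w * expected_allocation \<Omega> n X a)
                 in if i \<in> J then q else 1 - q)"
    and served_integrable: "\<And>a i. a \<in> \<A> \<Longrightarrow> i < n \<Longrightarrow>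
      integrable (conditional_law X a) (\<lambda>w. active X i w * served X i w)"
    and matching: "\<And>a i. a \<in> \<A> \<Longrightarrow> i < n \<Longrightarrow>
      AE w in conditional_law X a.
        real_cond_exp (conditional_law X a) (sigma_matching n X)
          (\<lambda>v. active X i v * served X i v) w =
        active X i w * \<Omega> (demand X w) (num_active n X w)"

text \<open>
  \<open>Sys n \<pi>\<close> is the system of market size \<open>n\<close> under payment distribution \<open>\<pi>\<close>. The second moment in
  \<open>demand_L2\<close> is a nonnegative extended-real integral, so that an infinite one is not read as 0.
\<close>

locale market_model =
  fixes \<A> :: "'s set"
    and \<B> :: "'b measure"
    and d :: "'s \<Rightarrow> real"
    and \<delta> :: "nat \<Rightarrow> 's \<Rightarrow> real measure"
    and \<nu> :: "'s \<Rightarrow> 'b measure"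
    and f :: "'b \<Rightarrow> real \<Rightarrow> real"
    and \<Omega> :: "real \<Rightarrow> real \<Rightarrow> real"
    and \<omega> :: "real \<Rightarrow> real"
    and l :: "real \<Rightarrow> real \<Rightarrow> real"
    and r :: "real \<Rightarrow> real"
    and l\<^sub>R :: "real \<Rightarrow> real \<Rightarrow> real"
    and Sys :: "nat \<Rightarrow> real measure \<Rightarrow> ('w, 's, 'b) system"
  assumes finite_states: "finite \<A>"
    and d_pos: "\<And>a. a \<in> \<A> \<Longrightarrow> 0 < d a"
    and demand_prob: "\<And>n a. 1 \<le> n \<Longrightarrow> a \<in> \<A> \<Longrightarrow> prob_space (\<delta> n a)"
    and demand_sets: "\<And>n a. 1 \<le> n \<Longrightarrow> a \<in> \<A> \<Longrightarrow> sets (\<delta> n a) = sets borel"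
    and demand_law_nonneg: "\<And>n a. 1 \<le> n \<Longrightarrow> a \<in> \<A> \<Longrightarrow> AE x in \<delta> n a. 0 \<le> x"
    and demand_integrable: "\<And>n a. 1 \<le> n \<Longrightarrow> a \<in> \<A> \<Longrightarrow> integrable (\<delta> n a) (\<lambda>x. x)"
    and demand_mean: "\<And>n a. 1 \<le> n \<Longrightarrow> a \<in> \<A> \<Longrightarrow> (\<integral>x. x / real n \<partial>\<delta> n a) = d a"
    and demand_L2: "\<And>a. a \<in> \<A> \<Longrightarrow>
      (\<lambda>n. \<integral>\<^sup>+x. ennreal ((x / real n - d a)\<^sup>2) \<partial>\<delta> n a) \<longlonglongrightarrow> 0"
    and demand_tail: "\<And>a. a \<in> \<A> \<Longrightarrow>
      (\<lambda>n. measure (\<delta> n a) {x. x / real n \<notin> {d a / 2..2 * d a}}) \<in> o(\<lambda>n. 1 / real n)"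
    and feature_prob: "\<And>a. a \<in> \<A> \<Longrightarrow> prob_space (\<nu> a)"
    and feature_sets: "\<And>a. a \<in> \<A> \<Longrightarrow> sets (\<nu> a) = sets \<B>"
    and regular: "regular_allocation \<omega>"
    and \<Omega>_nonneg: "\<And>x t. 0 \<le> x \<Longrightarrow> 0 \<le> t \<Longrightarrow> 0 \<le> \<Omega> x t"
    and \<Omega>_mono: "\<And>x y t. 0 \<le> x \<Longrightarrow> x \<le> y \<Longrightarrow> 0 \<le> t \<Longrightarrow> \<Omega> x t \<le> \<Omega> y t"
    and \<Omega>_antimono: "\<And>x s t. 0 \<le> x \<Longrightarrow> 0 \<le> s \<Longrightarrow> s \<le> t \<Longrightarrow> \<Omega> x t \<le> \<Omega> x s"
    and \<Omega>_eq: "\<And>x t. 0 \<le> x \<Longrightarrow> 0 \<le> t \<Longrightarrow> \<Omega> x t = mean_field_allocation \<omega> x t + l x t"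
    and l_lower_order: "lower_order l"
    and choice_measurable: "\<And>x. 0 \<le> x \<Longrightarrow> (\<lambda>b. f b x) \<in> borel_measurable \<B>"
    and choice_range: "\<And>b x. b \<in> space \<B> \<Longrightarrow> 0 \<le> x \<Longrightarrow> f b x \<in> {0..1}"
    and choice_mono: "\<And>b. b \<in> space \<B> \<Longrightarrow> mono_on {0..} (f b)"
    and choice_twice_diff: "\<exists>f' f'' K. \<forall>b\<in>space \<B>. \<forall>x\<ge>0.
      (f b has_real_derivative f' b x) (at x within {0..}) \<and>
      (f' b has_real_derivative f'' b x) (at x within {0..}) \<and> \<bar>f'' b x\<bar> \<le> K"
    and r_smooth: "smooth_bounded_derivatives_on {0..} r"
    and l\<^sub>R_lower_order: "lower_order l\<^sub>R"
    and l\<^sub>R_measurable: "\<And>t. 0 \<le> t \<Longrightarrow>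
      (\<lambda>x. l\<^sub>R x t) \<in> borel_measurable (restrict_space borel {0..})"
    and systems: "\<And>n \<pi>. 1 \<le> n \<Longrightarrow> payment_distribution \<pi> \<Longrightarrow>
      equilibrium_system \<A> \<B> \<delta> \<nu> f \<Omega> n \<pi> (Sys n \<pi>)"

definition platform_utility ::
    "(real \<Rightarrow> real) \<Rightarrow> (real \<Rightarrow> real \<Rightarrow> real) \<Rightarrow> nat \<Rightarrow> ('w, 's, 'b) system \<Rightarrow> 'w \<Rightarrow> real" where
  "platform_utility r l\<^sub>R n X w =
     revenue r l\<^sub>R (demand X w) (num_active n X w) -
     (\<Sum>i<n. payment X i w * active X i w * served X i w)"

definition utility ::
    "(real \<Rightarrow> real) \<Rightarrow> (real \<Rightarrow> real \<Rightarrow> real) \<Rightarrow> (nat \<Rightarrow> real measure \<Rightarrow> ('w, 's, 'b) system) \<Rightarrow>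
     's \<Rightarrow> real measure \<Rightarrow> nat \<Rightarrow> real" where
  "utility r l\<^sub>R Sys a \<pi> n =
     1 / real n * (\<integral>w. platform_utility r l\<^sub>R n (Sys n \<pi>) w \<partial>conditional_law (Sys n \<pi>) a)"

definition mean_field_utility ::
    "(real \<Rightarrow> real) \<Rightarrow> (real \<Rightarrow> real \<Rightarrow> real) \<Rightarrow> (nat \<Rightarrow> real measure \<Rightarrow> ('w, 's, 'b) system) \<Rightarrow>
     's \<Rightarrow> real \<Rightarrow> real \<Rightarrow> real" where
  "mean_field_utility r l\<^sub>R Sys a p \<zeta> = lim (utility r l\<^sub>R Sys a (perturbed_payment p \<zeta>))"

end

theory Submission
  imports Defs
begin

text \<open>
  Given the state, the suppliers' decisions are i.i.d. with probability \<open>G e\<close>, where \<open>e\<close> is the expected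
  allocation, so the active fraction \<open>T/n\<close> is within \<open>1 / sqrt n\<close> of its mean in \<open>L\<^sup>1\<close>, and so is \<open>D/n\<close>
  close to \<open>d\<close>. Hence in the limit the active fraction \<open>q\<close> solves \<open>q = G (\<omega> (d / q))\<close> and the utility is
  \<open>r (d / q) * q - H (\<omega> (d / q)) * \<omega> (d / q)\<close> with \<open>H\<close> the mean payout. Averaging over the sign of the
  perturbation cancels the first-order term, so \<open>G\<close> and \<open>H\<close> change by \<open>O(\<zeta>\<^sup>2)\<close>. Since \<open>q - G (\<omega> (d / q))\<close>
  has slope at least 1 in \<open>q\<close>, the root \<open>q\<close> moves by \<open>O(\<zeta>\<^sup>2)\<close>, and the limit utility is Lipschitz at
  \<open>q\<close> if \<open>q > 0\<close>. If \<open>q = 0\<close>, then \<open>r\<close> is bounded and the utility is itself \<open>O(q)\<close>.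
\<close>

section \<open>Deterministic estimates\<close>

text \<open>The error terms are small only where both arguments are large, and d / t is singular at
  t = 0. Approximations are therefore stated around a fixed centre (x0, y0) with error
  \<open>\<epsilon> + C * (|x - x0| + |y - y0|)\<close>, where boundedness pays for the points far
  from the centre; taking expectations turns the second term into an L1 deviation. The obstacle is
  that at finite n the expected allocation and the active fraction determine each other and neither
  is known to converge. Negative feedback settles this: a fraction above q lowers the allocation,
  which in turn lowers the fraction. At q = 0 the limit of the allocation is not identified, and the
  argument rests on revenue and payout vanishing together with the fraction. For r of linear growth
  this breaks down: if r(x) = -x, then r(d / q) * q equals -d for q > 0 but 0 at q = 0, so a tiny
  perturbation that activates a few suppliers would cost a fixed amount. The assumption
  \<open>nondegenerate\<close> excludes this, as it forces r to be bounded or the unperturbed q to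
  be positive.\<close>

text \<open>If x and y are at least half of x0 and y0, both scaled arguments are large and the
  little-o bound gives \<epsilon>. Otherwise (x, y) lies at a fixed positive distance from the
  centre, and the uniform bound on l is absorbed by C times that distance.\<close>

lemma lower_order_scaled:
  assumes l: "lower_order l" and pos: "0 < x0" "0 < y0" "0 < \<epsilon>"
  shows "\<exists>C\<ge>0. \<forall>\<^sub>F n in sequentially. \<forall>x\<ge>0. \<forall>y\<ge>0.
    \<bar>l (real n * x) (real n * y)\<bar> \<le> \<epsilon> + C * (\<bar>x - x0\<bar> + \<bar>y - y0\<bar>)"
proof -
  obtain K where K: "\<And>x y. 0 \<le> x \<Longrightarrow> 0 \<le> y \<Longrightarrow> \<bar>l x y\<bar> \<le> K"
    and small: "(\<lambda>(d, t). l d t) \<in> o[at_top \<times>\<^sub>F at_top](\<lambda>(d, t). 1 / sqrt t + 1 / sqrt d)"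
    using l unfolding lower_order_def by blast
  have K0: "0 \<le> K" using K[of 0 0] by simp
  have "\<forall>\<^sub>F p in at_top \<times>\<^sub>F at_top. norm ((\<lambda>(d, t). l d t) p)
      \<le> \<epsilon> / 2 * norm ((\<lambda>(d, t). 1 / sqrt t + 1 / sqrt d) p)"
    using landau_o.smallD[OF small, of "\<epsilon> / 2"] pos by simp
  then obtain P Q where P: "eventually P at_top" and Q: "eventually Q at_top"
    and PQ: "\<And>x y. P x \<Longrightarrow> Q y \<Longrightarrow> \<bar>l x y\<bar> \<le> \<epsilon> / 2 * \<bar>1 / sqrt y + 1 / sqrt x\<bar>"
    unfolding eventually_prod_filter by auto
  obtain N1 N2 where N: "\<And>x. N1 \<le> x \<Longrightarrow> P x" "\<And>y. N2 \<le> y \<Longrightarrow> Q y"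
    using P Q unfolding eventually_at_top_linorder by blast
  \<comment> \<open>Beyond 1 both square roots are at least 1, so the comparison function is at most
    2; this explains the factor \<epsilon> / 2 above.\<close>
  define N where "N = max 1 (max N1 N2)"
  \<comment> \<open>Chosen so that C times the distance is at least K once the distance reaches x0 /
    2 or y0 / 2.\<close>
  define C where "C = K * (2 / x0 + 2 / y0)"
  have large: "\<bar>l x y\<bar> \<le> \<epsilon>" if "N \<le> x" "N \<le> y" for x y
  proof -
    have x: "1 \<le> x" "1 \<le> y" "N1 \<le> x" "N2 \<le> y" using that by (auto simp: N_def)
    then have s: "1 \<le> sqrt x" "1 \<le> sqrt y" by simp_all
    have "\<bar>l x y\<bar> \<le> \<epsilon> / 2 * \<bar>1 / sqrt y + 1 / sqrt x\<bar>" using PQ N x by blast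
    also have "\<dots> \<le> \<epsilon> / 2 * 2"
    proof (rule mult_left_mono)
      have "1 / sqrt y \<le> 1" "1 / sqrt x \<le> 1" "0 \<le> 1 / sqrt y" "0 \<le> 1 / sqrt x" using s by auto
      then show "\<bar>1 / sqrt y + 1 / sqrt x\<bar> \<le> 2" by linarith
    qed (use pos in simp)
    finally show ?thesis by simp
  qed
  have lim: "\<forall>\<^sub>F n in sequentially. N \<le> real n * (z / 2)" if "0 < z" for z
  proof -
    have "filterlim (\<lambda>n. real n * (z / 2)) at_top sequentially"
      using that by (intro filterlim_tendsto_pos_mult_at_top[OF tendsto_const, of "z/2", unfolded mult.commute[of "z/2"]] filterlim_real_sequentially) auto
    then show ?thesis unfolding filterlim_at_top by blast
  qed
  have "\<forall>\<^sub>F n in sequentially. \<forall>x\<ge>0. \<forall>y\<ge>0.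
      \<bar>l (real n * x) (real n * y)\<bar> \<le> \<epsilon> + C * (\<bar>x - x0\<bar> + \<bar>y - y0\<bar>)"
    using lim[OF pos(1)] lim[OF pos(2)]
  proof eventually_elim
    case (elim n)
    show ?case
    proof (intro allI impI)
      fix x y :: real assume xy: "0 \<le> x" "0 \<le> y"
      let ?s = "\<bar>x - x0\<bar> + \<bar>y - y0\<bar>"
      have C0: "0 \<le> C * ?s" using K0 pos by (simp add: C_def)
      have bound: "K \<le> C * ?s" if h: "z / 2 \<le> ?s" "0 < z" "z = x0 \<or> z = y0" for z
      proof -
        have "1 = 2 / z * (z / 2)" using h(2) by simp
        also have "\<dots> \<le> 2 / z * ?s" using h by (intro mult_left_mono) auto
        also have "\<dots> \<le> (2 / x0 + 2 / y0) * ?s" using h pos by (intro mult_right_mono) auto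
        finally have "K * 1 \<le> K * ((2 / x0 + 2 / y0) * ?s)" by (rule mult_left_mono[OF _ K0])
        then show ?thesis by (simp add: C_def mult.assoc)
      qed
      have Kb: "\<bar>l (real n * x) (real n * y)\<bar> \<le> K" using K xy by simp
      consider "x < x0 / 2" | "y < y0 / 2" | "x0 / 2 \<le> x" "y0 / 2 \<le> y" by linarith
      then show "\<bar>l (real n * x) (real n * y)\<bar> \<le> \<epsilon> + C * ?s"
      proof cases
        case 1
        then have "x0 / 2 \<le> ?s" by (simp add: abs_if)
        from bound[OF this pos(1)] show ?thesis using Kb pos by simp
      next
        case 2
        then have "y0 / 2 \<le> ?s" by (simp add: abs_if)
        from bound[OF this pos(2)] show ?thesis using Kb pos by simp
      next
        case 3
        then have "real n * (x0 / 2) \<le> real n * x" "real n * (y0 / 2) \<le> real n * y"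
          by (intro mult_left_mono; simp)+
        with elim have "\<bar>l (real n * x) (real n * y)\<bar> \<le> \<epsilon>" by (intro large) linarith+
        then show ?thesis using C0 by simp
      qed
    qed
  qed
  moreover have "0 \<le> C" using K0 pos by (simp add: C_def)
  ultimately show ?thesis by blast
qed

lemma lower_order_bounded:
  assumes "lower_order l"
  shows "\<exists>K\<ge>0. \<forall>x\<ge>0. \<forall>y\<ge>0. \<bar>l x y\<bar> \<le> K"
  using assms unfolding lower_order_def by (metis abs_ge_zero order_trans order_refl)

section \<open>Calculus on the half line\<close>

text \<open>The one-sided derivative at 0 is needed only for continuity, since interior points have
  two-sided derivatives. The intermediate point may be an endpoint, which admits a = b.\<close>

lemma real_MVT_within_nonneg:
  fixes g g' :: "real \<Rightarrow> real"
  assumes der: "\<And>x. 0 \<le> x \<Longrightarrow> (g has_real_derivative g' x) (at x within {0..})"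
    and ab: "0 \<le> a" "a \<le> b"
  shows "\<exists>z. a \<le> z \<and> z \<le> b \<and> g b - g a = (b - a) * g' z"
proof (cases "a = b")
  case False
  have "continuous_on {0..} g"
    using der by (meson DERIV_continuous atLeast_iff continuous_on_eq_continuous_within)
  then have "continuous_on {a..b} g" using ab by (auto intro: continuous_on_subset)
  moreover have "(g has_real_derivative g' x) (at x)" if "a < x" "x < b" for x
    using der[of x] that ab at_within_interior[of x "{0..}"] by (simp add: interior_real_atLeast)
  ultimately obtain z where z: "a < z" "z < b" "g b - g a = (\<lambda>h. g' z * h) (b - a)"
    using mvt[of a b g "\<lambda>x h. g' x * h"] False ab
    by (auto simp: has_field_derivative_def)
  then show ?thesis by (intro exI[of _ z]) (auto simp: mult.commute)
qed (use ab in auto)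

text \<open>A function with values in [0, 1] has slope at most 1 in absolute value somewhere in
  [a, a + 1], and the bound on the second derivative carries this back to a at a cost of K. The
  Lipschitz constant 1 + K is thus the same for all features. The second difference is h times the
  difference of g' at two mean-value points at distance at most 2h.\<close>

lemma C2_bounds:
  fixes g g' g'' :: "real \<Rightarrow> real"
  assumes d1: "\<And>x. 0 \<le> x \<Longrightarrow> (g has_real_derivative g' x) (at x within {0..})"
    and d2: "\<And>x. 0 \<le> x \<Longrightarrow> (g' has_real_derivative g'' x) (at x within {0..})"
    and K: "\<And>x. 0 \<le> x \<Longrightarrow> \<bar>g'' x\<bar> \<le> K"
    and rng: "\<And>x. 0 \<le> x \<Longrightarrow> g x \<in> {0..1}"
  shows C2_lipschitz: "0 \<le> x \<Longrightarrow> 0 \<le> y \<Longrightarrow> \<bar>g x - g y\<bar> \<le> (1 + K) * \<bar>x - y\<bar>"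
    and C2_second_difference: "0 \<le> h \<Longrightarrow> h \<le> x \<Longrightarrow> \<bar>g (x + h) + g (x - h) - 2 * g x\<bar> \<le> 2 * K * h\<^sup>2"
proof -
  have d2': "\<bar>g' b - g' a\<bar> \<le> K * \<bar>b - a\<bar>" if ab: "0 \<le> a" "0 \<le> b" for a b
  proof -
    have *: "\<bar>g' v - g' u\<bar> \<le> K * (v - u)" if uv: "0 \<le> u" "u \<le> v" for u v
    proof -
      obtain z where z: "u \<le> z" "g' v - g' u = (v - u) * g'' z"
        using real_MVT_within_nonneg[OF d2 uv] by blast
      have "\<bar>g' v - g' u\<bar> = (v - u) * \<bar>g'' z\<bar>" using z uv by (simp add: abs_mult)
      also have "\<dots> \<le> (v - u) * K" using K[of z] z uv by (intro mult_left_mono) auto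
      finally show ?thesis by (simp add: mult.commute)
    qed
    show ?thesis using *[of a b] *[of b a] ab by (cases "a \<le> b") (auto simp: abs_minus_commute)
  qed
  have d1': "\<bar>g' a\<bar> \<le> 1 + K" if a: "0 \<le> a" for a
  proof -
    obtain z where z: "a \<le> z" "z \<le> a + 1" "g (a + 1) - g a = g' z"
      using real_MVT_within_nonneg[OF d1 a, of "a + 1"] by auto
    have "\<bar>g' z\<bar> \<le> 1" using rng[of a] rng[of "a + 1"] z(3) a by auto
    moreover have "\<bar>g' a - g' z\<bar> \<le> K * \<bar>a - z\<bar>" using d2'[of z a] z a by simp
    moreover have "K * \<bar>a - z\<bar> \<le> K * 1"
      using z K[of 0] by (intro mult_left_mono) auto
    ultimately show ?thesis by linarith
  qed
  have *: "\<bar>g v - g u\<bar> \<le> (1 + K) * (v - u)" if uv: "0 \<le> u" "u \<le> v" for u v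
  proof -
    obtain z where z: "u \<le> z" "g v - g u = (v - u) * g' z"
      using real_MVT_within_nonneg[OF d1 uv] by blast
    have "\<bar>g v - g u\<bar> = (v - u) * \<bar>g' z\<bar>" using z uv by (simp add: abs_mult)
    also have "\<dots> \<le> (v - u) * (1 + K)" using d1'[of z] z uv by (intro mult_left_mono) auto
    finally show ?thesis by (simp add: mult.commute)
  qed
  show "\<bar>g x - g y\<bar> \<le> (1 + K) * \<bar>x - y\<bar>" if "0 \<le> x" "0 \<le> y"
    using *[of x y] *[of y x] that by (cases "x \<le> y") (auto simp: abs_minus_commute)
  show "\<bar>g (x + h) + g (x - h) - 2 * g x\<bar> \<le> 2 * K * h\<^sup>2" if h: "0 \<le> h" "h \<le> x"
  proof -
    obtain z1 where z1: "x \<le> z1" "z1 \<le> x + h" "g (x + h) - g x = h * g' z1"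
      using real_MVT_within_nonneg[OF d1, of x "x + h"] h by auto
    obtain z2 where z2: "x - h \<le> z2" "z2 \<le> x" "g x - g (x - h) = h * g' z2"
      using real_MVT_within_nonneg[OF d1, of "x - h" x] h by auto
    have "\<bar>g' z1 - g' z2\<bar> \<le> K * \<bar>z1 - z2\<bar>" using d2'[of z2 z1] z1 z2 h by simp
    also have "\<dots> \<le> K * (2 * h)" using z1 z2 K[of 0] by (intro mult_left_mono) auto
    finally have "h * \<bar>g' z1 - g' z2\<bar> \<le> h * (K * (2 * h))" using h by (intro mult_left_mono) auto
    moreover have e: "g (x + h) + g (x - h) - 2 * g x = h * (g' z1 - g' z2)"
      using z1(3) z2(3) by (simp add: algebra_simps)
    have "\<bar>g (x + h) + g (x - h) - 2 * g x\<bar> = h * \<bar>g' z1 - g' z2\<bar>"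
      unfolding e using h by (simp add: abs_mult)
    ultimately show ?thesis by (simp add: power2_eq_square algebra_simps)
  qed
qed

text \<open>Near z0 the difference quotient is within 1 of D; at distance \<rho> or more, the bound
  1 on the increment is at most 1 / \<rho> times the distance. The estimate is anchored at z0 but
  holds on all of S.\<close>

lemma bounded_differentiable_lipschitz_at:
  fixes h :: "real \<Rightarrow> real"
  assumes der: "(h has_real_derivative D) (at z0 within S)"
    and bnd: "\<And>z. z \<in> S \<Longrightarrow> \<bar>h z - h z0\<bar> \<le> 1"
  shows "\<exists>C\<ge>0. \<forall>z\<in>S. \<bar>h z - h z0\<bar> \<le> C * \<bar>z - z0\<bar>"
proof -
  have "\<forall>\<^sub>F z in at z0 within S. dist ((h z - h z0) / (z - z0)) D < 1"
    using der unfolding has_field_derivative_iff by (rule tendstoD) simp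
  then obtain \<rho> where \<rho>: "0 < \<rho>"
    and near: "\<And>z. z \<in> S \<Longrightarrow> z \<noteq> z0 \<Longrightarrow> dist z z0 < \<rho> \<Longrightarrow> dist ((h z - h z0) / (z - z0)) D < 1"
    unfolding eventually_at by blast
  define C where "C = \<bar>D\<bar> + 1 + 1 / \<rho>"
  have "\<bar>h z - h z0\<bar> \<le> C * \<bar>z - z0\<bar>" if z: "z \<in> S" for z
  proof (cases "z = z0")
    case False
    show ?thesis
    proof (cases "dist z z0 < \<rho>")
      case True
      then have "\<bar>(h z - h z0) / (z - z0)\<bar> \<le> \<bar>D\<bar> + 1"
        using near[OF z False] unfolding dist_real_def by linarith
      then have "\<bar>(h z - h z0) / (z - z0)\<bar> * \<bar>z - z0\<bar> \<le> (\<bar>D\<bar> + 1) * \<bar>z - z0\<bar>"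
        by (rule mult_right_mono) simp
      then have "\<bar>h z - h z0\<bar> \<le> (\<bar>D\<bar> + 1) * \<bar>z - z0\<bar>"
        using False by (simp add: abs_divide)
      also have "\<dots> \<le> C * \<bar>z - z0\<bar>" using \<rho> by (intro mult_right_mono) (auto simp: C_def)
      finally show ?thesis .
    next
      case far: False
      have "1 = 1 / \<rho> * \<rho>" using \<rho> by simp
      also have "\<dots> \<le> 1 / \<rho> * \<bar>z - z0\<bar>" using far \<rho> by (intro mult_left_mono) (auto simp: dist_real_def)
      also have "\<dots> \<le> C * \<bar>z - z0\<bar>" by (intro mult_right_mono) (auto simp: C_def)
      finally show ?thesis using bnd[OF z] by simp
    qed
  qed auto
  moreover have "0 \<le> C" using \<rho> by (simp add: C_def)
  ultimately show ?thesis by blast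
qed

section \<open>Regular allocation functions and the mean-field allocation\<close>

context
  fixes \<omega> :: "real \<Rightarrow> real"
  assumes regular: "regular_allocation \<omega>"
begin

lemma regular_allocation_range: "0 \<le> x \<Longrightarrow> 0 \<le> \<omega> x \<and> \<omega> x \<le> 1"
  using regular unfolding regular_allocation_def by (auto simp: image_subset_iff)

lemma regular_allocation_mono: "0 \<le> x \<Longrightarrow> x \<le> y \<Longrightarrow> \<omega> x \<le> \<omega> y"
  using regular unfolding regular_allocation_def by (auto simp: mono_on_def)

lemma regular_allocation_differentiable: "0 \<le> x \<Longrightarrow> \<exists>D. (\<omega> has_real_derivative D) (at x within {0..})"
  using regular unfolding regular_allocation_def smooth_on_def derivative_sequence_def by fastforce

lemma regular_allocation_continuous: "continuous_on {0..} \<omega>"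
  using regular_allocation_differentiable
  by (meson DERIV_continuous atLeast_iff continuous_on_eq_continuous_within)

lemma regular_allocation_tendsto: "(\<omega> \<longlongrightarrow> Lim at_top \<omega>) at_top"
  using regular unfolding regular_allocation_def by (auto simp: tendsto_Lim)

lemma regular_allocation_le_Lim:
  assumes "0 \<le> x" shows "\<omega> x \<le> Lim at_top \<omega>"
proof (rule tendsto_lowerbound[OF regular_allocation_tendsto])
  show "\<forall>\<^sub>F y in at_top. \<omega> x \<le> \<omega> y"
    using eventually_ge_at_top[of x] by eventually_elim (use assms regular_allocation_mono in auto)
qed simp

lemma Lim_regular_allocation_range: "0 \<le> Lim at_top \<omega>" "Lim at_top \<omega> \<le> 1"
proof -
  show "0 \<le> Lim at_top \<omega>" using regular_allocation_le_Lim[of 0] regular_allocation_range[of 0] by simp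
  show "Lim at_top \<omega> \<le> 1"
  proof (rule tendsto_upperbound[OF regular_allocation_tendsto])
    show "\<forall>\<^sub>F y in at_top. \<omega> y \<le> 1"
      using eventually_ge_at_top[of 0] by eventually_elim (use regular_allocation_range in auto)
  qed simp
qed

lemma mean_field_allocation_range:
  "0 \<le> x \<Longrightarrow> 0 \<le> y \<Longrightarrow> 0 \<le> mean_field_allocation \<omega> x y \<and> mean_field_allocation \<omega> x y \<le> 1"
  using Lim_regular_allocation_range regular_allocation_range[of "x / y"]
  by (simp add: mean_field_allocation_def)

lemma mean_field_allocation_antimono:
  assumes "0 \<le> x" "0 \<le> y" "y \<le> y'"
  shows "mean_field_allocation \<omega> x y' \<le> mean_field_allocation \<omega> x y"
proof (cases "y = 0")
  case True
  then show ?thesis using assms regular_allocation_le_Lim[of "x / y'"] by (simp add: mean_field_allocation_def)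
next
  case False
  then show ?thesis using assms
    by (auto simp: mean_field_allocation_def intro!: regular_allocation_mono divide_left_mono mult_pos_pos)
qed

text \<open>The value at 0 is the limit of \<omega> at infinity, and x / q tends to infinity as q
  decreases to 0 because x > 0.\<close>

lemma continuous_on_mean_field_allocation:
  assumes x: "0 < x"
  shows "continuous_on {0..} (mean_field_allocation \<omega> x)"
  unfolding continuous_on_eq_continuous_within
proof
  fix y :: real assume "y \<in> {0..}"
  then consider "y = 0" | "0 < y" by fastforce
  then show "continuous (at y within {0..}) (mean_field_allocation \<omega> x)"
  proof cases
    case 1
    have "filterlim (\<lambda>q. x / q) at_top (at_right 0)"
      using x by real_asymp
    then have "((\<lambda>q. \<omega> (x / q)) \<longlongrightarrow> Lim at_top \<omega>) (at_right 0)"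
      by (rule filterlim_compose[OF regular_allocation_tendsto])
    then have "(mean_field_allocation \<omega> x \<longlongrightarrow> Lim at_top \<omega>) (at_right 0)"
      by (rule Lim_transform_eventually)
        (auto simp: mean_field_allocation_def eventually_at_filter)
    moreover have "at 0 within {0..} = at_right (0::real)"
    proof -
      have "{0..} - {0} = {0::real<..}" by auto
      then show ?thesis by (simp add: at_within_def)
    qed
    ultimately show ?thesis using 1 by (simp add: continuous_within mean_field_allocation_def)
  next
    case 2
    have "isCont \<omega> (x / y)"
      using regular_allocation_continuous x 2
      by (metis atLeast_iff continuous_on_interior divide_pos_pos greaterThan_iff interior_real_atLeast)
    then have "isCont (\<lambda>q. \<omega> (x / q)) y"
      using 2 by (intro isCont_o2[of y "\<lambda>q. x / q" \<omega>] continuous_intros) auto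
    moreover have "\<forall>\<^sub>F q in nhds y. q \<in> {0<..}"
      using 2 by (intro eventually_nhds_in_open) auto
    then have "\<forall>\<^sub>F q in nhds y. \<omega> (x / q) = mean_field_allocation \<omega> x q"
      by eventually_elim (simp add: mean_field_allocation_def)
    ultimately have "isCont (mean_field_allocation \<omega> x) y" by (simp add: isCont_cong)
    then show ?thesis by (rule continuous_at_imp_continuous_within)
  qed
qed

text \<open>Division by y is harmless once y is at least y0 / 2. For smaller y, the difference of
  two values in [0, 1] is at most 1, and the distance to the centre already exceeds y0 / 2.\<close>

lemma mean_field_allocation_approx:
  assumes pos: "0 < x0" "0 < y0"
  shows "\<exists>C\<ge>0. \<forall>x\<ge>0. \<forall>y\<ge>0.
    \<bar>mean_field_allocation \<omega> x y - \<omega> (x0 / y0)\<bar> \<le> C * (\<bar>x - x0\<bar> + \<bar>y - y0\<bar>)"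
proof -
  define z0 where "z0 = x0 / y0"
  have z0: "0 \<le> z0" using pos by (simp add: z0_def)
  have diff: "\<bar>u - v\<bar> \<le> 1" if "0 \<le> u" "u \<le> 1" "0 \<le> v" "v \<le> 1" for u v :: real using that by linarith
  obtain D where D: "(\<omega> has_real_derivative D) (at z0 within {0..})"
    using regular_allocation_differentiable[OF z0] by blast
  have "\<bar>\<omega> z - \<omega> z0\<bar> \<le> 1" if "z \<in> {0..}" for z
    using that z0 regular_allocation_range[of z] regular_allocation_range[of z0] by (intro diff) auto
  from bounded_differentiable_lipschitz_at[OF D this]
  obtain C0 where C0: "0 \<le> C0" "\<And>z. 0 \<le> z \<Longrightarrow> \<bar>\<omega> z - \<omega> z0\<bar> \<le> C0 * \<bar>z - z0\<bar>" by auto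
  \<comment> \<open>The first summand serves the region y < y0 / 2; the other two are the
    coefficients of |x - x0| and |y - y0| in the linearised quotient.\<close>
  define C where "C = 2 / y0 + 2 * C0 / y0 + 2 * C0 * z0 / y0"
  have C: "0 \<le> C" using C0 z0 pos by (simp add: C_def)
  have "\<bar>mean_field_allocation \<omega> x y - \<omega> z0\<bar> \<le> C * (\<bar>x - x0\<bar> + \<bar>y - y0\<bar>)" if xy: "0 \<le> x" "0 \<le> y" for x y
  proof (cases "y < y0 / 2")
    case True
    have "1 = 2 / y0 * (y0 / 2)" using pos by simp
    also have "\<dots> \<le> C * (\<bar>x - x0\<bar> + \<bar>y - y0\<bar>)"
    proof (rule mult_mono)
      show "2 / y0 \<le> C" using C0 z0 pos by (simp add: C_def)
      show "y0 / 2 \<le> \<bar>x - x0\<bar> + \<bar>y - y0\<bar>" using True by linarith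
    qed (use C pos in auto)
    finally show ?thesis
      using diff[of "mean_field_allocation \<omega> x y" "\<omega> z0"] mean_field_allocation_range[OF xy]
        regular_allocation_range[OF z0] by linarith
  next
    case False
    then have y: "0 < y" "y0 / 2 \<le> y" using pos by linarith+
    have e: "x / y - z0 = ((x - x0) - z0 * (y - y0)) / y"
      using y pos by (simp add: z0_def field_simps)
    have n: "\<bar>(x - x0) - z0 * (y - y0)\<bar> \<le> \<bar>x - x0\<bar> + z0 * \<bar>y - y0\<bar>"
      using abs_triangle_ineq4[of "x - x0" "z0 * (y - y0)"] z0 by (simp add: abs_mult)
    have "\<bar>x / y - z0\<bar> = \<bar>(x - x0) - z0 * (y - y0)\<bar> * (1 / y)"
      using y by (simp add: e)
    also have "\<dots> \<le> (\<bar>x - x0\<bar> + z0 * \<bar>y - y0\<bar>) * (2 / y0)"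
      using n y pos z0 by (intro mult_mono) (auto simp: field_simps)
    finally have "C0 * \<bar>x / y - z0\<bar> \<le> C0 * ((\<bar>x - x0\<bar> + z0 * \<bar>y - y0\<bar>) * (2 / y0))"
      by (rule mult_left_mono) (use C0 in auto)
    also have "\<dots> = 2 * C0 / y0 * \<bar>x - x0\<bar> + 2 * C0 * z0 / y0 * \<bar>y - y0\<bar>" by (simp add: algebra_simps)
    also have "\<dots> \<le> C * \<bar>x - x0\<bar> + C * \<bar>y - y0\<bar>"
      using C0 z0 pos by (intro add_mono mult_right_mono) (auto simp: C_def)
    finally show ?thesis using C0(2)[of "x / y"] xy y
      by (simp add: mean_field_allocation_def algebra_simps)
  qed
  with C show ?thesis unfolding z0_def by blast
qed

end

section \<open>Revenue estimates and a limit criterion\<close>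

lemma smooth_bounded_derivatives_lipschitz:
  assumes "smooth_bounded_derivatives_on {0..} r"
  shows "\<exists>K\<ge>0. \<forall>x\<ge>0. \<forall>y\<ge>0. \<bar>r x - r y\<bar> \<le> K * \<bar>x - y\<bar>"
proof -
  obtain g where g: "g 0 = r" "derivative_sequence {0..} g" "bounded (g 1 ` {0..})"
    using assms unfolding smooth_bounded_derivatives_on_def by auto
  then obtain K where K: "\<And>x. 0 \<le> x \<Longrightarrow> \<bar>g 1 x\<bar> \<le> K" unfolding bounded_iff by auto
  have der: "(r has_real_derivative g 1 x) (at x within {0..})" if "0 \<le> x" for x
    using g that unfolding derivative_sequence_def by (metis One_nat_def atLeast_iff)
  have *: "\<bar>r v - r u\<bar> \<le> K * (v - u)" if uv: "0 \<le> u" "u \<le> v" for u v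
  proof -
    obtain z where z: "u \<le> z" "r v - r u = (v - u) * g 1 z"
      using real_MVT_within_nonneg[OF der uv] by blast
    have "\<bar>r v - r u\<bar> = (v - u) * \<bar>g 1 z\<bar>" using z uv by (simp add: abs_mult)
    also have "\<dots> \<le> (v - u) * K" using K[of z] z uv by (intro mult_left_mono) auto
    finally show ?thesis by (simp add: mult.commute)
  qed
  have "\<bar>r x - r y\<bar> \<le> K * \<bar>x - y\<bar>" if "0 \<le> x" "0 \<le> y" for x y
    using *[of x y] *[of y x] that by (cases "x \<le> y") (auto simp: abs_minus_commute)
  moreover have "0 \<le> K" using K[of 0] by simp
  ultimately show ?thesis by blast
qed

text \<open>The outer factor y cancels the singularity of x / y: (r (x / y) - r z0) * y is at most K
  times |x - z0 * y|, whatever the size of y. At y = 0 this product is 0.\<close>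

lemma perspective_approx:
  fixes r :: "real \<Rightarrow> real"
  assumes lip: "\<And>x y. 0 \<le> x \<Longrightarrow> 0 \<le> y \<Longrightarrow> \<bar>r x - r y\<bar> \<le> K * \<bar>x - y\<bar>"
    and K: "0 \<le> K" and pos: "0 < x0" "0 < y0"
  shows "\<exists>C\<ge>0. \<forall>x\<ge>0. \<forall>y\<ge>0. \<bar>r (x / y) * y - r (x0 / y0) * y0\<bar> \<le> C * (\<bar>x - x0\<bar> + \<bar>y - y0\<bar>)"
proof -
  define z0 where "z0 = x0 / y0"
  have z0: "0 \<le> z0" using pos by (simp add: z0_def)
  define C where "C = K + K * z0 + \<bar>r z0\<bar>"
  have "\<bar>r (x / y) * y - r z0 * y0\<bar> \<le> C * (\<bar>x - x0\<bar> + \<bar>y - y0\<bar>)" if xy: "0 \<le> x" "0 \<le> y" for x y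
  proof -
    have 1: "\<bar>(r (x / y) - r z0) * y\<bar> \<le> K * (\<bar>x - x0\<bar> + z0 * \<bar>y - y0\<bar>)"
    proof (cases "y = 0")
      case False
      have "\<bar>(r (x / y) - r z0) * y\<bar> \<le> K * \<bar>x / y - z0\<bar> * y"
        using lip[of "x / y" z0] xy z0 by (simp add: abs_mult mult_right_mono)
      also have "\<dots> = K * \<bar>(x / y - z0) * y\<bar>" using xy by (simp add: abs_mult)
      also have "(x / y - z0) * y = (x - x0) - z0 * (y - y0)"
        using False pos by (simp add: z0_def field_simps)
      also have "K * \<bar>\<dots>\<bar> \<le> K * (\<bar>x - x0\<bar> + z0 * \<bar>y - y0\<bar>)"
        using abs_triangle_ineq4[of "x - x0" "z0 * (y - y0)"] z0 K
        by (intro mult_left_mono) (auto simp: abs_mult)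
      finally show ?thesis .
    qed (use K z0 in simp)
    have "r (x / y) * y - r z0 * y0 = (r (x / y) - r z0) * y + r z0 * (y - y0)"
      by (simp add: algebra_simps)
    then have "\<bar>r (x / y) * y - r z0 * y0\<bar> \<le> \<bar>(r (x / y) - r z0) * y\<bar> + \<bar>r z0\<bar> * \<bar>y - y0\<bar>"
      by (metis abs_mult abs_triangle_ineq)
    also have "\<dots> \<le> K * \<bar>x - x0\<bar> + (K * z0 + \<bar>r z0\<bar>) * \<bar>y - y0\<bar>"
      using 1 by (simp add: algebra_simps)
    also have "\<dots> \<le> C * \<bar>x - x0\<bar> + C * \<bar>y - y0\<bar>"
      using K z0 by (intro add_mono mult_right_mono) (auto simp: C_def)
    finally show ?thesis by (simp add: algebra_simps)
  qed
  moreover have "0 \<le> C" using K z0 by (simp add: C_def)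
  ultimately show ?thesis unfolding z0_def by blast
qed

text \<open>C may depend on \<epsilon>, so \<epsilon> is fixed first and only then g is sent to 0.
  This is how bounds of the form \<epsilon> plus C times a deviation become limits.\<close>

lemma tendsto_zero_by_deviation:
  fixes u g :: "nat \<Rightarrow> real"
  assumes g: "g \<longlonglongrightarrow> 0" and M: "0 \<le> M"
    and bound: "\<And>\<epsilon>. 0 < \<epsilon> \<Longrightarrow> \<exists>C. \<forall>\<^sub>F n in sequentially. \<bar>u n\<bar> \<le> M * (\<epsilon> + C * g n)"
  shows "u \<longlonglongrightarrow> 0"
proof (rule tendstoI)
  fix s :: real assume s: "0 < s"
  \<comment> \<open>The summand 1 keeps the denominator positive when M = 0.\<close>
  define \<epsilon> where "\<epsilon> = s / (2 * (M + 1))"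
  have \<epsilon>: "0 < \<epsilon>" using s M by (simp add: \<epsilon>_def)
  have M\<epsilon>: "M * (2 * \<epsilon>) < s" using s M by (simp add: \<epsilon>_def field_simps)
  obtain C where C: "\<forall>\<^sub>F n in sequentially. \<bar>u n\<bar> \<le> M * (\<epsilon> + C * g n)" using bound[OF \<epsilon>] by blast
  have "(\<lambda>n. C * g n) \<longlonglongrightarrow> C * 0" by (intro tendsto_intros g)
  then have "\<forall>\<^sub>F n in sequentially. C * g n < \<epsilon>" using \<epsilon> by (intro order_tendstoD) auto
  with C show "\<forall>\<^sub>F n in sequentially. dist (u n) 0 < s"
  proof eventually_elim
    case (elim n)
    have "M * (\<epsilon> + C * g n) \<le> M * (2 * \<epsilon>)" using elim(2) M by (intro mult_left_mono) auto
    then show ?case using elim(1) M\<epsilon> by simp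
  qed
qed

section \<open>One system with perturbed payments\<close>

text \<open>The random sign, not the payment, carries the two-point law, so the formula includes
  \<zeta> = 0, where the two atoms merge.\<close>

lemma integral_perturbed_payment:
  fixes h :: "real \<Rightarrow> real"
  assumes "h \<in> borel_measurable borel"
  shows "(\<integral>x. h x \<partial>perturbed_payment p \<zeta>) = (h (p + \<zeta>) + h (p - \<zeta>)) / 2"
proof -
  have "(\<integral>x. h x \<partial>perturbed_payment p \<zeta>) = (\<integral>\<epsilon>. h (p + \<zeta> * \<epsilon>) \<partial>measure_pmf (pmf_of_set {-1, 1}))"
    unfolding perturbed_payment_def by (rule integral_distr) (use assms in auto)
  also have "\<dots> = (\<Sum>\<epsilon>\<in>{-1, 1}. h (p + \<zeta> * \<epsilon>)) / real (card {-1, 1::real})"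
    by (rule integral_pmf_of_set) auto
  finally show ?thesis by (simp add: add.commute)
qed

lemma prob_space_perturbed_payment: "prob_space (perturbed_payment p \<zeta>)"
  unfolding perturbed_payment_def by (intro measure_pmf.prob_space_distr) simp

lemma sets_perturbed_payment: "sets (perturbed_payment p \<zeta>) = sets borel"
  by (simp add: perturbed_payment_def)

lemma payment_distribution_perturbed:
  assumes "0 \<le> \<zeta>" "\<zeta> < p"
  shows "payment_distribution (perturbed_payment p \<zeta>)"
proof -
  have "AE x in perturbed_payment p \<zeta>. 0 \<le> x"
    unfolding perturbed_payment_def
    by (subst AE_distr_iff) (use assms in \<open>auto simp: AE_measure_pmf_iff\<close>)
  then show ?thesis
    by (simp add: payment_distribution_def prob_space_perturbed_payment sets_perturbed_payment)
qed

section \<open>A fixed system in a fixed state: variables and measurability\<close>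

text \<open>The market size is fixed throughout, so all estimates here are non-asymptotic. The bound
  \<open>K\<^sub>\<Omega>\<close> makes the allocation integrable.\<close>

locale perturbed_system =
  equilibrium_system \<A> \<B> \<delta> \<nu> f \<Omega> n "perturbed_payment p \<zeta>" X
  for \<A> :: "'s set" and \<B> :: "'b measure" and \<delta> \<nu> f \<Omega> n p \<zeta>
    and X :: "('w, 's, 'b) system" +
  fixes a :: 's and K\<^sub>\<Omega> :: real
  assumes n_pos: "1 \<le> n"
    and state_mem: "a \<in> \<A>"
    and \<zeta>: "0 \<le> \<zeta>" "\<zeta> < p"
    and prob_\<delta>: "prob_space (\<delta> n a)"
    and sets_\<delta>: "sets (\<delta> n a) = sets borel"
    and prob_\<nu>: "prob_space (\<nu> a)"
    and sets_\<nu>: "sets (\<nu> a) = sets \<B>"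
    and allocation_nonneg: "\<And>x t. 0 \<le> x \<Longrightarrow> 0 \<le> t \<Longrightarrow> 0 \<le> \<Omega> x t"
    and allocation_mono: "\<And>x y t. 0 \<le> x \<Longrightarrow> x \<le> y \<Longrightarrow> 0 \<le> t \<Longrightarrow> \<Omega> x t \<le> \<Omega> y t"
    and allocation_bounded: "\<And>x t. 0 \<le> x \<Longrightarrow> 0 \<le> t \<Longrightarrow> \<Omega> x t \<le> K\<^sub>\<Omega>"
    and f_measurable: "\<And>x. 0 \<le> x \<Longrightarrow> (\<lambda>b. f b x) \<in> borel_measurable \<B>"
    and f_range: "\<And>b x. b \<in> space \<B> \<Longrightarrow> 0 \<le> x \<Longrightarrow> 0 \<le> f b x \<and> f b x \<le> 1"
begin

abbreviation "M \<equiv> conditional_law X a"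
abbreviation "D \<equiv> demand X"
abbreviation "num \<equiv> num_active n X"
abbreviation "e \<equiv> expected_allocation \<Omega> n X a"

text \<open>Probability that a given supplier is active, as \<open>expectation_active\<close>
  confirms; the two summands belong to the two signs of the perturbation.\<close>

definition q where
  "q = ((\<integral>b. f b ((p + \<zeta>) * e) \<partial>\<nu> a) + (\<integral>b. f b ((p - \<zeta>) * e) \<partial>\<nu> a)) / 2"

text \<open>Mean of payment times activity of one supplier, as
  \<open>expectation_payment_active\<close> confirms; the demand served is a separate
  factor.\<close>

definition payout where
  "payout = ((p + \<zeta>) * (\<integral>b. f b ((p + \<zeta>) * e) \<partial>\<nu> a) + (p - \<zeta>) * (\<integral>b. f b ((p - \<zeta>) * e) \<partial>\<nu> a)) / 2"

text \<open>Bounded everywhere, whereas \<open>payment\<close> is controlled only almost surely; p -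
  \<zeta> is the default value off the two atoms.\<close>

definition snap :: "real \<Rightarrow> real" where
  "snap x = (if x = p + \<zeta> then p + \<zeta> else p - \<zeta>)"

text \<open>
  \<open>f\<close> need not be jointly measurable; evaluating it at the snapped payment makes it so, and changes it
  on a null event only.
\<close>

definition choice :: "'b \<times> real \<Rightarrow> real" where
  "choice y = (if snd y = p + \<zeta> then f (fst y) ((p + \<zeta>) * e) else f (fst y) ((p - \<zeta>) * e))"

sublocale prob_space M
proof -
  let ?E = "{w \<in> space (sample X). state X w = a}"
  interpret S: prob_space "sample X" by (rule prob_space)
  show "prob_space M"
    unfolding conditional_law_def
    using state_pos[OF state_mem] by (intro prob_space_uniform_measure) (auto simp: S.emeasure_eq_measure)
qed

lemma space_M: "space M = space (sample X)"
  by (simp add: conditional_law_def)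

lemma sets_M [measurable_cong]: "sets M = sets (sample X)"
  by (simp add: conditional_law_def)

lemma measurable_D [measurable]: "D \<in> borel_measurable M"
  using demand_measurable by (simp add: measurable_cong_sets[OF sets_M refl])

lemma measurable_feature [measurable]: "i < n \<Longrightarrow> feature X i \<in> M \<rightarrow>\<^sub>M \<B>"
  using feature_measurable by (simp add: measurable_cong_sets[OF sets_M refl])

lemma measurable_payment [measurable]: "i < n \<Longrightarrow> payment X i \<in> borel_measurable M"
  using payment_measurable by (simp add: measurable_cong_sets[OF sets_M refl])

lemma measurable_active [measurable]: "i < n \<Longrightarrow> active X i \<in> borel_measurable M"
  using active_measurable by (simp add: measurable_cong_sets[OF sets_M refl])

lemma measurable_served [measurable]: "i < n \<Longrightarrow> served X i \<in> borel_measurable M"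
  using served_measurable by (simp add: measurable_cong_sets[OF sets_M refl])

lemma measurable_num [measurable]: "num \<in> borel_measurable M"
  unfolding num_active_def[abs_def] by measurable

lemma measurable_snap [measurable]: "snap \<in> borel_measurable borel"
  unfolding snap_def[abs_def] by measurable

lemma snap_bound: "0 \<le> snap x" "\<bar>snap x\<bar> \<le> 2 * p"
  using \<zeta> by (auto simp: snap_def)

lemma active_range: "i < n \<Longrightarrow> w \<in> space M \<Longrightarrow> active X i w = 0 \<or> active X i w = 1"
  using active_binary[of i w] by (simp add: space_M)

lemma num_nat:
  assumes w: "w \<in> space M"
  shows "\<exists>k\<le>n. num w = real k"
proof -
  have "\<exists>k\<le>m. (\<Sum>i<m. active X i w) = real k" if "m \<le> n" for m
    using that
  proof (induction m)
    case (Suc m)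
    then obtain k where "k \<le> m" "(\<Sum>i<m. active X i w) = real k" by auto
    moreover have "active X m w = real 0 \<or> active X m w = real 1" using active_range[OF _ w] Suc by simp
    ultimately have "(\<Sum>i<Suc m. active X i w) = real k \<or> (\<Sum>i<Suc m. active X i w) = real (Suc k)" by auto
    with \<open>k \<le> m\<close> show ?case by (metis Suc_le_mono le_Suc_eq)
  qed simp
  then show ?thesis by (simp add: num_active_def)
qed

lemma num_range: "w \<in> space M \<Longrightarrow> 0 \<le> num w" "w \<in> space M \<Longrightarrow> num w \<le> real n"
  using num_nat[of w] by auto

lemma demand_nonneg': "w \<in> space M \<Longrightarrow> 0 \<le> D w"
  using demand_nonneg by (simp add: space_M)

text \<open>F is measurable only in its first argument, but the number of active suppliers takes the
  finitely many values 0 to n, so the composition is a finite sum of slices.\<close>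

lemma measurable_of_demand_num:
  fixes F :: "real \<Rightarrow> real \<Rightarrow> real"
  assumes F: "\<And>t. 0 \<le> t \<Longrightarrow> (\<lambda>x. F x t) \<in> borel_measurable (restrict_space borel {0..})"
  shows "(\<lambda>w. F (D w) (num w)) \<in> borel_measurable M"
proof -
  have D: "D \<in> M \<rightarrow>\<^sub>M restrict_space borel {0..}"
    using demand_nonneg by (intro measurable_restrict_space2) (auto simp: space_M)
  have 1: "(\<lambda>w. F (D w) (real k)) \<in> borel_measurable M" for k
    using measurable_compose[OF D F[of "real k"]] by simp
  have "(\<lambda>w. \<Sum>k\<le>n. indicator {w\<in>space M. num w = real k} w * F (D w) (real k)) \<in> borel_measurable M"
    using 1 by (intro borel_measurable_sum borel_measurable_times borel_measurable_indicator) auto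
  moreover have "(\<Sum>k\<le>n. indicator {w\<in>space M. num w = real k} w * F (D w) (real k)) = F (D w) (num w)"
    if w: "w \<in> space M" for w
  proof -
    obtain m where m: "m \<le> n" "num w = real m" using num_nat[OF w] by blast
    have "(\<Sum>k\<le>n. indicator {w\<in>space M. num w = real k} w * F (D w) (real k))
        = (\<Sum>k\<le>n. if k = m then F (D w) (real k) else 0)"
      using m w by (intro sum.cong) (auto simp: indicator_def)
    then show ?thesis using m by simp
  qed
  ultimately show ?thesis by (subst measurable_cong) auto
qed

text \<open>Each slice of \<Omega> is Borel because it is monotone in the demand.\<close>

lemma measurable_allocation [measurable]: "(\<lambda>w. \<Omega> (D w) (num w)) \<in> borel_measurable M"
  by (rule measurable_of_demand_num) (auto intro!: borel_measurable_mono_on_fnc mono_onI allocation_mono)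

lemma allocation_range: "w \<in> space M \<Longrightarrow> 0 \<le> \<Omega> (D w) (num w)" "w \<in> space M \<Longrightarrow> \<Omega> (D w) (num w) \<le> K\<^sub>\<Omega>"
  using allocation_nonneg allocation_bounded demand_nonneg' num_range by auto

lemma e_nonneg: "0 \<le> e"
  unfolding expected_allocation_def
  by (rule integral_nonneg_AE) (use allocation_range in auto)

lemma space_\<nu>: "space (\<nu> a) = space \<B>"
  using sets_\<nu> by (rule sets_eq_imp_space_eq)

lemma measurable_choice [measurable]: "choice \<in> borel_measurable (\<B> \<Otimes>\<^sub>M borel)"
proof -
  have [measurable]: "(\<lambda>b. f b ((p + \<zeta>) * e)) \<in> borel_measurable \<B>" "(\<lambda>b. f b ((p - \<zeta>) * e)) \<in> borel_measurable \<B>"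
    using \<zeta> e_nonneg by (auto intro!: f_measurable mult_nonneg_nonneg)
  show ?thesis unfolding choice_def[abs_def] by measurable
qed

lemma choice_bounds: "b \<in> space \<B> \<Longrightarrow> 0 \<le> choice (b, x) \<and> choice (b, x) \<le> 1"
  using \<zeta> e_nonneg f_range unfolding choice_def by simp

lemma choice_abs: "b \<in> space \<B> \<Longrightarrow> \<bar>choice (b, x)\<bar> \<le> 1"
  using choice_bounds[of b x] by simp

lemma choice_values:
  "choice (b, p + \<zeta>) = f b ((p + \<zeta>) * e)" "choice (b, p - \<zeta>) = f b ((p - \<zeta>) * e)"
  by (auto simp: choice_def)

lemma snap_values: "snap (p + \<zeta>) = p + \<zeta>" "snap (p - \<zeta>) = p - \<zeta>"
  by (auto simp: snap_def)

section \<open>Independence of features and payments\<close>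

lemma measurable_primitives: "primitives n X \<in> M \<rightarrow>\<^sub>M primitives_space \<B> n"
  unfolding primitives_def[abs_def] primitives_space_def
  by (intro measurable_Pair measurable_restrict) auto

lemma distr_demand: "distr M borel D = \<delta> n a"
proof -
  interpret \<delta>: prob_space "\<delta> n a" by (rule prob_\<delta>)
  interpret \<pi>: prob_space "perturbed_payment p \<zeta>" by (rule prob_space_perturbed_payment)
  interpret \<nu>: prob_space "\<nu> a" by (rule prob_\<nu>)
  interpret PN: prob_space "\<Pi>\<^sub>M i\<in>{..<n}. \<nu> a" by (intro prob_space_PiM prob_\<nu>)
  interpret PP: prob_space "\<Pi>\<^sub>M i\<in>{..<n}. perturbed_payment p \<zeta>" by (intro prob_space_PiM prob_space_perturbed_payment)
  interpret N: pair_prob_space "\<Pi>\<^sub>M i\<in>{..<n}. \<nu> a" "\<Pi>\<^sub>M i\<in>{..<n}. perturbed_payment p \<zeta>" ..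
  let ?N = "(\<Pi>\<^sub>M i\<in>{..<n}. \<nu> a) \<Otimes>\<^sub>M (\<Pi>\<^sub>M i\<in>{..<n}. perturbed_payment p \<zeta>)"
  have "distr M borel D = distr M borel (fst \<circ> primitives n X)"
    by (simp add: primitives_def comp_def)
  also have "\<dots> = distr (distr M (primitives_space \<B> n) (primitives n X)) borel fst"
    by (rule distr_distr[symmetric, OF _ measurable_primitives]) (simp add: primitives_space_def)
  also have "\<dots> = distr (\<delta> n a \<Otimes>\<^sub>M ?N) (\<delta> n a) fst"
    unfolding primitives_law[OF state_mem] by (rule distr_cong) (auto simp: sets_\<delta>)
  also have "\<dots> = \<delta> n a" by (rule N.P.distr_pair_fst)
  finally show ?thesis .
qed

text \<open>Fubini on the product law given by \<open>primitives_law\<close>; boundedness supplies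
  the integrability. The factors may depend on i, so constant factors 1 later reduce this to one or
  two suppliers.\<close>

lemma expectation_prod_feature_payment:
  fixes g :: "nat \<Rightarrow> 'b \<times> real \<Rightarrow> real"
  assumes meas [measurable]: "\<And>i. i < n \<Longrightarrow> g i \<in> borel_measurable (\<B> \<Otimes>\<^sub>M borel)"
    and bound: "\<And>i b x. i < n \<Longrightarrow> b \<in> space \<B> \<Longrightarrow> \<bar>g i (b, x)\<bar> \<le> c"
  shows "(\<integral>w. (\<Prod>i<n. g i (feature X i w, payment X i w)) \<partial>M)
    = (\<Prod>i<n. ((\<integral>b. g i (b, p + \<zeta>) \<partial>\<nu> a) + (\<integral>b. g i (b, p - \<zeta>) \<partial>\<nu> a)) / 2)"
proof -
  let ?\<pi> = "perturbed_payment p \<zeta>"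
  interpret \<delta>: prob_space "\<delta> n a" by (rule prob_\<delta>)
  interpret \<pi>: prob_space ?\<pi> by (rule prob_space_perturbed_payment)
  interpret \<nu>: prob_space "\<nu> a" by (rule prob_\<nu>)
  let ?PN = "\<Pi>\<^sub>M i\<in>{..<n}. \<nu> a"
  let ?PP = "\<Pi>\<^sub>M i\<in>{..<n}. ?\<pi>"
  interpret PN: prob_space ?PN by (intro prob_space_PiM prob_\<nu>)
  interpret PP: prob_space ?PP by (intro prob_space_PiM prob_space_perturbed_payment)
  interpret N: pair_prob_space ?PN ?PP ..
  interpret DN: pair_prob_space "\<delta> n a" "?PN \<Otimes>\<^sub>M ?PP" ..
  interpret sN: product_sigma_finite "\<lambda>_::nat. \<nu> a" ..
  interpret sP: product_sigma_finite "\<lambda>_::nat. ?\<pi>" ..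
  let ?g = "\<lambda>(bs, xs). \<Prod>i<n. g i (bs i, xs i)"
  let ?G = "\<lambda>(y, z). ?g z"
  have gm: "?g \<in> borel_measurable (?PN \<Otimes>\<^sub>M ?PP)"
    unfolding case_prod_beta
  proof (intro borel_measurable_prod)
    fix i assume i: "i \<in> {..<n}"
    have "(\<lambda>y. y i) \<in> ?PN \<rightarrow>\<^sub>M \<B>" "(\<lambda>y. y i) \<in> borel_measurable ?PP"
      using measurable_component_singleton[OF i, of "\<lambda>_. \<nu> a"]
        measurable_component_singleton[OF i, of "\<lambda>_. ?\<pi>"]
      by (simp_all only: measurable_cong_sets[OF refl sets_\<nu>] measurable_cong_sets[OF refl sets_perturbed_payment])
    with i show "(\<lambda>z. g i (fst z i, snd z i)) \<in> borel_measurable (?PN \<Otimes>\<^sub>M ?PP)"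
      by (intro measurable_compose[OF _ meas] measurable_Pair
          measurable_compose[OF measurable_fst] measurable_compose[OF measurable_snd]) auto
  qed
  have Gm: "?G \<in> borel_measurable (\<delta> n a \<Otimes>\<^sub>M (?PN \<Otimes>\<^sub>M ?PP))"
    using measurable_compose[OF measurable_snd gm, of "\<delta> n a"] by (simp add: case_prod_beta)
  have gb: "\<bar>?g (bs, xs)\<bar> \<le> c ^ n" if "bs \<in> space ?PN" for bs xs
  proof -
    have "\<bar>?g (bs, xs)\<bar> = (\<Prod>i<n. \<bar>g i (bs i, xs i)\<bar>)" by (simp add: abs_prod)
    also have "\<dots> \<le> (\<Prod>i<n. c)"
      using that by (intro prod_mono conjI bound) (auto simp: space_PiM space_\<nu>)
    finally show ?thesis by simp
  qed
  have gi: "integrable (?PN \<Otimes>\<^sub>M ?PP) ?g"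
    by (rule N.integrable_const_bound[where B = "c ^ n", OF _ gm])
      (auto intro!: AE_I2 simp: space_pair_measure gb[simplified])
  have Gi: "integrable (\<delta> n a \<Otimes>\<^sub>M (?PN \<Otimes>\<^sub>M ?PP)) ?G"
    by (rule DN.integrable_const_bound[where B = "c ^ n", OF _ Gm])
      (auto intro!: AE_I2 simp: space_pair_measure gb[simplified])
  have gib: "integrable (\<nu> a) (\<lambda>b. g i (b, x))" if "i < n" for i x
  proof (rule \<nu>.integrable_const_bound[where B = c])
    show "(\<lambda>b. g i (b, x)) \<in> borel_measurable (\<nu> a)"
      using that unfolding measurable_cong_sets[OF sets_\<nu> refl] by measurable
  qed (use that in \<open>auto intro!: AE_I2 bound simp: space_\<nu>\<close>)
  have gix: "integrable ?\<pi> (\<lambda>x. g i (b, x))" if "i < n" "b \<in> space \<B>" for i b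
  proof (rule \<pi>.integrable_const_bound[where B = c])
    show "(\<lambda>x. g i (b, x)) \<in> borel_measurable ?\<pi>"
      using that unfolding measurable_cong_sets[OF sets_perturbed_payment refl] by measurable
  qed (use that in \<open>auto intro!: AE_I2 bound\<close>)
  have inner: "(\<integral>x. g i (b, x) \<partial>?\<pi>) = (g i (b, p + \<zeta>) + g i (b, p - \<zeta>)) / 2"
    if "i < n" "b \<in> space \<B>" for i b
    using that by (intro integral_perturbed_payment) (auto intro!: measurable_compose[OF _ meas])
  have "(\<integral>w. (\<Prod>i<n. g i (feature X i w, payment X i w)) \<partial>M) = (\<integral>w. ?G (primitives n X w) \<partial>M)"
    by (intro Bochner_Integration.integral_cong refl) (simp add: primitives_def)
  also have "\<dots> = (\<integral>z. ?G z \<partial>distr M (primitives_space \<B> n) (primitives n X))"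
    using Gm
    by (intro integral_distr[symmetric, OF measurable_primitives])
      (simp add: primitives_law[OF state_mem, symmetric] flip: measurable_distr_eq1)
  also have "\<dots> = (\<integral>y. (\<integral>z. ?G (y, z) \<partial>(?PN \<Otimes>\<^sub>M ?PP)) \<partial>\<delta> n a)"
    unfolding primitives_law[OF state_mem] by (rule DN.integral_fst'[symmetric, OF Gi])
  \<comment> \<open>The integrand does not involve the demand, whose law has total mass 1.\<close>
  also have "\<dots> = (\<integral>z. ?g z \<partial>(?PN \<Otimes>\<^sub>M ?PP))" by (simp add: \<delta>.prob_space)
  also have "\<dots> = (\<integral>bs. (\<integral>xs. ?g (bs, xs) \<partial>?PP) \<partial>?PN)" by (rule N.integral_fst'[symmetric, OF gi])
  also have "\<dots> = (\<integral>bs. (\<Prod>i<n. (g i (bs i, p + \<zeta>) + g i (bs i, p - \<zeta>)) / 2) \<partial>?PN)"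
  proof (intro Bochner_Integration.integral_cong refl)
    fix bs assume bs: "bs \<in> space ?PN"
    then have bi: "bs i \<in> space \<B>" if "i < n" for i using that by (auto simp: space_PiM space_\<nu>)
    have "(\<integral>xs. (\<Prod>i<n. g i (bs i, xs i)) \<partial>?PP) = (\<Prod>i<n. \<integral>x. g i (bs i, x) \<partial>?\<pi>)"
      using gix bi by (intro sP.product_integral_prod) auto
    also have "\<dots> = (\<Prod>i<n. (g i (bs i, p + \<zeta>) + g i (bs i, p - \<zeta>)) / 2)"
      using inner bi by (intro prod.cong) auto
    finally show "(\<integral>xs. ?g (bs, xs) \<partial>?PP) = (\<Prod>i<n. (g i (bs i, p + \<zeta>) + g i (bs i, p - \<zeta>)) / 2)" by simp
  qed
  also have "\<dots> = (\<Prod>i<n. \<integral>b. (g i (b, p + \<zeta>) + g i (b, p - \<zeta>)) / 2 \<partial>\<nu> a)"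
    using gib by (intro sN.product_integral_prod) auto
  also have "\<dots> = (\<Prod>i<n. ((\<integral>b. g i (b, p + \<zeta>) \<partial>\<nu> a) + (\<integral>b. g i (b, p - \<zeta>) \<partial>\<nu> a)) / 2)"
    using gib by (intro prod.cong refl) simp
  finally show ?thesis .
qed

lemma expectation_feature_payment:
  fixes g :: "'b \<times> real \<Rightarrow> real"
  assumes i: "i < n" and meas [measurable]: "g \<in> borel_measurable (\<B> \<Otimes>\<^sub>M borel)"
    and bound: "\<And>b x. b \<in> space \<B> \<Longrightarrow> \<bar>g (b, x)\<bar> \<le> c"
  shows "(\<integral>w. g (feature X i w, payment X i w) \<partial>M)
    = ((\<integral>b. g (b, p + \<zeta>) \<partial>\<nu> a) + (\<integral>b. g (b, p - \<zeta>) \<partial>\<nu> a)) / 2"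
proof -
  interpret \<nu>: prob_space "\<nu> a" by (rule prob_\<nu>)
  let ?g = "\<lambda>k y. if k = i then g y else 1"
  have "(\<integral>w. g (feature X i w, payment X i w) \<partial>M)
      = (\<integral>w. (\<Prod>k<n. ?g k (feature X k w, payment X k w)) \<partial>M)"
    using i by (simp add: prod.delta)
  also have "\<dots> = (\<Prod>k<n. ((\<integral>b. ?g k (b, p + \<zeta>) \<partial>\<nu> a) + (\<integral>b. ?g k (b, p - \<zeta>) \<partial>\<nu> a)) / 2)"
    \<comment> \<open>The common bound must also cover the constant factors 1.\<close>
    by (rule expectation_prod_feature_payment[where c = "max 1 c"])
      (auto simp: le_max_iff_disj bound)
  also have "\<dots> = (\<Prod>k<n. if k = i then ((\<integral>b. g (b, p + \<zeta>) \<partial>\<nu> a) + (\<integral>b. g (b, p - \<zeta>) \<partial>\<nu> a)) / 2 else 1)"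
    by (intro prod.cong) (auto simp: \<nu>.prob_space)
  finally show ?thesis using i by (simp add: prod.delta)
qed

lemma expectation_feature_payment_pair:
  fixes g :: "'b \<times> real \<Rightarrow> real"
  assumes i: "i < n" "j < n" "i \<noteq> j" and meas [measurable]: "g \<in> borel_measurable (\<B> \<Otimes>\<^sub>M borel)"
    and bound: "\<And>b x. b \<in> space \<B> \<Longrightarrow> \<bar>g (b, x)\<bar> \<le> c"
  shows "(\<integral>w. g (feature X i w, payment X i w) * g (feature X j w, payment X j w) \<partial>M)
    = (((\<integral>b. g (b, p + \<zeta>) \<partial>\<nu> a) + (\<integral>b. g (b, p - \<zeta>) \<partial>\<nu> a)) / 2)\<^sup>2"
proof -
  interpret \<nu>: prob_space "\<nu> a" by (rule prob_\<nu>)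
  let ?g = "\<lambda>k y. if k \<in> {i, j} then g y else 1"
  have two: "(\<Prod>k<n. if k \<in> {i, j} then h k else 1) = h i * h j" for h :: "nat \<Rightarrow> real"
    using i by (subst prod.inter_restrict[symmetric]) (auto simp: Int_absorb1)
  have "(\<integral>w. g (feature X i w, payment X i w) * g (feature X j w, payment X j w) \<partial>M)
      = (\<integral>w. (\<Prod>k<n. ?g k (feature X k w, payment X k w)) \<partial>M)"
    by (subst two) simp
  also have "\<dots> = (\<Prod>k<n. ((\<integral>b. ?g k (b, p + \<zeta>) \<partial>\<nu> a) + (\<integral>b. ?g k (b, p - \<zeta>) \<partial>\<nu> a)) / 2)"
    by (rule expectation_prod_feature_payment[where c = "max 1 c"])
      (auto simp: le_max_iff_disj bound)
  also have "\<dots> = (\<Prod>k<n. if k \<in> {i, j} then ((\<integral>b. g (b, p + \<zeta>) \<partial>\<nu> a) + (\<integral>b. g (b, p - \<zeta>) \<partial>\<nu> a)) / 2 else 1)"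
    by (intro prod.cong) (auto simp: \<nu>.prob_space)
  also have "\<dots> = (((\<integral>b. g (b, p + \<zeta>) \<partial>\<nu> a) + (\<integral>b. g (b, p - \<zeta>) \<partial>\<nu> a)) / 2)\<^sup>2"
    by (subst two) (simp add: power2_eq_square)
  finally show ?thesis .
qed

text \<open>\<open>snap\<close> fixes both atoms, so the indicator that it changes the payment has
  mean 0 and vanishes almost everywhere.\<close>

lemma AE_payment:
  assumes i: "i < n"
  shows "AE w in M. payment X i w = snap (payment X i w)"
proof -
  let ?g = "\<lambda>y::'b \<times> real. if snd y = snap (snd y) then 0 else (1::real)"
  have "(\<integral>w. ?g (feature X i w, payment X i w) \<partial>M)
    = ((\<integral>b. ?g (b, p + \<zeta>) \<partial>\<nu> a) + (\<integral>b. ?g (b, p - \<zeta>) \<partial>\<nu> a)) / 2"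
    by (rule expectation_feature_payment[where c = 1, OF i]) auto
  also have "\<dots> = 0" by (simp add: snap_values)
  finally have 0: "(\<integral>w. ?g (feature X i w, payment X i w) \<partial>M) = 0" .
  have "integrable M (\<lambda>w. ?g (feature X i w, payment X i w))"
    using i by (intro integrable_const_bound[where B = 1]) auto
  from integral_nonneg_eq_0_iff_AE[OF this] 0
  have "AE w in M. ?g (feature X i w, payment X i w) = 0" by auto
  then show ?thesis by eventually_elim (simp split: if_splits)
qed

section \<open>Activity decisions given the primitives\<close>

text \<open>Conditional probability that supplier i is active given the primitives; by
  \<open>AE_choice\<close> it agrees almost surely with the value of f in the choice model.\<close>

definition Q :: "nat \<Rightarrow> 'w \<Rightarrow> real" where
  "Q i w = choice (feature X i w, payment X i w)"

lemma measurable_Q [measurable]: "i < n \<Longrightarrow> Q i \<in> borel_measurable M"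
  using measurable_compose[OF measurable_Pair[OF measurable_feature measurable_payment] measurable_choice]
  by (simp add: Q_def[abs_def])

lemma Q_range:
  assumes "i < n" "w \<in> space M"
  shows "0 \<le> Q i w" "Q i w \<le> 1"
proof -
  have "feature X i w \<in> space \<B>" by (rule measurable_space[OF measurable_feature[OF assms(1)] assms(2)])
  from choice_bounds[OF this] show "0 \<le> Q i w" "Q i w \<le> 1" unfolding Q_def by auto
qed

lemma Q_abs: "i < n \<Longrightarrow> w \<in> space M \<Longrightarrow> \<bar>Q i w\<bar> \<le> 1"
  using Q_range[of i w] by simp

lemma AE_choice:
  "AE w in M. \<forall>i<n. f (feature X i w) (payment X i w * e) = Q i w"
proof -
  have "AE w in M. \<forall>i\<in>{..<n}. payment X i w = snap (payment X i w)"
    using AE_payment by (intro AE_finite_allI) auto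
  then show ?thesis
    by eventually_elim (auto simp: Q_def choice_def snap_def split: if_splits)
qed

lemma subalgebra_primitives: "finite_measure_subalgebra M (sigma_primitives \<B> n X)"
proof
  show "subalgebra M (sigma_primitives \<B> n X)"
    unfolding subalgebra_def sigma_primitives_def space_M[symmetric]
  proof (intro conjI)
    show "sets (vimage_algebra (space M) (primitives n X) (primitives_space \<B> n)) \<subseteq> sets M"
      using measurable_primitives measurable_space[OF measurable_primitives]
      by (subst sets_vimage_algebra2) (auto dest: measurable_sets)
  qed simp
qed

lemma measurable_payment_primitives:
  assumes i: "i < n"
  shows "payment X i \<in> borel_measurable (sigma_primitives \<B> n X)"
proof -
  have 1: "primitives n X \<in> sigma_primitives \<B> n X \<rightarrow>\<^sub>M primitives_space \<B> n"
    unfolding sigma_primitives_def space_M[symmetric]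
    using measurable_space[OF measurable_primitives] by (intro measurable_vimage_algebra1) auto
  have 2: "(\<lambda>z. snd (snd z) i) \<in> borel_measurable (primitives_space \<B> n)"
    unfolding primitives_space_def using i by (intro measurable_compose[OF measurable_compose[OF measurable_snd measurable_snd]]
        measurable_component_singleton) auto
  have "payment X i = (\<lambda>w. snd (snd (primitives n X w)) i)"
    using i by (simp add: primitives_def fun_eq_iff)
  with measurable_compose[OF 1 2] show ?thesis by simp
qed

definition active_set :: "'w \<Rightarrow> nat set" where
  "active_set w = {i\<in>{..<n}. active X i w = 1}"

lemma sets_active_set: "{w\<in>space M. active_set w = J} \<in> sets M"
proof -
  have "{w\<in>space M. active_set w = J} =
      (if J \<subseteq> {..<n} then {w\<in>space M. \<forall>i\<in>{..<n}. (i \<in> J) = (active X i w = 1)} else {})"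
    by (auto simp: active_set_def)
  also have "\<dots> \<in> sets M"
  proof (cases "J \<subseteq> {..<n}")
    case True
    have "{w\<in>space M. \<forall>i\<in>{..<n}. (i \<in> J) = (active X i w = 1)} \<in> sets M"
      by (intro sets.sets_Collect_finite_All) auto
    with True show ?thesis by simp
  qed simp
  finally show ?thesis .
qed

text \<open>\<phi> is measurable for the primitives, so it can be pulled out of the conditional
  expectation that \<open>choices\<close> evaluates.\<close>

lemma expectation_active_set:
  assumes J: "J \<subseteq> {..<n}" and \<phi>: "\<phi> \<in> borel_measurable (sigma_primitives \<B> n X)"
    and bound: "\<And>w. w \<in> space M \<Longrightarrow> \<bar>\<phi> w\<bar> \<le> c"
  shows "(\<integral>w. \<phi> w * indicat_real {v\<in>space M. active_set v = J} w \<partial>M)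
    = (\<integral>w. \<phi> w * (\<Prod>i<n. if i \<in> J then Q i w else 1 - Q i w) \<partial>M)"
proof -
  interpret S: finite_measure_subalgebra M "sigma_primitives \<B> n X" by (rule subalgebra_primitives)
  have [measurable]: "\<phi> \<in> borel_measurable M" by (rule measurable_from_subalg[OF S.subalg \<phi>])
  note [measurable] = sets_active_set
  have int: "integrable M (\<lambda>w. \<phi> w * indicat_real {v\<in>space M. active_set v = J} w)"
  proof (rule integrable_const_bound[where B = c])
    show "AE w in M. norm (\<phi> w * indicat_real {v\<in>space M. active_set v = J} w) \<le> c"
    proof (intro AE_I2)
      fix w assume "w \<in> space M"
      from bound[OF this] order_trans[OF abs_ge_zero bound[OF this]]
      show "norm (\<phi> w * indicat_real {v\<in>space M. active_set v = J} w) \<le> c" by (simp add: indicator_def)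
    qed
  qed measurable
  have "(\<integral>w. \<phi> w * indicat_real {v\<in>space M. active_set v = J} w \<partial>M)
      = (\<integral>w. \<phi> w * real_cond_exp M (sigma_primitives \<B> n X) (indicat_real {v\<in>space M. active_set v = J}) w \<partial>M)"
    by (rule S.real_cond_exp_intg(2)[symmetric, OF int \<phi>]) measurable
  also have "\<dots> = (\<integral>w. \<phi> w * (\<Prod>i<n. if i \<in> J then Q i w else 1 - Q i w) \<partial>M)"
  proof (rule integral_cong_AE)
    show "AE w in M. \<phi> w * real_cond_exp M (sigma_primitives \<B> n X) (indicat_real {v\<in>space M. active_set v = J}) w
      = \<phi> w * (\<Prod>i<n. if i \<in> J then Q i w else 1 - Q i w)"
      using choices[OF state_mem J] AE_choice
    proof eventually_elim
      case (elim w)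
      have "real_cond_exp M (sigma_primitives \<B> n X) (indicat_real {v\<in>space M. active_set v = J}) w
        = (\<Prod>i<n. let q = f (feature X i w) (payment X i w * e) in if i \<in> J then q else 1 - q)"
        using elim(1) by (simp add: active_set_def space_M)
      also have "\<dots> = (\<Prod>i<n. if i \<in> J then Q i w else 1 - Q i w)"
        using elim(2) by (intro prod.cong) (auto simp: Let_def)
      finally show ?case by simp
    qed
    show "(\<lambda>w. \<phi> w * real_cond_exp M (sigma_primitives \<B> n X) (indicat_real {v\<in>space M. active_set v = J}) w)
      \<in> borel_measurable M"
      by (intro borel_measurable_times borel_measurable_cond_exp2) measurable
    show "(\<lambda>w. \<phi> w * (\<Prod>i<n. if i \<in> J then Q i w else 1 - Q i w)) \<in> borel_measurable M"
      by (intro borel_measurable_times borel_measurable_prod) auto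
  qed
  finally show ?thesis .
qed

text \<open>All suppliers in S are inactive exactly when the active set J is contained in the
  complement of S. Summing the conditional probabilities over these J integrates out the other
  suppliers. Stating this for inactivity keeps the family of sets J a full power set.\<close>

lemma expectation_inactive:
  assumes S: "S \<subseteq> {..<n}" and \<phi>: "\<phi> \<in> borel_measurable (sigma_primitives \<B> n X)"
    and bound: "\<And>w. w \<in> space M \<Longrightarrow> \<bar>\<phi> w\<bar> \<le> c"
  shows "(\<integral>w. \<phi> w * (\<Prod>i\<in>S. 1 - active X i w) \<partial>M) = (\<integral>w. \<phi> w * (\<Prod>i\<in>S. 1 - Q i w) \<partial>M)"
proof -
  interpret F: finite_measure_subalgebra M "sigma_primitives \<B> n X" by (rule subalgebra_primitives)
  have [measurable]: "\<phi> \<in> borel_measurable M" by (rule measurable_from_subalg[OF F.subalg \<phi>])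
  note [measurable] = sets_active_set
  let ?R = "{..<n} - S"
  let ?q = "\<lambda>J w. \<Prod>i<n. if i \<in> J then Q i w else 1 - Q i w"
  have fin: "finite S" using S finite_subset by blast
  have c0: "\<bar>\<phi> w * x\<bar> \<le> c" if "w \<in> space M" "\<bar>x\<bar> \<le> 1" for w x
    using mult_mono[OF bound[OF that(1)] that(2)] order_trans[OF abs_ge_zero bound[OF that(1)]]
    by (simp add: abs_mult)
  have i1: "integrable M (\<lambda>w. \<phi> w * indicat_real {v\<in>space M. active_set v = J} w)" for J
  proof (rule integrable_const_bound[where B = c])
    show "AE w in M. norm (\<phi> w * indicat_real {v\<in>space M. active_set v = J} w) \<le> c"
      unfolding real_norm_def by (intro AE_I2 c0) (auto simp: indicator_def)
  qed measurable
  have i2: "integrable M (\<lambda>w. \<phi> w * ?q J w)" for J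
  proof (rule integrable_const_bound[where B = c])
    have "\<bar>?q J w\<bar> \<le> 1" if "w \<in> space M" for w
      unfolding abs_prod using Q_range that by (intro prod_le_1) auto
    then show "AE w in M. norm (\<phi> w * ?q J w) \<le> c" by (intro AE_I2) (auto intro!: c0)
    show "(\<lambda>w. \<phi> w * ?q J w) \<in> borel_measurable M"
      by (intro borel_measurable_times borel_measurable_prod) auto
  qed
  \<comment> \<open>The product is 1 if no supplier in S is active and 0 otherwise; the sum picks
    out the one J equal to the active set.\<close>
  have act: "(\<Prod>i\<in>S. 1 - active X i w) = (\<Sum>J\<in>Pow ?R. indicat_real {v\<in>space M. active_set v = J} w)"
    if w: "w \<in> space M" for w
  proof -
    have "(\<Sum>J\<in>Pow ?R. indicat_real {v\<in>space M. active_set v = J} w)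
        = (\<Sum>J\<in>Pow ?R. if J = active_set w then 1 else 0)"
      using w by (intro sum.cong) (auto simp: indicator_def)
    also have "\<dots> = (if active_set w \<in> Pow ?R then 1 else 0)" by simp
    also have "\<dots> = (\<Prod>i\<in>S. 1 - active X i w)"
    proof (cases "active_set w \<in> Pow ?R")
      case True
      then have "1 - active X i w = 1" if "i \<in> S" for i
        using active_range[of i w] w S that by (auto simp: active_set_def)
      with True show ?thesis by (simp add: prod.neutral)
    next
      case False
      then obtain i where "i \<in> S" "active X i w = 1" by (auto simp: active_set_def)
      with False show ?thesis using fin by (auto intro!: prod_zero[symmetric])
    qed
    finally show ?thesis by simp
  qed
  \<comment> \<open>Expanding the product of Q + (1 - Q) = 1 over the complement of S shows that the
    weights of the subsets J add up to 1.\<close>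
  have Qsum: "(\<Sum>J\<in>Pow ?R. ?q J w) = (\<Prod>i\<in>S. 1 - Q i w)" for w
  proof -
    have "?q J w = (\<Prod>i\<in>S. 1 - Q i w) * ((\<Prod>i\<in>J. Q i w) * (\<Prod>i\<in>?R - J. 1 - Q i w))" if J: "J \<in> Pow ?R" for J
    proof -
      have "?q J w = (\<Prod>i\<in>{..<n} \<inter> J. Q i w) * (\<Prod>i\<in>{..<n} \<inter> - J. 1 - Q i w)"
        by (subst prod.If_cases) (auto simp: Int_def)
      also have "{..<n} \<inter> J = J" using J by auto
      also have "{..<n} \<inter> - J = S \<union> (?R - J)" using J S by auto
      also have "(\<Prod>i\<in>S \<union> (?R - J). 1 - Q i w) = (\<Prod>i\<in>S. 1 - Q i w) * (\<Prod>i\<in>?R - J. 1 - Q i w)"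
        using fin by (intro prod.union_disjoint) auto
      finally show ?thesis by (simp add: mult.left_commute)
    qed
    then have "(\<Sum>J\<in>Pow ?R. ?q J w)
        = (\<Sum>J\<in>Pow ?R. (\<Prod>i\<in>S. 1 - Q i w) * ((\<Prod>i\<in>J. Q i w) * (\<Prod>i\<in>?R - J. 1 - Q i w)))"
      by (intro sum.cong) auto
    also have "\<dots> = (\<Prod>i\<in>S. 1 - Q i w) * (\<Prod>i\<in>?R. Q i w + (1 - Q i w))"
      by (subst prod_add) (auto simp: sum_distrib_left)
    finally show ?thesis by simp
  qed
  have "(\<integral>w. \<phi> w * (\<Prod>i\<in>S. 1 - active X i w) \<partial>M)
      = (\<integral>w. (\<Sum>J\<in>Pow ?R. \<phi> w * indicat_real {v\<in>space M. active_set v = J} w) \<partial>M)"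
    using act by (intro Bochner_Integration.integral_cong refl) (simp add: sum_distrib_left)
  also have "\<dots> = (\<Sum>J\<in>Pow ?R. \<integral>w. \<phi> w * indicat_real {v\<in>space M. active_set v = J} w \<partial>M)"
    by (rule Bochner_Integration.integral_sum[OF i1])
  also have "\<dots> = (\<Sum>J\<in>Pow ?R. \<integral>w. \<phi> w * ?q J w \<partial>M)"
    by (intro sum.cong refl expectation_active_set[OF _ \<phi> bound]) auto
  also have "\<dots> = (\<integral>w. (\<Sum>J\<in>Pow ?R. \<phi> w * ?q J w) \<partial>M)"
    by (rule Bochner_Integration.integral_sum[OF i2, symmetric])
  also have "\<dots> = (\<integral>w. \<phi> w * (\<Prod>i\<in>S. 1 - Q i w) \<partial>M)"
    by (simp flip: sum_distrib_left add: Qsum)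
  finally show ?thesis .
qed

section \<open>Moments of the active fraction and of the payout\<close>

lemma integrable_active: "i < n \<Longrightarrow> integrable M (active X i)"
  by (rule integrable_const_bound[where B = 1]) (auto intro!: AE_I2 dest: active_range)

lemma integrable_Q: "i < n \<Longrightarrow> integrable M (Q i)"
  by (rule integrable_const_bound[where B = 1]) (auto intro!: AE_I2 Q_abs)

lemma integrable_choice_\<nu>: "integrable (\<nu> a) (\<lambda>b. choice (b, x))"
proof -
  interpret \<nu>: prob_space "\<nu> a" by (rule prob_\<nu>)
  have "(\<lambda>b. choice (b, x)) \<in> borel_measurable \<B>" by measurable
  then have "(\<lambda>b. choice (b, x)) \<in> borel_measurable (\<nu> a)"
    by (simp only: measurable_cong_sets[OF sets_\<nu> refl])
  then show ?thesis
    by (rule \<nu>.integrable_const_bound[where B = 1, rotated])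
      (auto intro!: AE_I2 choice_abs simp: space_\<nu>)
qed

lemma expectation_Q: "i < n \<Longrightarrow> (\<integral>w. Q i w \<partial>M) = q"
  unfolding Q_def
  by (subst expectation_feature_payment[where c = 1])
    (auto simp: q_def choice_values intro: choice_abs)

lemma expectation_active:
  assumes i: "i < n"
  shows "(\<integral>w. active X i w \<partial>M) = q"
proof -
  have "(\<integral>w. 1 - active X i w \<partial>M) = (\<integral>w. 1 - Q i w \<partial>M)"
    using expectation_inactive[of "{i}" "\<lambda>_. 1" 1] i by simp
  then show ?thesis using expectation_Q[OF i] integrable_active[OF i] integrable_Q[OF i]
    by (simp add: prob_space)
qed

text \<open>The expected allocation inside \<open>choice\<close> is a deterministic number, so
  distinct suppliers, having independent features and payments, decide independently.\<close>

lemma expectation_inactive_pair: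
  assumes i: "i < n" "j < n" "i \<noteq> j"
  shows "(\<integral>w. (1 - active X i w) * (1 - active X j w) \<partial>M) = (1 - q)\<^sup>2"
proof -
  interpret \<nu>: prob_space "\<nu> a" by (rule prob_\<nu>)
  have "(\<integral>w. (1 - active X i w) * (1 - active X j w) \<partial>M)
      = (\<integral>w. (1 - choice (feature X i w, payment X i w)) * (1 - choice (feature X j w, payment X j w)) \<partial>M)"
    using expectation_inactive[of "{i, j}" "\<lambda>_. 1" 1] i by (simp add: Q_def)
  also have "\<dots> = (((\<integral>b. 1 - choice (b, p + \<zeta>) \<partial>\<nu> a) + (\<integral>b. 1 - choice (b, p - \<zeta>) \<partial>\<nu> a)) / 2)\<^sup>2"
    by (rule expectation_feature_payment_pair[where c = 1 and g = "\<lambda>y. 1 - choice y", OF i])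
      (auto simp: abs_le_iff intro: order_trans[OF conjunct2[OF choice_bounds]] conjunct1[OF choice_bounds])
  also have "\<dots> = (1 - q)\<^sup>2"
    using integrable_choice_\<nu>[of "p + \<zeta>"] integrable_choice_\<nu>[of "p - \<zeta>"]
    unfolding choice_values by (simp add: q_def \<nu>.prob_space field_simps)
  finally show ?thesis .
qed

lemma expectation_payment_active:
  assumes i: "i < n"
  shows "(\<integral>w. snap (payment X i w) * active X i w \<partial>M) = payout"
proof -
  interpret \<nu>: prob_space "\<nu> a" by (rule prob_\<nu>)
  have \<phi>: "(\<lambda>w. snap (payment X i w)) \<in> borel_measurable (sigma_primitives \<B> n X)"
    by (rule measurable_compose[OF measurable_payment_primitives[OF i] measurable_snap])
  have b: "\<bar>snap x * y\<bar> \<le> 2 * p" if "\<bar>y\<bar> \<le> 1" for x y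
    using mult_mono[OF snap_bound(2)[of x] that] \<zeta> by (simp add: abs_mult)
  have i1: "integrable M (\<lambda>w. snap (payment X i w) * active X i w)"
    using i by (intro integrable_const_bound[where B = "2 * p"]) (auto intro!: AE_I2 b dest: active_range)
  have i2: "integrable M (\<lambda>w. snap (payment X i w) * Q i w)"
    using i by (intro integrable_const_bound[where B = "2 * p"]) (auto intro!: AE_I2 b Q_abs)
  have i3: "integrable M (\<lambda>w. snap (payment X i w))"
    using i snap_bound by (intro integrable_const_bound[where B = "2 * p"]) auto
  \<comment> \<open>The choice model is available for inactivity; subtracting from the mean of the
    snapped payment turns it into a statement about activity.\<close>
  have "(\<integral>w. snap (payment X i w) * (1 - active X i w) \<partial>M) = (\<integral>w. snap (payment X i w) * (1 - Q i w) \<partial>M)"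
    using expectation_inactive[of "{i}" _ "2 * p", OF _ \<phi>] snap_bound i by simp
  then have "(\<integral>w. snap (payment X i w) * active X i w \<partial>M)
      = (\<integral>w. snap (payment X i w) * choice (feature X i w, payment X i w) \<partial>M)"
    using i1 i2 i3 by (simp add: right_diff_distrib Q_def)
  also have "\<dots> = ((\<integral>b. snap (p + \<zeta>) * choice (b, p + \<zeta>) \<partial>\<nu> a) + (\<integral>b. snap (p - \<zeta>) * choice (b, p - \<zeta>) \<partial>\<nu> a)) / 2"
    using expectation_feature_payment[OF i, where c = "2 * p" and g = "\<lambda>y. snap (snd y) * choice y"]
    by (auto intro!: b choice_abs)
  also have "\<dots> = payout" by (simp add: payout_def choice_values snap_values)
  finally show ?thesis .
qed

lemma q_range: "0 \<le> q" "q \<le> 1"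
proof -
  have "0 < n" using n_pos by simp
  from expectation_Q[OF this] Q_range[OF this]
  show "0 \<le> q" "q \<le> 1"
    using integral_ge_const[OF integrable_Q[OF \<open>0 < n\<close>] AE_I2, of 0]
      integral_le_const[OF integrable_Q[OF \<open>0 < n\<close>] AE_I2, of 1] by auto
qed

text \<open>The centred activities are uncorrelated for distinct suppliers, so of the double sum
  only the n diagonal terms remain, each at most 1.\<close>

lemma expectation_num_deviation_square:
  "(\<integral>w. (num w / real n - q)\<^sup>2 \<partial>M) \<le> 1 / real n"
proof -
  let ?Y = "\<lambda>i w. active X i w - q"
  have Y: "\<bar>?Y i w\<bar> \<le> 1" if "i < n" "w \<in> space M" for i w
    using active_range[OF that] q_range by auto
  have YY: "\<bar>?Y i w * ?Y j w\<bar> \<le> 1" if "i < n" "j < n" "w \<in> space M" for i j w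
    using mult_mono[OF Y Y, of i w j w] that by (simp add: abs_mult)
  have iY: "integrable M (\<lambda>w. ?Y i w * ?Y j w)" if "i < n" "j < n" for i j
  proof (rule integrable_const_bound[where B = 1])
    show "AE w in M. norm (?Y i w * ?Y j w) \<le> 1"
      unfolding real_norm_def using that by (intro AE_I2 YY)
  qed (use that in measurable)
  have cov: "(\<integral>w. ?Y i w * ?Y j w \<partial>M) = 0" if ij: "i < n" "j < n" "i \<noteq> j" for i j
  proof -
    have ip: "integrable M (\<lambda>w. (1 - active X i w) * (1 - active X j w))"
    proof (rule integrable_const_bound[where B = 1])
      show "AE w in M. norm ((1 - active X i w) * (1 - active X j w)) \<le> 1"
      proof (intro AE_I2)
        fix w assume "w \<in> space M"
        then show "norm ((1 - active X i w) * (1 - active X j w)) \<le> 1"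
          using active_range[of i w] active_range[of j w] ij by auto
      qed
    qed (use ij in measurable)
    \<comment> \<open>Z - q equals (1 - q) - (1 - Z); this rewrites the covariance through
      inactivity, for which the pair formula is known.\<close>
    have "?Y i w * ?Y j w = (1 - active X i w) * (1 - active X j w)
        - (1 - q) * (1 - active X i w) - (1 - q) * (1 - active X j w) + (1 - q)\<^sup>2" for w
      by (simp add: algebra_simps power2_eq_square)
    then have "(\<integral>w. ?Y i w * ?Y j w \<partial>M) = (\<integral>w. (1 - active X i w) * (1 - active X j w)
        - (1 - q) * (1 - active X i w) - (1 - q) * (1 - active X j w) + (1 - q)\<^sup>2 \<partial>M)" by simp
    also have "\<dots> = (1 - q)\<^sup>2 - (1 - q) * (1 - q) - (1 - q) * (1 - q) + (1 - q)\<^sup>2"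
      using ip integrable_active ij by (simp add: expectation_inactive_pair expectation_active prob_space)
    finally show ?thesis by (simp add: power2_eq_square)
  qed
  have "(\<integral>w. (num w / real n - q)\<^sup>2 \<partial>M) = (\<integral>w. (\<Sum>i<n. \<Sum>j<n. ?Y i w * ?Y j w) / (real n)\<^sup>2 \<partial>M)"
  proof (intro Bochner_Integration.integral_cong refl)
    fix w
    have "num w / real n - q = (\<Sum>i<n. ?Y i w) / real n"
      using n_pos by (simp add: num_active_def sum_subtractf field_simps)
    then show "(num w / real n - q)\<^sup>2 = (\<Sum>i<n. \<Sum>j<n. ?Y i w * ?Y j w) / (real n)\<^sup>2"
      by (simp only: power_divide) (simp add: power2_eq_square sum_product)
  qed
  also have "\<dots> = (\<Sum>i<n. \<Sum>j<n. \<integral>w. ?Y i w * ?Y j w \<partial>M) / (real n)\<^sup>2"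
  proof -
    have "(\<integral>w. (\<Sum>i<n. \<Sum>j<n. ?Y i w * ?Y j w) \<partial>M) = (\<Sum>i<n. \<integral>w. (\<Sum>j<n. ?Y i w * ?Y j w) \<partial>M)"
      using iY by (intro Bochner_Integration.integral_sum Bochner_Integration.integrable_sum) auto
    also have "\<dots> = (\<Sum>i<n. \<Sum>j<n. \<integral>w. ?Y i w * ?Y j w \<partial>M)"
      using iY by (intro sum.cong refl Bochner_Integration.integral_sum) auto
    finally show ?thesis by simp
  qed
  also have "(\<Sum>i<n. \<Sum>j<n. \<integral>w. ?Y i w * ?Y j w \<partial>M) \<le> (\<Sum>i<n. \<Sum>j<n. if j = i then 1 else 0)"
  proof (intro sum_mono)
    fix i j assume "i \<in> {..<n}" "j \<in> {..<n}"
    then have ij: "i < n" "j < n" by auto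
    show "(\<integral>w. ?Y i w * ?Y j w \<partial>M) \<le> (if j = i then 1 else 0)"
    proof (cases "j = i")
      case True
      have "(\<integral>w. ?Y i w * ?Y j w \<partial>M) \<le> 1"
        using iY[OF ij] YY[OF ij] by (intro integral_le_const AE_I2) (auto simp: abs_le_iff)
      with True show ?thesis by simp
    qed (use cov ij in simp)
  qed
  also have "(\<Sum>i<n. \<Sum>j<n. if j = i then 1 else 0) = real n" by simp
  finally show ?thesis using n_pos by (simp add: power2_eq_square divide_right_mono)
qed

lemma integrable_num: "integrable M num"
  by (rule integrable_const_bound[where B = "real n"]) (auto intro!: AE_I2 simp: num_range)

text \<open>Jensen's inequality, obtained from the nonnegativity of the variance of |T / n -
  q|.\<close>

lemma expectation_num_deviation:
  "(\<integral>w. \<bar>num w / real n - q\<bar> \<partial>M) \<le> 1 / sqrt (real n)"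
proof -
  let ?Y = "\<lambda>w. \<bar>num w / real n - q\<bar>"
  have Y: "?Y w \<le> 1" if "w \<in> space M" for w
  proof -
    have "0 \<le> num w / real n" "num w / real n \<le> 1" using num_range[OF that] n_pos by auto
    then show ?thesis using q_range by (simp add: abs_le_iff)
  qed
  have i1: "integrable M ?Y" using integrable_num by auto
  have i2: "integrable M (\<lambda>w. (?Y w)\<^sup>2)"
    using Y by (intro integrable_const_bound[where B = 1]) (auto intro!: AE_I2 simp: abs_square_le_1)
  have "(\<integral>w. ?Y w \<partial>M)\<^sup>2 \<le> (\<integral>w. (?Y w)\<^sup>2 \<partial>M)"
    using variance_eq[OF i1 i2] variance_positive[of ?Y] by simp
  also have "\<dots> \<le> 1 / real n" using expectation_num_deviation_square by simp
  finally have "(\<integral>w. ?Y w \<partial>M) \<le> sqrt (1 / real n)" by (rule real_le_rsqrt)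
  then show ?thesis by (simp add: real_sqrt_divide)
qed

lemma expectation_demand_deviation:
  "(\<integral>w. \<bar>D w / real n - x\<bar> \<partial>M) = (\<integral>y. \<bar>y / real n - x\<bar> \<partial>\<delta> n a)"
  unfolding distr_demand[symmetric] by (rule integral_distr[symmetric]) auto

lemma integrable_demand:
  assumes "integrable (\<delta> n a) (\<lambda>x. x)"
  shows "integrable M D"
  using assms unfolding distr_demand[symmetric] by (subst (asm) integrable_distr_eq) auto

section \<open>Matching and expected payments\<close>

lemma subalgebra_matching: "finite_measure_subalgebra M (sigma_matching n X)"
  and measurable_payment_matching: "i < n \<Longrightarrow> payment X i \<in> borel_measurable (sigma_matching n X)"
proof -
  let ?m = "\<lambda>w. (demand X w, (\<lambda>i\<in>{..<n}. payment X i w), (\<lambda>i\<in>{..<n}. active X i w))"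
  let ?B = "borel \<Otimes>\<^sub>M ((\<Pi>\<^sub>M i\<in>{..<n}. borel) \<Otimes>\<^sub>M (\<Pi>\<^sub>M i\<in>{..<n}. borel))
      :: (real \<times> (nat \<Rightarrow> real) \<times> (nat \<Rightarrow> real)) measure"
  have m: "?m \<in> M \<rightarrow>\<^sub>M ?B" by (intro measurable_Pair measurable_restrict) auto
  show "finite_measure_subalgebra M (sigma_matching n X)"
  proof
    show "subalgebra M (sigma_matching n X)"
      unfolding subalgebra_def sigma_matching_def space_M[symmetric]
    proof (intro conjI)
      show "sets (vimage_algebra (space M) ?m ?B) \<subseteq> sets M"
        using m measurable_space[OF m] by (subst sets_vimage_algebra2) (auto dest: measurable_sets)
    qed simp
  qed
  show "payment X i \<in> borel_measurable (sigma_matching n X)" if i: "i < n"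
  proof -
    have 1: "?m \<in> sigma_matching n X \<rightarrow>\<^sub>M ?B"
      unfolding sigma_matching_def space_M[symmetric] using measurable_space[OF m] by (intro measurable_vimage_algebra1) auto
    have 2: "(\<lambda>z. fst (snd z) i) \<in> borel_measurable ?B"
      using i by (intro measurable_compose[OF measurable_compose[OF measurable_snd measurable_fst]]
          measurable_component_singleton) auto
    have "payment X i = (\<lambda>w. fst (snd (?m w)) i)" using i by (simp add: fun_eq_iff)
    with measurable_compose[OF 1 2] show ?thesis by simp
  qed
qed

text \<open>The snapped payment is bounded and measurable for the matching information, so the tower
  property replaces the demand served by its conditional mean \<Omega>.\<close>

lemma served_payment:
  assumes i: "i < n"
  shows "integrable M (\<lambda>w. payment X i w * active X i w * served X i w)"
    and "(\<integral>w. payment X i w * active X i w * served X i w \<partial>M)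
      = (\<integral>w. snap (payment X i w) * active X i w * \<Omega> (D w) (num w) \<partial>M)"
proof -
  interpret F: finite_measure_subalgebra M "sigma_matching n X" by (rule subalgebra_matching)
  have \<phi>: "(\<lambda>w. snap (payment X i w)) \<in> borel_measurable (sigma_matching n X)"
    by (rule measurable_compose[OF measurable_payment_matching[OF i] measurable_snap])
  have int: "integrable M (\<lambda>w. snap (payment X i w) * (active X i w * served X i w))"
  proof (rule Bochner_Integration.integrable_bound)
    show "integrable M (\<lambda>w. 2 * p * (active X i w * served X i w))"
      using served_integrable[OF state_mem i] by simp
    show "AE w in M. norm (snap (payment X i w) * (active X i w * served X i w))
        \<le> norm (2 * p * (active X i w * served X i w))"
      using snap_bound \<zeta> by (intro AE_I2) (auto simp: abs_mult intro!: mult_right_mono)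
  qed (use i in measurable)
  have AE: "AE w in M. payment X i w * active X i w * served X i w
      = snap (payment X i w) * (active X i w * served X i w)"
    using AE_payment[OF i] by eventually_elim simp
  show "integrable M (\<lambda>w. payment X i w * active X i w * served X i w)"
    using int AE i by (subst integrable_cong_AE[OF _ _ AE]) measurable
  have "(\<integral>w. payment X i w * active X i w * served X i w \<partial>M)
      = (\<integral>w. snap (payment X i w) * (active X i w * served X i w) \<partial>M)"
    using i by (intro integral_cong_AE AE) measurable
  also have "\<dots> = (\<integral>w. snap (payment X i w) *
      real_cond_exp M (sigma_matching n X) (\<lambda>v. active X i v * served X i v) w \<partial>M)"
    using i by (intro F.real_cond_exp_intg(2)[symmetric, OF int \<phi>]) measurable
  also have "\<dots> = (\<integral>w. snap (payment X i w) * active X i w * \<Omega> (D w) (num w) \<partial>M)"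
  proof (rule integral_cong_AE)
    show "AE w in M. snap (payment X i w) * real_cond_exp M (sigma_matching n X) (\<lambda>v. active X i v * served X i v) w
      = snap (payment X i w) * active X i w * \<Omega> (D w) (num w)"
      using matching[OF state_mem i] by eventually_elim simp
    show "(\<lambda>w. snap (payment X i w) * real_cond_exp M (sigma_matching n X) (\<lambda>v. active X i v * served X i v) w)
      \<in> borel_measurable M"
      using i by (intro borel_measurable_times borel_measurable_cond_exp2) measurable
    show "(\<lambda>w. snap (payment X i w) * active X i w * \<Omega> (D w) (num w)) \<in> borel_measurable M"
      using i by measurable
  qed
  finally show "(\<integral>w. payment X i w * active X i w * served X i w \<partial>M)
      = (\<integral>w. snap (payment X i w) * active X i w * \<Omega> (D w) (num w) \<partial>M)" .
qed

text \<open>Dominates the mean of |D / n - x0| + |T / n - y0|: demand fluctuation, sampling noise of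
  the active fraction, and distance of its mean from y0.\<close>

definition deviation :: "real \<Rightarrow> real \<Rightarrow> real" where
  "deviation x0 y0 = (\<integral>y. \<bar>y / real n - x0\<bar> \<partial>\<delta> n a) + 1 / sqrt (real n) + \<bar>q - y0\<bar>"

lemma scaled_range:
  assumes "w \<in> space M"
  shows "0 \<le> D w / real n" "0 \<le> num w / real n" "num w / real n \<le> 1"
    "real n * (D w / real n) = D w" "real n * (num w / real n) = num w"
  using assms demand_nonneg' num_range n_pos by auto

lemma integrable_allocation: "integrable M (\<lambda>w. \<Omega> (D w) (num w))"
  using allocation_range by (intro integrable_const_bound[where B = K\<^sub>\<Omega>]) (auto intro!: AE_I2)

lemma integrable_payment_allocation:
  assumes i: "i < n"
  shows "integrable M (\<lambda>w. snap (payment X i w) * active X i w * \<Omega> (D w) (num w))"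
proof (rule Bochner_Integration.integrable_bound)
  show "integrable M (\<lambda>w. 2 * p * \<Omega> (D w) (num w))" using integrable_allocation by simp
  show "AE w in M. norm (snap (payment X i w) * active X i w * \<Omega> (D w) (num w)) \<le> norm (2 * p * \<Omega> (D w) (num w))"
  proof (intro AE_I2)
    fix w assume w: "w \<in> space M"
    show "norm (snap (payment X i w) * active X i w * \<Omega> (D w) (num w)) \<le> norm (2 * p * \<Omega> (D w) (num w))"
      using active_range[OF i w] snap_bound[of "payment X i w"] \<zeta> by (auto simp: abs_mult intro!: mult_right_mono)
  qed
  show "(\<lambda>w. snap (payment X i w) * active X i w * \<Omega> (D w) (num w)) \<in> borel_measurable M"
    using i by measurable
qed

text \<open>Only active suppliers are paid, at most 2p per unit, so replacing \<Omega> by a constant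
  costs an error weighted by the active fraction. This weight is what saves the case q = 0, where
  \<Omega> itself is not approximated.\<close>

lemma payments_approx:
  "\<bar>(\<Sum>i<n. \<integral>w. payment X i w * active X i w * served X i w \<partial>M) / real n - payout * c\<bar>
    \<le> 2 * p * (\<integral>w. num w / real n * \<bar>\<Omega> (D w) (num w) - c\<bar> \<partial>M)"
proof -
  have iZ: "integrable M (\<lambda>w. active X i w * \<bar>\<Omega> (D w) (num w) - c\<bar>)" if i: "i < n" for i
  proof (rule Bochner_Integration.integrable_bound)
    show "integrable M (\<lambda>w. \<bar>\<Omega> (D w) (num w) - c\<bar>)" using integrable_allocation by simp
    show "AE w in M. norm (active X i w * \<bar>\<Omega> (D w) (num w) - c\<bar>) \<le> norm \<bar>\<Omega> (D w) (num w) - c\<bar>"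
    proof (intro AE_I2)
      fix w assume w: "w \<in> space M"
      show "norm (active X i w * \<bar>\<Omega> (D w) (num w) - c\<bar>) \<le> norm \<bar>\<Omega> (D w) (num w) - c\<bar>"
        using active_range[OF i w] by auto
    qed
    show "(\<lambda>w. active X i w * \<bar>\<Omega> (D w) (num w) - c\<bar>) \<in> borel_measurable M" using i by measurable
  qed
  have iP: "integrable M (\<lambda>w. snap (payment X i w) * active X i w)" if i: "i < n" for i
  proof (rule integrable_const_bound[where B = "2 * p"])
    show "AE w in M. norm (snap (payment X i w) * active X i w) \<le> 2 * p"
    proof (intro AE_I2)
      fix w assume w: "w \<in> space M"
      show "norm (snap (payment X i w) * active X i w) \<le> 2 * p"
        using active_range[OF i w] snap_bound[of "payment X i w"] \<zeta> by auto
    qed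
    show "(\<lambda>w. snap (payment X i w) * active X i w) \<in> borel_measurable M" using i by measurable
  qed
  have each: "\<bar>(\<integral>w. payment X i w * active X i w * served X i w \<partial>M) - payout * c\<bar>
      \<le> 2 * p * (\<integral>w. active X i w * \<bar>\<Omega> (D w) (num w) - c\<bar> \<partial>M)" if i: "i < n" for i
  proof -
    let ?h = "\<lambda>w. snap (payment X i w) * active X i w * (\<Omega> (D w) (num w) - c)"
    have "(\<integral>w. payment X i w * active X i w * served X i w \<partial>M) - payout * c
        = (\<integral>w. snap (payment X i w) * active X i w * \<Omega> (D w) (num w) \<partial>M)
          - (\<integral>w. snap (payment X i w) * active X i w * c \<partial>M)"
      using expectation_payment_active[OF i] served_payment(2)[OF i] by simp
    also have "\<dots> = (\<integral>w. ?h w \<partial>M)"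
      using integrable_payment_allocation[OF i] iP[OF i]
      by (subst Bochner_Integration.integral_diff[symmetric]) (auto simp: right_diff_distrib)
    finally have eq: "(\<integral>w. payment X i w * active X i w * served X i w \<partial>M) - payout * c = (\<integral>w. ?h w \<partial>M)" .
    have ih: "integrable M ?h"
      using integrable_payment_allocation[OF i] iP[OF i] by (simp add: right_diff_distrib)
    have "\<bar>\<integral>w. ?h w \<partial>M\<bar> \<le> (\<integral>w. \<bar>?h w\<bar> \<partial>M)" by (rule integral_abs_bound)
    also have "\<dots> \<le> (\<integral>w. 2 * p * (active X i w * \<bar>\<Omega> (D w) (num w) - c\<bar>) \<partial>M)"
    proof (rule integral_mono)
      fix w assume w: "w \<in> space M"
      show "\<bar>?h w\<bar> \<le> 2 * p * (active X i w * \<bar>\<Omega> (D w) (num w) - c\<bar>)"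
        using active_range[OF i w] snap_bound[of "payment X i w"] by (auto simp: abs_mult intro!: mult_right_mono)
    qed (use ih iZ[OF i] in auto)
    finally show ?thesis using eq by simp
  qed
  have "(\<Sum>i<n. \<integral>w. payment X i w * active X i w * served X i w \<partial>M) / real n - payout * c
      = (\<Sum>i<n. (\<integral>w. payment X i w * active X i w * served X i w \<partial>M) - payout * c) / real n"
    using n_pos by (simp add: sum_subtractf field_simps)
  also have "\<bar>\<dots>\<bar> \<le> (\<Sum>i<n. 2 * p * (\<integral>w. active X i w * \<bar>\<Omega> (D w) (num w) - c\<bar> \<partial>M)) / real n"
    unfolding abs_divide using each by (auto intro!: divide_right_mono order_trans[OF sum_abs] sum_mono)
  also have "\<dots> = 2 * p * (\<integral>w. (\<Sum>i<n. active X i w * \<bar>\<Omega> (D w) (num w) - c\<bar>) / real n \<partial>M)"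
  proof -
    have "(\<integral>w. (\<Sum>i<n. active X i w * \<bar>\<Omega> (D w) (num w) - c\<bar>) \<partial>M)
        = (\<Sum>i<n. \<integral>w. active X i w * \<bar>\<Omega> (D w) (num w) - c\<bar> \<partial>M)"
      using iZ by (intro Bochner_Integration.integral_sum) auto
    then show ?thesis by (simp add: sum_distrib_left)
  qed
  also have "(\<lambda>w. (\<Sum>i<n. active X i w * \<bar>\<Omega> (D w) (num w) - c\<bar>) / real n)
      = (\<lambda>w. num w / real n * \<bar>\<Omega> (D w) (num w) - c\<bar>)"
    by (simp add: num_active_def sum_distrib_right)
  finally show ?thesis .
qed

section \<open>Expected utility of one system\<close>

context
  assumes demand_int: "integrable (\<delta> n a) (\<lambda>x. x)"
begin

lemma integrable_deviation:
  assumes h: "h \<in> borel_measurable M"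
    and bound: "\<And>w. w \<in> space M \<Longrightarrow> \<bar>h w\<bar> \<le> c + C * (\<bar>D w / real n - x0\<bar> + \<bar>num w / real n - y0\<bar>)"
  shows "integrable M h"
proof (rule Bochner_Integration.integrable_bound[OF _ h])
  show "integrable M (\<lambda>w. c + C * (\<bar>D w / real n - x0\<bar> + \<bar>num w / real n - y0\<bar>))"
    using integrable_demand[OF demand_int] integrable_num by auto
  show "AE w in M. norm (h w) \<le> norm (c + C * (\<bar>D w / real n - x0\<bar> + \<bar>num w / real n - y0\<bar>))"
    using bound by (intro AE_I2) force
qed

text \<open>Triangle inequality through the mean q of the active fraction. The bound is one-sided
  because clamping the number of active suppliers yields a comparison in one direction only.\<close>

lemma expectation_le_deviation:
  assumes h: "integrable M h" and C: "0 \<le> C"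
    and bound: "\<And>w. w \<in> space M \<Longrightarrow> h w \<le> c + C * (\<bar>D w / real n - x0\<bar> + \<bar>num w / real n - y0\<bar>)"
  shows "(\<integral>w. h w \<partial>M) \<le> c + C * deviation x0 y0"
proof -
  have i: "integrable M (\<lambda>w. \<bar>D w / real n - x0\<bar>)" "integrable M (\<lambda>w. \<bar>num w / real n - q\<bar>)"
    using integrable_demand[OF demand_int] integrable_num by auto
  have "(\<integral>w. h w \<partial>M)
      \<le> (\<integral>w. c + C * (\<bar>D w / real n - x0\<bar> + (\<bar>num w / real n - q\<bar> + \<bar>q - y0\<bar>)) \<partial>M)"
  proof (rule integral_mono[OF h])
    show "integrable M (\<lambda>w. c + C * (\<bar>D w / real n - x0\<bar> + (\<bar>num w / real n - q\<bar> + \<bar>q - y0\<bar>)))"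
      using i by auto
    fix w assume "w \<in> space M"
    have "C * (\<bar>D w / real n - x0\<bar> + \<bar>num w / real n - y0\<bar>)
        \<le> C * (\<bar>D w / real n - x0\<bar> + (\<bar>num w / real n - q\<bar> + \<bar>q - y0\<bar>))"
      by (intro mult_left_mono[OF _ C]) linarith
    then show "h w \<le> c + C * (\<bar>D w / real n - x0\<bar> + (\<bar>num w / real n - q\<bar> + \<bar>q - y0\<bar>))"
      using bound[OF \<open>w \<in> space M\<close>] by linarith
  qed
  also have "\<dots> = c + C * ((\<integral>w. \<bar>D w / real n - x0\<bar> \<partial>M) + ((\<integral>w. \<bar>num w / real n - q\<bar> \<partial>M) + \<bar>q - y0\<bar>))"
    using i by (simp add: prob_space)
  also have "\<dots> \<le> c + C * deviation x0 y0"
    unfolding deviation_def expectation_demand_deviation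
    using expectation_num_deviation C by (intro add_left_mono mult_left_mono) auto
  finally show ?thesis .
qed

lemma abs_expectation_le_deviation:
  assumes h: "h \<in> borel_measurable M" and C: "0 \<le> C"
    and bound: "\<And>w. w \<in> space M \<Longrightarrow> \<bar>h w\<bar> \<le> c + C * (\<bar>D w / real n - x0\<bar> + \<bar>num w / real n - y0\<bar>)"
  shows "(\<integral>w. \<bar>h w\<bar> \<partial>M) \<le> c + C * deviation x0 y0" "\<bar>\<integral>w. h w \<partial>M\<bar> \<le> c + C * deviation x0 y0"
proof -
  have i: "integrable M (\<lambda>w. \<bar>h w\<bar>)" using integrable_deviation[OF h bound] by simp
  show "(\<integral>w. \<bar>h w\<bar> \<partial>M) \<le> c + C * deviation x0 y0"
    by (rule expectation_le_deviation[OF i C bound])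
  then show "\<bar>\<integral>w. h w \<partial>M\<bar> \<le> c + C * deviation x0 y0"
    using integral_abs_bound[of M h] by linarith
qed

text \<open>Reduces the probabilistic problem to two deterministic estimates in x = D / n and y = T
  / n, one for the revenue and one for the allocation weighted by y. Revenue contributes the 1 and
  payments the 2p in the constant; \<open>payout\<close> stays at its exact finite-n value.\<close>

lemma platform_utility_approx:
  assumes r: "continuous_on {0..} r"
    and lR: "\<And>t. 0 \<le> t \<Longrightarrow> (\<lambda>x. l\<^sub>R x t) \<in> borel_measurable (restrict_space borel {0..})"
    and C: "0 \<le> C"
    and B1: "\<And>x y. 0 \<le> x \<Longrightarrow> 0 \<le> y \<Longrightarrow> y \<le> 1 \<Longrightarrow>
      \<bar>revenue r l\<^sub>R (real n * x) (real n * y) / real n - \<rho>\<bar> \<le> \<epsilon> + C * (\<bar>x - x0\<bar> + \<bar>y - y0\<bar>)"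
    and B2: "\<And>x y. 0 \<le> x \<Longrightarrow> 0 \<le> y \<Longrightarrow> y \<le> 1 \<Longrightarrow>
      y * \<bar>\<Omega> (real n * x) (real n * y) - c\<bar> \<le> \<epsilon> + C * (\<bar>x - x0\<bar> + \<bar>y - y0\<bar>)"
  shows "\<bar>1 / real n * (\<integral>w. platform_utility r l\<^sub>R n X w \<partial>M) - (\<rho> - payout * c)\<bar>
    \<le> (1 + 2 * p) * (\<epsilon> + C * deviation x0 y0)"
proof -
  let ?R = "\<lambda>w. revenue r l\<^sub>R (D w) (num w)"
  let ?S = "\<lambda>w. \<Sum>i<n. payment X i w * active X i w * served X i w"
  have rm: "r \<in> borel_measurable (restrict_space borel {0..})"
    using r by (simp add: borel_measurable_continuous_on_restrict)
  have Rm: "?R \<in> borel_measurable M"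
  proof (rule measurable_of_demand_num)
    fix t :: real assume t: "0 \<le> t"
    \<comment> \<open>For t = 0 the quotient is 0, which still lies in the half line.\<close>
    have "(\<lambda>x. x / t) \<in> restrict_space borel {0..} \<rightarrow>\<^sub>M restrict_space borel {0..}"
    proof (rule measurable_restrict_space2)
      show "(\<lambda>x. x / t) \<in> space (restrict_space borel {0..}) \<rightarrow> {0..}"
        using t by (auto simp: space_restrict_space)
      show "(\<lambda>x. x / t) \<in> borel_measurable (restrict_space borel {0..})"
        by (intro measurable_restrict_space1) simp
    qed
    from measurable_compose[OF this rm] lR[OF t]
    show "(\<lambda>x. revenue r l\<^sub>R x t) \<in> borel_measurable (restrict_space borel {0..})"
      unfolding revenue_def by simp
  qed
  have b1: "\<bar>?R w / real n - \<rho>\<bar> \<le> \<epsilon> + C * (\<bar>D w / real n - x0\<bar> + \<bar>num w / real n - y0\<bar>)"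
    if w: "w \<in> space M" for w
    using B1[OF scaled_range(1,2,3)[OF w]] unfolding scaled_range(4,5)[OF w] .
  have b2: "\<bar>num w / real n * \<bar>\<Omega> (D w) (num w) - c\<bar>\<bar> \<le> \<epsilon> + C * (\<bar>D w / real n - x0\<bar> + \<bar>num w / real n - y0\<bar>)"
    if w: "w \<in> space M" for w
    using B2[OF scaled_range(1,2,3)[OF w]] num_range(1)[OF w] unfolding scaled_range(4,5)[OF w]
    by (simp add: abs_mult)
  have m1: "(\<lambda>w. ?R w / real n - \<rho>) \<in> borel_measurable M" using Rm by simp
  have iR: "integrable M (\<lambda>w. ?R w / real n - \<rho>)" by (rule integrable_deviation[OF m1 b1])
  have iR': "integrable M ?R"
  proof -
    have "integrable M (\<lambda>w. real n * ((?R w / real n - \<rho>) + \<rho>))"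
      using iR by (intro integrable_mult_right Bochner_Integration.integrable_add) auto
    then show ?thesis using n_pos by simp
  qed
  have E1: "\<bar>(\<integral>w. ?R w / real n - \<rho> \<partial>M)\<bar> \<le> \<epsilon> + C * deviation x0 y0"
    by (rule abs_expectation_le_deviation(2)[OF m1 C b1])
  have "(\<integral>w. \<bar>num w / real n * \<bar>\<Omega> (D w) (num w) - c\<bar>\<bar> \<partial>M) \<le> \<epsilon> + C * deviation x0 y0"
    by (rule abs_expectation_le_deviation(1)[OF _ C b2]) measurable
  also have "(\<integral>w. \<bar>num w / real n * \<bar>\<Omega> (D w) (num w) - c\<bar>\<bar> \<partial>M) = (\<integral>w. num w / real n * \<bar>\<Omega> (D w) (num w) - c\<bar> \<partial>M)"
    using num_range(1) by (intro Bochner_Integration.integral_cong refl) (simp add: abs_mult)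
  finally have "2 * p * (\<integral>w. num w / real n * \<bar>\<Omega> (D w) (num w) - c\<bar> \<partial>M) \<le> 2 * p * (\<epsilon> + C * deviation x0 y0)"
    using \<zeta> by (intro mult_left_mono) auto
  with payments_approx[of c]
  have E2: "\<bar>(\<Sum>i<n. \<integral>w. payment X i w * active X i w * served X i w \<partial>M) / real n - payout * c\<bar>
      \<le> 2 * p * (\<epsilon> + C * deviation x0 y0)" by linarith
  have "(\<integral>w. platform_utility r l\<^sub>R n X w \<partial>M) = (\<integral>w. ?R w \<partial>M) - (\<integral>w. ?S w \<partial>M)"
    unfolding platform_utility_def[abs_def] using iR' served_payment(1)
    by (intro Bochner_Integration.integral_diff Bochner_Integration.integrable_sum) auto
  also have "(\<integral>w. ?S w \<partial>M) = (\<Sum>i<n. \<integral>w. payment X i w * active X i w * served X i w \<partial>M)"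
    using served_payment(1) by (intro Bochner_Integration.integral_sum) auto
  finally have "1 / real n * (\<integral>w. platform_utility r l\<^sub>R n X w \<partial>M) - (\<rho> - payout * c)
      = (\<integral>w. ?R w / real n - \<rho> \<partial>M)
        - ((\<Sum>i<n. \<integral>w. payment X i w * active X i w * served X i w \<partial>M) / real n - payout * c)"
    using iR' by (simp add: prob_space diff_divide_distrib)
  then show ?thesis using E1 E2 by (simp add: distrib_right abs_le_iff)
qed

end

end

section \<open>Mean-field limit\<close>

context market_model
begin

section \<open>Choices averaged over the features\<close>

definition response :: "'s \<Rightarrow> real \<Rightarrow> real" where
  "response a z = (\<integral>b. f b z \<partial>\<nu> a)"

text \<open>Written as a function of a free allocation y: the finite-n allocation and the mean-field
  allocation are both inserted for y later.\<close>

definition mean_choice :: "'s \<Rightarrow> real \<Rightarrow> real \<Rightarrow> real \<Rightarrow> real" where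
  "mean_choice a p \<zeta> y = (response a ((p + \<zeta>) * y) + response a ((p - \<zeta>) * y)) / 2"

definition mean_payout :: "'s \<Rightarrow> real \<Rightarrow> real \<Rightarrow> real \<Rightarrow> real" where
  "mean_payout a p \<zeta> y = ((p + \<zeta>) * response a ((p + \<zeta>) * y) + (p - \<zeta>) * response a ((p - \<zeta>) * y)) / 2"

lemma space_feature: "a \<in> \<A> \<Longrightarrow> space (\<nu> a) = space \<B>"
  using feature_sets by (rule sets_eq_imp_space_eq)

lemma integrable_response:
  assumes "a \<in> \<A>" "0 \<le> z"
  shows "integrable (\<nu> a) (\<lambda>b. f b z)"
proof -
  interpret \<nu>: prob_space "\<nu> a" by (rule feature_prob[OF assms(1)])
  show ?thesis
  proof (rule \<nu>.integrable_const_bound[where B = 1])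
    show "AE b in \<nu> a. norm (f b z) \<le> 1"
      using choice_range assms by (intro AE_I2) (fastforce simp: space_feature)
    show "(\<lambda>b. f b z) \<in> borel_measurable (\<nu> a)"
      using choice_measurable[OF assms(2)] by (simp add: measurable_cong_sets[OF feature_sets[OF assms(1)] refl])
  qed
qed

lemma response_mono:
  assumes "a \<in> \<A>" "0 \<le> x" "x \<le> y"
  shows "response a x \<le> response a y"
  unfolding response_def using assms
  by (intro integral_mono integrable_response) (auto simp: space_feature intro!: mono_onD[OF choice_mono])

lemma response_range:
  assumes "a \<in> \<A>" "0 \<le> z"
  shows "0 \<le> response a z" "response a z \<le> 1"
proof -
  interpret \<nu>: prob_space "\<nu> a" by (rule feature_prob[OF assms(1)])
  have "0 \<le> f b z \<and> f b z \<le> 1" if "b \<in> space (\<nu> a)" for b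
    using choice_range[of b z] that assms by (simp add: space_feature)
  then show "0 \<le> response a z" "response a z \<le> 1"
    unfolding response_def
    using \<nu>.integral_ge_const[OF integrable_response[OF assms] AE_I2, of 0]
      \<nu>.integral_le_const[OF integrable_response[OF assms] AE_I2, of 1] by auto
qed

text \<open>Finite differences rather than derivatives are averaged over the feature, which avoids
  differentiating under the integral and any measurability of the derivatives in b.\<close>

lemma response_smooth:
  "\<exists>K\<ge>0. \<forall>a\<in>\<A>. (\<forall>x\<ge>0. \<forall>y\<ge>0. \<bar>response a x - response a y\<bar> \<le> (1 + K) * \<bar>x - y\<bar>) \<and>
    (\<forall>x h. 0 \<le> h \<longrightarrow> h \<le> x \<longrightarrow> \<bar>response a (x + h) + response a (x - h) - 2 * response a x\<bar> \<le> 2 * K * h\<^sup>2)"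
proof -
  obtain f' f'' K0 where f': "\<And>b x. b \<in> space \<B> \<Longrightarrow> 0 \<le> x \<Longrightarrow> (f b has_real_derivative f' b x) (at x within {0..})"
    and f'': "\<And>b x. b \<in> space \<B> \<Longrightarrow> 0 \<le> x \<Longrightarrow> (f' b has_real_derivative f'' b x) (at x within {0..})"
    and K0: "\<And>b x. b \<in> space \<B> \<Longrightarrow> 0 \<le> x \<Longrightarrow> \<bar>f'' b x\<bar> \<le> K0"
    using choice_twice_diff by blast
  \<comment> \<open>The absolute value makes the constant nonnegative without inspecting the feature
    space.\<close>
  define K where "K = \<bar>K0\<bar>"
  have K: "0 \<le> K" by (simp add: K_def)
  have KK: "\<bar>f'' b x\<bar> \<le> K" if "b \<in> space \<B>" "0 \<le> x" for b x
    using K0[OF that] by (simp add: K_def)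
  note lip = C2_lipschitz[OF f' f'' KK choice_range]
  note second = C2_second_difference[OF f' f'' KK choice_range]
  have avg: "\<bar>\<integral>b. g b \<partial>\<nu> a\<bar> \<le> c"
    if a: "a \<in> \<A>" and "integrable (\<nu> a) g" and "\<And>b. b \<in> space \<B> \<Longrightarrow> \<bar>g b\<bar> \<le> c" for a c and g :: "'b \<Rightarrow> real"
  proof -
    interpret \<nu>: prob_space "\<nu> a" by (rule feature_prob[OF a])
    have "(\<integral>b. \<bar>g b\<bar> \<partial>\<nu> a) \<le> c"
      by (rule \<nu>.integral_le_const) (use that in \<open>auto simp: space_feature intro!: AE_I2\<close>)
    then show ?thesis using integral_abs_bound[of "\<nu> a" g] by linarith
  qed
  have "\<bar>response a x - response a y\<bar> \<le> (1 + K) * \<bar>x - y\<bar>" if a: "a \<in> \<A>" and xy: "0 \<le> x" "0 \<le> y" for a x y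
  proof -
    note i = integrable_response[OF a xy(1)] integrable_response[OF a xy(2)]
    have "\<bar>\<integral>b. f b x - f b y \<partial>\<nu> a\<bar> \<le> (1 + K) * \<bar>x - y\<bar>"
      by (rule avg[OF a]) (use i lip xy in auto)
    then show ?thesis using i by (simp add: response_def)
  qed
  moreover have "\<bar>response a (x + h) + response a (x - h) - 2 * response a x\<bar> \<le> 2 * K * h\<^sup>2"
    if a: "a \<in> \<A>" and h: "0 \<le> h" "h \<le> x" for a x h
  proof -
    have i: "integrable (\<nu> a) (\<lambda>b. f b (x + h))" "integrable (\<nu> a) (\<lambda>b. f b (x - h))" "integrable (\<nu> a) (\<lambda>b. f b x)"
      using h by (auto intro!: integrable_response[OF a])
    have "\<bar>\<integral>b. f b (x + h) + f b (x - h) - 2 * f b x \<partial>\<nu> a\<bar> \<le> 2 * K * h\<^sup>2"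
      by (rule avg[OF a]) (use i second h in auto)
    then show ?thesis using i by (simp add: response_def)
  qed
  ultimately show ?thesis using K by blast
qed

text \<open>The change of the choice is half a second difference with step \<zeta> * y. The change
  of the payout is half of p times that second difference plus \<zeta> times a first difference; the
  latter is itself of order \<zeta>, so both parts are quadratic. The constant L depends neither on
  p nor on y.\<close>

lemma mean_perturbation:
  "\<exists>L\<ge>0. \<forall>a\<in>\<A>. \<forall>p \<zeta> y :: real. 0 \<le> \<zeta> \<longrightarrow> \<zeta> < p \<longrightarrow> 0 \<le> y \<longrightarrow> y \<le> 1 \<longrightarrow>
    \<bar>mean_choice a p \<zeta> y - mean_choice a p 0 y\<bar> \<le> L * \<zeta>\<^sup>2 \<and>
    \<bar>mean_payout a p \<zeta> y - mean_payout a p 0 y\<bar> \<le> L * (1 + p) * \<zeta>\<^sup>2"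
proof -
  obtain K where K: "0 \<le> K"
    and lip: "\<And>a x y. a \<in> \<A> \<Longrightarrow> 0 \<le> x \<Longrightarrow> 0 \<le> y \<Longrightarrow> \<bar>response a x - response a y\<bar> \<le> (1 + K) * \<bar>x - y\<bar>"
    and second: "\<And>a x h. a \<in> \<A> \<Longrightarrow> 0 \<le> h \<Longrightarrow> h \<le> x \<Longrightarrow>
      \<bar>response a (x + h) + response a (x - h) - 2 * response a x\<bar> \<le> 2 * K * h\<^sup>2"
    using response_smooth by blast
  have "\<bar>mean_choice a p \<zeta> y - mean_choice a p 0 y\<bar> \<le> (1 + K) * \<zeta>\<^sup>2 \<and>
    \<bar>mean_payout a p \<zeta> y - mean_payout a p 0 y\<bar> \<le> (1 + K) * (1 + p) * \<zeta>\<^sup>2"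
    if a: "a \<in> \<A>" and z: "0 \<le> \<zeta>" "\<zeta> < p" and y: "0 \<le> y" "y \<le> 1" for a p \<zeta> y
  proof -
    define F1 F2 F0 where F: "F1 = response a ((p + \<zeta>) * y)" "F2 = response a ((p - \<zeta>) * y)" "F0 = response a (p * y)"
    have h: "0 \<le> \<zeta> * y" "\<zeta> * y \<le> p * y" using z y by (auto intro!: mult_right_mono)
    have hy: "\<zeta> * y \<le> \<zeta>" using z y by (simp add: mult_left_le)
    then have hz: "(\<zeta> * y)\<^sup>2 \<le> \<zeta>\<^sup>2" using h by (intro power_mono) auto
    have "\<bar>F1 + F2 - 2 * F0\<bar> \<le> 2 * K * (\<zeta> * y)\<^sup>2"
      using second[OF a h] by (simp add: F algebra_simps)
    also have "\<dots> \<le> 2 * K * \<zeta>\<^sup>2" using hz K by (intro mult_left_mono) auto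
    finally have s: "\<bar>F1 + F2 - 2 * F0\<bar> \<le> 2 * (K * \<zeta>\<^sup>2)" by simp
    have "\<bar>F1 - F2\<bar> \<le> (1 + K) * \<bar>(p + \<zeta>) * y - (p - \<zeta>) * y\<bar>"
      unfolding F using z y by (intro lip a) auto
    also have "(p + \<zeta>) * y - (p - \<zeta>) * y = 2 * (\<zeta> * y)" by (simp add: algebra_simps)
    also have "(1 + K) * \<bar>2 * (\<zeta> * y)\<bar> \<le> (1 + K) * (2 * \<zeta>)" using h hy K by (intro mult_left_mono) auto
    finally have "\<zeta> * \<bar>F1 - F2\<bar> \<le> \<zeta> * ((1 + K) * (2 * \<zeta>))" using z by (intro mult_left_mono)
    also have "\<zeta> * \<bar>F1 - F2\<bar> = \<bar>\<zeta> * (F1 - F2)\<bar>" using z by (simp add: abs_mult)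
    finally have d: "\<bar>\<zeta> * (F1 - F2)\<bar> \<le> 2 * ((1 + K) * \<zeta>\<^sup>2)"
      by (simp add: power2_eq_square algebra_simps)
    have "mean_choice a p \<zeta> y - mean_choice a p 0 y = (F1 + F2 - 2 * F0) / 2"
      by (simp add: mean_choice_def F)
    then have 1: "\<bar>mean_choice a p \<zeta> y - mean_choice a p 0 y\<bar> \<le> K * \<zeta>\<^sup>2" using s by simp
    have "\<bar>p * (F1 + F2 - 2 * F0)\<bar> \<le> p * (2 * (K * \<zeta>\<^sup>2))"
      using s z by (simp add: abs_mult mult_left_mono)
    moreover have "mean_payout a p \<zeta> y - mean_payout a p 0 y = (p * (F1 + F2 - 2 * F0) + \<zeta> * (F1 - F2)) / 2"
    proof -
      have "mean_payout a p \<zeta> y = ((p + \<zeta>) * F1 + (p - \<zeta>) * F2) / 2" "mean_payout a p 0 y = p * F0"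
        by (simp_all add: mean_payout_def F)
      then show ?thesis by (simp add: field_simps)
    qed
    ultimately have "\<bar>mean_payout a p \<zeta> y - mean_payout a p 0 y\<bar> \<le> p * (K * \<zeta>\<^sup>2) + (1 + K) * \<zeta>\<^sup>2"
      using d by (simp add: abs_le_iff)
    also have "\<dots> \<le> (1 + K) * (1 + p) * \<zeta>\<^sup>2"
      using z by (simp add: algebra_simps)
    finally show ?thesis using 1 by (simp add: algebra_simps add_increasing)
  qed
  then show ?thesis using K by (intro exI[of _ "1 + K"]) auto
qed

section \<open>The mean-field equilibrium equation\<close>

context
  fixes a and p \<zeta> :: real
  assumes a: "a \<in> \<A>" and \<zeta>: "0 \<le> \<zeta>" "\<zeta> < p"
begin

lemma mean_choice_mono: "0 \<le> y \<Longrightarrow> y \<le> y' \<Longrightarrow> mean_choice a p \<zeta> y \<le> mean_choice a p \<zeta> y'"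
  unfolding mean_choice_def using \<zeta>
  by (intro divide_right_mono add_mono response_mono[OF a] mult_left_mono mult_nonneg_nonneg) auto

lemma mean_choice_range: "0 \<le> y \<Longrightarrow> 0 \<le> mean_choice a p \<zeta> y \<and> mean_choice a p \<zeta> y \<le> 1"
  using response_range[OF a, of "(p + \<zeta>) * y"] response_range[OF a, of "(p - \<zeta>) * y"] \<zeta>
  by (simp add: mean_choice_def)

text \<open>Payments are at most 2p, so the payout is forced to 0 together with the active
  fraction.\<close>

lemma mean_payout_range: "0 \<le> y \<Longrightarrow> 0 \<le> mean_payout a p \<zeta> y \<and> mean_payout a p \<zeta> y \<le> 2 * p * mean_choice a p \<zeta> y"
proof -
  assume y: "0 \<le> y"
  define F1 F2 where F: "F1 = response a ((p + \<zeta>) * y)" "F2 = response a ((p - \<zeta>) * y)"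
  have F0: "0 \<le> F1" "0 \<le> F2" unfolding F using \<zeta> y by (auto intro!: response_range[OF a])
  have "(p + \<zeta>) * F1 \<le> 2 * p * F1" "(p - \<zeta>) * F2 \<le> 2 * p * F2"
    using F0 \<zeta> by (auto intro!: mult_right_mono)
  moreover have "0 \<le> (p + \<zeta>) * F1" "0 \<le> (p - \<zeta>) * F2" using F0 \<zeta> by auto
  ultimately show ?thesis unfolding mean_payout_def mean_choice_def F[symmetric] by (simp add: algebra_simps)
qed

lemma mean_lipschitz:
  "\<exists>L\<ge>0. \<forall>y\<ge>0. \<forall>y'\<ge>0. \<bar>mean_choice a p \<zeta> y - mean_choice a p \<zeta> y'\<bar> \<le> L * \<bar>y - y'\<bar> \<and>
    \<bar>mean_payout a p \<zeta> y - mean_payout a p \<zeta> y'\<bar> \<le> L * \<bar>y - y'\<bar>"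
proof -
  obtain K where K: "0 \<le> K"
    and lip: "\<And>x y. 0 \<le> x \<Longrightarrow> 0 \<le> y \<Longrightarrow> \<bar>response a x - response a y\<bar> \<le> (1 + K) * \<bar>x - y\<bar>"
    using response_smooth a by blast
  define L where "L = (1 + K) * (2 * p)"
  have L: "0 \<le> L" using K \<zeta> by (simp add: L_def)
  have one: "\<bar>response a (s * y) - response a (s * y')\<bar> \<le> L * \<bar>y - y'\<bar>"
    if "0 \<le> s" "s \<le> 2 * p" "0 \<le> y" "0 \<le> y'" for s y y'
  proof -
    have "\<bar>response a (s * y) - response a (s * y')\<bar> \<le> (1 + K) * \<bar>s * y - s * y'\<bar>"
      using that by (intro lip) auto
    also have "\<dots> = (1 + K) * (s * \<bar>y - y'\<bar>)"
      using that by (simp flip: right_diff_distrib add: abs_mult)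
    also have "\<dots> \<le> (1 + K) * (2 * p * \<bar>y - y'\<bar>)"
      using that K by (intro mult_left_mono mult_right_mono) auto
    finally show ?thesis by (simp add: L_def mult.assoc)
  qed
  have "\<bar>mean_choice a p \<zeta> y - mean_choice a p \<zeta> y'\<bar> \<le> L * (1 + 2 * p) * \<bar>y - y'\<bar> \<and>
    \<bar>mean_payout a p \<zeta> y - mean_payout a p \<zeta> y'\<bar> \<le> L * (1 + 2 * p) * \<bar>y - y'\<bar>" if y: "0 \<le> y" "0 \<le> y'" for y y'
  proof -
    define u v where uv: "u = response a ((p + \<zeta>) * y) - response a ((p + \<zeta>) * y')"
      "v = response a ((p - \<zeta>) * y) - response a ((p - \<zeta>) * y')"
    define e where "e = L * \<bar>y - y'\<bar>"
    have e: "0 \<le> e" using L by (simp add: e_def)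
    have b: "\<bar>u\<bar> \<le> e" "\<bar>v\<bar> \<le> e" unfolding uv e_def using one \<zeta> y by auto
    have pe: "0 \<le> p * e" using \<zeta> e by simp
    have m: "\<bar>s * t\<bar> \<le> 2 * p * e" if "0 \<le> s" "s \<le> 2 * p" "\<bar>t\<bar> \<le> e" for s t
      using that by (simp add: abs_mult mult_mono)
    have "mean_choice a p \<zeta> y - mean_choice a p \<zeta> y' = (u + v) / 2"
      by (simp add: mean_choice_def uv field_simps)
    then have "\<bar>mean_choice a p \<zeta> y - mean_choice a p \<zeta> y'\<bar> \<le> e" using b by (simp add: abs_le_iff)
    moreover have "mean_payout a p \<zeta> y - mean_payout a p \<zeta> y' = ((p + \<zeta>) * u + (p - \<zeta>) * v) / 2"
      by (simp add: mean_payout_def uv field_simps)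
    then have "\<bar>mean_payout a p \<zeta> y - mean_payout a p \<zeta> y'\<bar> \<le> 2 * p * e"
      using m[of "p + \<zeta>" u] m[of "p - \<zeta>" v] b \<zeta> by (simp add: abs_le_iff)
    moreover have "L * (1 + 2 * p) * \<bar>y - y'\<bar> = e + 2 * (p * e)" by (simp add: e_def algebra_simps)
    ultimately show ?thesis using e pe by simp
  qed
  moreover have "0 \<le> L * (1 + 2 * p)" using L \<zeta> by simp
  ultimately show ?thesis by blast
qed

text \<open>Intermediate value theorem on [0, 1] for q minus the mean choice, which lies between 0
  and 1. Continuity at q = 0 comes from reading the allocation there as the limit of
  \<omega>.\<close>

lemma equilibrium_exists:
  "\<exists>q. 0 \<le> q \<and> q \<le> 1 \<and> q = mean_choice a p \<zeta> (mean_field_allocation \<omega> (d a) q)"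
proof -
  let ?m = "mean_field_allocation \<omega> (d a)"
  obtain L where L: "0 \<le> L"
    "\<And>y y'. 0 \<le> y \<Longrightarrow> 0 \<le> y' \<Longrightarrow> \<bar>mean_choice a p \<zeta> y - mean_choice a p \<zeta> y'\<bar> \<le> L * \<bar>y - y'\<bar>"
    using mean_lipschitz by blast
  have "L-lipschitz_on {0..} (mean_choice a p \<zeta>)"
    using L by (intro lipschitz_onI) (auto simp: dist_real_def)
  then have cG: "continuous_on {0..} (mean_choice a p \<zeta>)" by (rule lipschitz_on_continuous_on)
  have m: "0 \<le> ?m q \<and> ?m q \<le> 1" if "0 \<le> q" for q
    using mean_field_allocation_range[OF regular _ that, of "d a"] d_pos[OF a] by auto
  have cm: "continuous_on {0..1} ?m"
    by (rule continuous_on_subset[OF continuous_on_mean_field_allocation[OF regular d_pos[OF a]]]) auto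
  have "?m ` {0..1} \<subseteq> {0..}" using m by (simp add: image_subset_iff)
  from continuous_on_compose2[OF cG cm this]
  have *: "continuous_on {0..1} (\<lambda>q. q - mean_choice a p \<zeta> (?m q))"
    by (rule continuous_on_diff[OF continuous_on_id])
  have "0 - mean_choice a p \<zeta> (?m 0) \<le> 0" "0 \<le> 1 - mean_choice a p \<zeta> (?m 1)"
    using mean_choice_range[OF m[THEN conjunct1], of 0] mean_choice_range[OF m[THEN conjunct1], of 1] by simp_all
  with * obtain q where "0 \<le> q" "q \<le> 1" "q - mean_choice a p \<zeta> (?m q) = 0"
    using IVT'[of "\<lambda>q. q - mean_choice a p \<zeta> (?m q)" 0 0 1] by (metis zero_le_one)
  then show ?thesis by (intro exI[of _ q]) simp
qed

end

section \<open>Large-market approximation of allocation and revenue\<close>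

lemma allocation_bounded: "\<exists>K\<ge>0. \<forall>x\<ge>0. \<forall>t\<ge>0. \<Omega> x t \<le> K"
proof -
  obtain K where K: "0 \<le> K" "\<And>x y. 0 \<le> x \<Longrightarrow> 0 \<le> y \<Longrightarrow> \<bar>l x y\<bar> \<le> K"
    using lower_order_bounded[OF l_lower_order] by blast
  have "\<Omega> x t \<le> 1 + K" if "0 \<le> x" "0 \<le> t" for x t
    using \<Omega>_eq[OF that] mean_field_allocation_range[OF regular that] K(2)[OF that] by linarith
  then show ?thesis using K by (intro exI[of _ "1 + K"]) auto
qed

lemma mean_field_allocation_scale:
  "0 < c \<Longrightarrow> mean_field_allocation \<omega> (c * x) (c * y) = mean_field_allocation \<omega> x y"
  by (simp add: mean_field_allocation_def)

text \<open>The ratio d / t is invariant under scaling by n, so only the lower-order term depends on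
  n.\<close>

lemma allocation_approx:
  assumes pos: "0 < x0" "0 < y0" "0 < \<epsilon>"
  shows "\<exists>C\<ge>0. \<forall>\<^sub>F n in sequentially. \<forall>x\<ge>0. \<forall>y\<ge>0.
    \<bar>\<Omega> (real n * x) (real n * y) - mean_field_allocation \<omega> x0 y0\<bar> \<le> \<epsilon> + C * (\<bar>x - x0\<bar> + \<bar>y - y0\<bar>)"
proof -
  obtain C1 where C1: "0 \<le> C1" and l: "\<forall>\<^sub>F n in sequentially. \<forall>x\<ge>0. \<forall>y\<ge>0.
      \<bar>l (real n * x) (real n * y)\<bar> \<le> \<epsilon> + C1 * (\<bar>x - x0\<bar> + \<bar>y - y0\<bar>)"
    using lower_order_scaled[OF l_lower_order pos] by blast
  obtain C2 where C2: "0 \<le> C2" and m: "\<And>x y. 0 \<le> x \<Longrightarrow> 0 \<le> y \<Longrightarrow>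
      \<bar>mean_field_allocation \<omega> x y - \<omega> (x0 / y0)\<bar> \<le> C2 * (\<bar>x - x0\<bar> + \<bar>y - y0\<bar>)"
    using mean_field_allocation_approx[OF regular pos(1,2)] by blast
  have "\<forall>\<^sub>F n in sequentially. \<forall>x\<ge>0. \<forall>y\<ge>0.
    \<bar>\<Omega> (real n * x) (real n * y) - mean_field_allocation \<omega> x0 y0\<bar> \<le> \<epsilon> + (C1 + C2) * (\<bar>x - x0\<bar> + \<bar>y - y0\<bar>)"
    using l eventually_gt_at_top[of 0]
  proof eventually_elim
    case (elim n)
    show ?case
    proof (intro allI impI)
      fix x y :: real assume xy: "0 \<le> x" "0 \<le> y"
      have "\<Omega> (real n * x) (real n * y) = mean_field_allocation \<omega> x y + l (real n * x) (real n * y)"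
        using \<Omega>_eq[of "real n * x" "real n * y"] xy elim(2) by (simp add: mean_field_allocation_scale)
      moreover have "\<bar>l (real n * x) (real n * y)\<bar> \<le> \<epsilon> + C1 * (\<bar>x - x0\<bar> + \<bar>y - y0\<bar>)" using elim(1) xy by blast
      moreover have "mean_field_allocation \<omega> x0 y0 = \<omega> (x0 / y0)" using pos by (simp add: mean_field_allocation_def)
      ultimately show "\<bar>\<Omega> (real n * x) (real n * y) - mean_field_allocation \<omega> x0 y0\<bar>
          \<le> \<epsilon> + (C1 + C2) * (\<bar>x - x0\<bar> + \<bar>y - y0\<bar>)"
        using m[OF xy] unfolding distrib_right by linarith
    qed
  qed
  then show ?thesis using C1 C2 by (intro exI[of _ "C1 + C2"]) auto
qed

lemma weighted_allocation_approx:
  assumes pos: "0 < x0" "0 \<le> y0" "0 < \<epsilon>"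
  shows "\<exists>C\<ge>0. \<forall>\<^sub>F n in sequentially. \<forall>x\<ge>0. \<forall>y\<ge>0. y \<le> 1 \<longrightarrow>
    y * \<bar>\<Omega> (real n * x) (real n * y) - mean_field_allocation \<omega> x0 y0\<bar> \<le> \<epsilon> + C * (\<bar>x - x0\<bar> + \<bar>y - y0\<bar>)"
proof (cases "y0 = 0")
  case False
  then have y0: "0 < y0" using pos by simp
  obtain C where C: "0 \<le> C" and *: "\<forall>\<^sub>F n in sequentially. \<forall>x\<ge>0. \<forall>y\<ge>0.
    \<bar>\<Omega> (real n * x) (real n * y) - mean_field_allocation \<omega> x0 y0\<bar> \<le> \<epsilon> + C * (\<bar>x - x0\<bar> + \<bar>y - y0\<bar>)"
    using allocation_approx[OF pos(1) y0 pos(3)] by blast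
  from * have "\<forall>\<^sub>F n in sequentially. \<forall>x\<ge>0. \<forall>y\<ge>0. y \<le> 1 \<longrightarrow>
    y * \<bar>\<Omega> (real n * x) (real n * y) - mean_field_allocation \<omega> x0 y0\<bar> \<le> \<epsilon> + C * (\<bar>x - x0\<bar> + \<bar>y - y0\<bar>)"
    by eventually_elim (auto intro: order_trans[OF mult_left_le_one_le])
  then show ?thesis using C by blast
next
  case True
  obtain K where K: "0 \<le> K" "\<And>x t. 0 \<le> x \<Longrightarrow> 0 \<le> t \<Longrightarrow> \<Omega> x t \<le> K" using allocation_bounded by blast
  have "y * \<bar>\<Omega> (real n * x) (real n * y) - mean_field_allocation \<omega> x0 y0\<bar> \<le> \<epsilon> + (K + 1) * (\<bar>x - x0\<bar> + \<bar>y - y0\<bar>)"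
    if xy: "0 \<le> x" "0 \<le> y" for n x y
  proof -
    have n: "0 \<le> real n * x" "0 \<le> real n * y" using xy by auto
    have x0: "0 \<le> x0" using pos by simp
    have "\<bar>\<Omega> (real n * x) (real n * y) - mean_field_allocation \<omega> x0 y0\<bar> \<le> K + 1"
      using K(2)[OF n] \<Omega>_nonneg[OF n] K(1) mean_field_allocation_range[OF regular x0 pos(2)] by (simp add: abs_le_iff)
    then have "y * \<bar>\<Omega> (real n * x) (real n * y) - mean_field_allocation \<omega> x0 y0\<bar> \<le> y * (K + 1)"
      using xy by (intro mult_left_mono)
    also have "\<dots> = (K + 1) * \<bar>y - y0\<bar>" using True xy by simp
    also have "\<dots> \<le> (K + 1) * (\<bar>x - x0\<bar> + \<bar>y - y0\<bar>)" using K by (intro mult_left_mono) auto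
    finally show ?thesis using pos by simp
  qed
  then show ?thesis using K by (intro exI[of _ "K + 1"]) auto
qed

text \<open>For y0 = 0 the prefactor y plays the role of the deviation, which requires r to be
  bounded: under linear growth r (x / y) * y would stay of the order of x. The formal quotient x0 /
  0 is multiplied by 0.\<close>

lemma revenue_approx:
  assumes pos: "0 < x0" "0 \<le> y0" "0 < \<epsilon>" and nondeg: "0 < y0 \<or> bounded (r ` {0..})"
  shows "\<exists>C\<ge>0. \<forall>\<^sub>F n in sequentially. \<forall>x\<ge>0. \<forall>y\<ge>0. y \<le> 1 \<longrightarrow>
    \<bar>revenue r l\<^sub>R (real n * x) (real n * y) / real n - r (x0 / y0) * y0\<bar> \<le> \<epsilon> + C * (\<bar>x - x0\<bar> + \<bar>y - y0\<bar>)"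
proof -
  have scale: "revenue r l\<^sub>R (real n * x) (real n * y) / real n = r (x / y) * y - l\<^sub>R (real n * x) (real n * y) * y"
    if "0 < n" for n x y
  proof -
    have "revenue r l\<^sub>R (real n * x) (real n * y) = real n * ((r (x / y) - l\<^sub>R (real n * x) (real n * y)) * y)"
      using that by (simp add: revenue_def)
    then show ?thesis using that by (simp add: left_diff_distrib)
  qed
  show ?thesis
  proof (cases "y0 = 0")
    case False
    then have y0: "0 < y0" using pos by simp
    obtain K where K: "0 \<le> K" "\<And>x y. 0 \<le> x \<Longrightarrow> 0 \<le> y \<Longrightarrow> \<bar>r x - r y\<bar> \<le> K * \<bar>x - y\<bar>"
      using smooth_bounded_derivatives_lipschitz[OF r_smooth] by blast
    obtain C1 where C1: "0 \<le> C1" "\<And>x y. 0 \<le> x \<Longrightarrow> 0 \<le> y \<Longrightarrow>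
        \<bar>r (x / y) * y - r (x0 / y0) * y0\<bar> \<le> C1 * (\<bar>x - x0\<bar> + \<bar>y - y0\<bar>)"
      using perspective_approx[OF K(2) K(1) pos(1) y0] by blast
    obtain C2 where C2: "0 \<le> C2" and l: "\<forall>\<^sub>F n in sequentially. \<forall>x\<ge>0. \<forall>y\<ge>0.
        \<bar>l\<^sub>R (real n * x) (real n * y)\<bar> \<le> \<epsilon> + C2 * (\<bar>x - x0\<bar> + \<bar>y - y0\<bar>)"
      using lower_order_scaled[OF l\<^sub>R_lower_order pos(1) y0 pos(3)] by blast
    have "\<forall>\<^sub>F n in sequentially. \<forall>x\<ge>0. \<forall>y\<ge>0. y \<le> 1 \<longrightarrow>
      \<bar>revenue r l\<^sub>R (real n * x) (real n * y) / real n - r (x0 / y0) * y0\<bar> \<le> \<epsilon> + (C1 + C2) * (\<bar>x - x0\<bar> + \<bar>y - y0\<bar>)"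
      using l eventually_gt_at_top[of 0]
    proof eventually_elim
      case (elim n)
      show ?case
      proof (intro allI impI)
        fix x y :: real assume xy: "0 \<le> x" "0 \<le> y" "y \<le> 1"
        have "\<bar>l\<^sub>R (real n * x) (real n * y) * y\<bar> \<le> \<bar>l\<^sub>R (real n * x) (real n * y)\<bar>"
          using xy by (simp add: abs_mult mult_right_le_one_le)
        also have "\<dots> \<le> \<epsilon> + C2 * (\<bar>x - x0\<bar> + \<bar>y - y0\<bar>)" using elim(1) xy by blast
        finally show "\<bar>revenue r l\<^sub>R (real n * x) (real n * y) / real n - r (x0 / y0) * y0\<bar>
            \<le> \<epsilon> + (C1 + C2) * (\<bar>x - x0\<bar> + \<bar>y - y0\<bar>)"
          using C1(2)[OF xy(1,2)] unfolding scale[OF elim(2)] distrib_right by linarith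
      qed
    qed
    then show ?thesis using C1 C2 by (intro exI[of _ "C1 + C2"]) auto
  next
    case True
    then obtain B where B: "\<And>x. 0 \<le> x \<Longrightarrow> \<bar>r x\<bar> \<le> B" using nondeg unfolding bounded_iff by auto
    obtain K where K: "0 \<le> K" "\<And>x y. 0 \<le> x \<Longrightarrow> 0 \<le> y \<Longrightarrow> \<bar>l\<^sub>R x y\<bar> \<le> K"
      using lower_order_bounded[OF l\<^sub>R_lower_order] by blast
    have B0: "0 \<le> B" using B[of 0] by simp
    have "\<bar>revenue r l\<^sub>R (real n * x) (real n * y) / real n - r (x0 / y0) * y0\<bar> \<le> \<epsilon> + (B + K) * (\<bar>x - x0\<bar> + \<bar>y - y0\<bar>)"
      if n: "0 < n" and xy: "0 \<le> x" "0 \<le> y" for n x y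
    proof -
      have "\<bar>r (x / y) - l\<^sub>R (real n * x) (real n * y)\<bar> \<le> B + K"
        using B[of "x / y"] K(2)[of "real n * x" "real n * y"] xy by (simp add: abs_le_iff)
      then have "\<bar>(r (x / y) - l\<^sub>R (real n * x) (real n * y)) * y\<bar> \<le> (B + K) * y"
        using xy by (simp add: abs_mult mult_right_mono)
      also have "\<dots> \<le> (B + K) * (\<bar>x - x0\<bar> + \<bar>y - y0\<bar>)" using B0 K True xy by (intro mult_left_mono) auto
      finally show ?thesis using pos True unfolding scale[OF n] by (simp add: left_diff_distrib)
    qed
    then have "\<forall>\<^sub>F n in sequentially. \<forall>x\<ge>0. \<forall>y\<ge>0. y \<le> 1 \<longrightarrow>
      \<bar>revenue r l\<^sub>R (real n * x) (real n * y) / real n - r (x0 / y0) * y0\<bar> \<le> \<epsilon> + (B + K) * (\<bar>x - x0\<bar> + \<bar>y - y0\<bar>)"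
      by (intro eventually_mono[OF eventually_gt_at_top[of 0]]) auto
    then show ?thesis using B0 K by (intro exI[of _ "B + K"]) auto
  qed
qed

lemma perturbed_systems:
  "\<exists>K\<ge>0. \<forall>a\<in>\<A>. \<forall>n\<ge>1. \<forall>p \<zeta>. 0 \<le> \<zeta> \<longrightarrow> \<zeta> < p \<longrightarrow>
    perturbed_system \<A> \<B> \<delta> \<nu> f \<Omega> n p \<zeta> (Sys n (perturbed_payment p \<zeta>)) a K"
proof -
  obtain K where K: "0 \<le> K" "\<And>x t. 0 \<le> x \<Longrightarrow> 0 \<le> t \<Longrightarrow> \<Omega> x t \<le> K"
    using allocation_bounded by blast
  have "perturbed_system \<A> \<B> \<delta> \<nu> f \<Omega> n p \<zeta> (Sys n (perturbed_payment p \<zeta>)) a K"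
    if a: "a \<in> \<A>" and n: "1 \<le> n" and \<zeta>: "0 \<le> \<zeta>" "\<zeta> < p" for a n p \<zeta>
  proof (intro perturbed_system.intro perturbed_system_axioms.intro)
    show "equilibrium_system \<A> \<B> \<delta> \<nu> f \<Omega> n (perturbed_payment p \<zeta>) (Sys n (perturbed_payment p \<zeta>))"
      by (rule systems[OF n payment_distribution_perturbed[OF \<zeta>]])
    show "0 \<le> f b x \<and> f b x \<le> 1" if "b \<in> space \<B>" "0 \<le> x" for b x
      using choice_range[OF that] by simp
  qed (use a n \<zeta> K demand_prob[OF n a] demand_sets[OF n a] feature_prob[OF a] feature_sets[OF a]
      in \<open>auto intro: \<Omega>_nonneg \<Omega>_mono choice_measurable\<close>)
  then show ?thesis using K(1) by blast
qed

section \<open>Concentration of the demand\<close>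

definition demand_deviation :: "'s \<Rightarrow> nat \<Rightarrow> real" where
  "demand_deviation a n = (\<integral>y. \<bar>y / real n - d a\<bar> \<partial>\<delta> n a)"

text \<open>L2 convergence gives L1 convergence through u \<le> \<epsilon> + u^2 / \<epsilon>. The
  extended-real integral handles the square without a separate proof that it is integrable; the
  threshold \<epsilon>^2 makes its contribution at most \<epsilon>.\<close>

lemma demand_deviation_tendsto:
  assumes a: "a \<in> \<A>"
  shows "demand_deviation a \<longlonglongrightarrow> 0"
proof (rule tendstoI)
  fix s :: real assume s: "0 < s"
  define \<epsilon> where "\<epsilon> = s / 3"
  have \<epsilon>: "0 < \<epsilon>" "2 * \<epsilon> < s" using s by (auto simp: \<epsilon>_def)
  have "\<forall>\<^sub>F n in sequentially. (\<integral>\<^sup>+x. ennreal ((x / real n - d a)\<^sup>2) \<partial>\<delta> n a) < ennreal (\<epsilon>\<^sup>2)"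
    using \<epsilon> by (intro order_tendstoD(2)[OF demand_L2[OF a]]) simp
  then show "\<forall>\<^sub>F n in sequentially. dist (demand_deviation a n) 0 < s"
    using eventually_ge_at_top[of 1]
  proof eventually_elim
    case (elim n)
    interpret \<delta>: prob_space "\<delta> n a" by (rule demand_prob[OF elim(2) a])
    have i: "integrable (\<delta> n a) (\<lambda>y. \<bar>y / real n - d a\<bar>)"
      using demand_integrable[OF elim(2) a] by auto
    have m: "(\<lambda>x. ennreal ((x / real n - d a)\<^sup>2)) \<in> borel_measurable (\<delta> n a)"
      unfolding measurable_cong_sets[OF demand_sets[OF elim(2) a] refl] by measurable
    have "ennreal (demand_deviation a n) = (\<integral>\<^sup>+y. ennreal \<bar>y / real n - d a\<bar> \<partial>\<delta> n a)"
      unfolding demand_deviation_def by (rule nn_integral_eq_integral[symmetric, OF i]) simp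
    also have "\<dots> \<le> (\<integral>\<^sup>+y. ennreal \<epsilon> + ennreal (1 / \<epsilon>) * ennreal ((y / real n - d a)\<^sup>2) \<partial>\<delta> n a)"
    proof (rule nn_integral_mono)
      fix y
      define u where "u = \<bar>y / real n - d a\<bar>"
      have u: "0 \<le> u" by (simp add: u_def)
      have "u * \<epsilon> \<le> \<epsilon> * \<epsilon> + u * u"
      proof (cases "u \<le> \<epsilon>")
        case True
        then have "u * \<epsilon> \<le> \<epsilon> * \<epsilon>" using \<epsilon> by (intro mult_right_mono) auto
        then show ?thesis using u by (simp add: add_increasing2)
      next
        case False
        then have "u * \<epsilon> \<le> u * u" using u by (intro mult_left_mono) auto
        then show ?thesis by (simp add: add_increasing)
      qed
      then have "u \<le> \<epsilon> + 1 / \<epsilon> * u\<^sup>2" using \<epsilon> by (simp add: field_simps power2_eq_square)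
      then have "ennreal u \<le> ennreal (\<epsilon> + 1 / \<epsilon> * u\<^sup>2)" by (rule ennreal_leI)
      also have "\<dots> = ennreal \<epsilon> + ennreal (1 / \<epsilon>) * ennreal (u\<^sup>2)"
      proof -
        have "ennreal (1 / \<epsilon> * u\<^sup>2) = ennreal (1 / \<epsilon>) * ennreal (u\<^sup>2)"
          using \<epsilon> by (intro ennreal_mult') simp
        moreover have "ennreal (\<epsilon> + 1 / \<epsilon> * u\<^sup>2) = ennreal \<epsilon> + ennreal (1 / \<epsilon> * u\<^sup>2)"
          using \<epsilon> by (intro ennreal_plus) auto
        ultimately show ?thesis by simp
      qed
      finally show "ennreal \<bar>y / real n - d a\<bar> \<le> ennreal \<epsilon> + ennreal (1 / \<epsilon>) * ennreal ((y / real n - d a)\<^sup>2)"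
        by (simp add: u_def)
    qed
    also have "\<dots> = ennreal \<epsilon> + ennreal (1 / \<epsilon>) * (\<integral>\<^sup>+y. ennreal ((y / real n - d a)\<^sup>2) \<partial>\<delta> n a)"
      using m by (simp add: nn_integral_add nn_integral_cmult \<delta>.emeasure_space_1)
    also have "\<dots> \<le> ennreal \<epsilon> + ennreal (1 / \<epsilon>) * ennreal (\<epsilon>\<^sup>2)"
      using elim(1) by (intro add_left_mono mult_left_mono) auto
    also have "\<dots> = ennreal (2 * \<epsilon>)"
      using \<epsilon> by (simp add: power2_eq_square flip: ennreal_mult' ennreal_plus)
    finally have "demand_deviation a n \<le> 2 * \<epsilon>" using \<epsilon> by (simp add: ennreal_le_iff)
    moreover have "0 \<le> demand_deviation a n" unfolding demand_deviation_def by simp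
    ultimately show ?case using \<epsilon> by simp
  qed
qed

section \<open>Convergence of equilibria and utilities\<close>

context
  fixes a and p \<zeta> :: real
  assumes a: "a \<in> \<A>" and \<zeta>: "0 \<le> \<zeta>" "\<zeta> < p"
begin

abbreviation "X n \<equiv> Sys n (perturbed_payment p \<zeta>)"
abbreviation "G \<equiv> mean_choice a p \<zeta>"
abbreviation "H \<equiv> mean_payout a p \<zeta>"
abbreviation "m \<equiv> mean_field_allocation \<omega> (d a)"

definition alloc :: "nat \<Rightarrow> real" where "alloc n = expected_allocation \<Omega> n (X n) a"
text \<open>For n \<ge> 1 this is the activity probability of a supplier in the n-th system, so the
  definition encodes the equilibrium condition at finite n.\<close>

definition fraction :: "nat \<Rightarrow> real" where "fraction n = G (alloc n)"
definition noise :: "nat \<Rightarrow> real" where "noise n = demand_deviation a n + 1 / sqrt (real n)"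

lemma noise_tendsto: "noise \<longlonglongrightarrow> 0"
proof -
  have "(\<lambda>n. 1 / sqrt (real n)) \<longlonglongrightarrow> 0"
    by (intro tendsto_divide_0[OF tendsto_const] filterlim_at_top_imp_at_infinity
        filterlim_compose[OF sqrt_at_top filterlim_real_sequentially])
  from tendsto_add[OF demand_deviation_tendsto[OF a] this] show ?thesis by (simp add: noise_def[abs_def])
qed

lemma alloc_nonneg: assumes n: "1 \<le> n" shows "0 \<le> alloc n"
proof -
  obtain K where "perturbed_system \<A> \<B> \<delta> \<nu> f \<Omega> n p \<zeta> (X n) a K"
    using perturbed_systems a n \<zeta> by blast
  then interpret P: perturbed_system \<A> \<B> \<delta> \<nu> f \<Omega> n p \<zeta> "X n" a K .
  show ?thesis unfolding alloc_def by (rule P.e_nonneg)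
qed

lemma mean_field_range: "0 \<le> q \<Longrightarrow> 0 \<le> m q \<and> m q \<le> 1"
  using mean_field_allocation_range[OF regular, of "d a" q] d_pos[OF a] by simp

lemma fraction_range: "1 \<le> n \<Longrightarrow> 0 \<le> fraction n \<and> fraction n \<le> 1"
  unfolding fraction_def using alloc_nonneg mean_choice_range[OF a \<zeta>] by auto

text \<open>Monotonicity of \<open>\<Omega>\<close> lets the random number of active suppliers be clamped at \<open>n * y1\<close>, so the
  approximation at the fixed ratio \<open>d a / y1\<close> suffices although \<open>fraction n\<close> is not known to converge.\<close>

lemma alloc_upper:
  assumes y1: "0 < y1" and \<epsilon>: "0 < \<epsilon>"
  shows "\<exists>C\<ge>0. \<forall>\<^sub>F n in sequentially. y1 \<le> fraction n \<longrightarrow> alloc n \<le> m y1 + \<epsilon> + C * noise n"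
proof -
  obtain C where C: "0 \<le> C" and ev: "\<forall>\<^sub>F n in sequentially. \<forall>x\<ge>0. \<forall>y\<ge>0.
      \<bar>\<Omega> (real n * x) (real n * y) - m y1\<bar> \<le> \<epsilon> + C * (\<bar>x - d a\<bar> + \<bar>y - y1\<bar>)"
    using allocation_approx[OF d_pos[OF a] y1 \<epsilon>] by blast
  have "\<forall>\<^sub>F n in sequentially. y1 \<le> fraction n \<longrightarrow> alloc n \<le> m y1 + \<epsilon> + C * noise n"
    using ev eventually_ge_at_top[of 1]
  proof eventually_elim
    case (elim n)
    show ?case
    proof
      assume le: "y1 \<le> fraction n"
      obtain K where "perturbed_system \<A> \<B> \<delta> \<nu> f \<Omega> n p \<zeta> (X n) a K"
        using perturbed_systems a elim(2) \<zeta> by blast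
      then interpret P: perturbed_system \<A> \<B> \<delta> \<nu> f \<Omega> n p \<zeta> "X n" a K .
      note di = demand_integrable[OF elim(2) a]
      have q: "P.q = fraction n"
        by (simp add: P.q_def fraction_def mean_choice_def response_def alloc_def)
      have "(\<integral>w. \<Omega> (P.D w) (P.num w) \<partial>P.M) \<le> m y1 + \<epsilon> + C * P.deviation (d a) P.q"
      proof (rule P.expectation_le_deviation[OF di P.integrable_allocation C])
        fix w assume w: "w \<in> space P.M"
        define x y where xy: "x = P.D w / real n" "y = P.num w / real n"
        note sc = P.scaled_range[OF w, folded xy]
        have "\<Omega> (P.D w) (P.num w) \<le> \<Omega> (P.D w) (real n * min y y1)"
        proof (rule \<Omega>_antimono)
          have "real n * min y y1 \<le> real n * y" by (intro mult_left_mono) auto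
          then show "real n * min y y1 \<le> P.num w" using sc by simp
        qed (use sc y1 P.demand_nonneg'[OF w] in auto)
        also have "\<dots> = \<Omega> (real n * x) (real n * min y y1)" using sc by simp
        also have "\<dots> \<le> m y1 + \<epsilon> + C * (\<bar>x - d a\<bar> + \<bar>min y y1 - y1\<bar>)"
        proof -
          have "0 \<le> min y y1" using sc y1 by simp
          with elim(1) sc(1) have "\<bar>\<Omega> (real n * x) (real n * min y y1) - m y1\<bar>
              \<le> \<epsilon> + C * (\<bar>x - d a\<bar> + \<bar>min y y1 - y1\<bar>)" by blast
          then show ?thesis by linarith
        qed
        \<comment> \<open>Since y1 \<le> q, a value y below y1 is at least as far from q as from y1;
          above y1 the clamped difference is 0.\<close>
        also have "\<dots> \<le> m y1 + \<epsilon> + C * (\<bar>x - d a\<bar> + \<bar>y - P.q\<bar>)"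
          using le q C by (intro add_left_mono mult_left_mono) auto
        finally show "\<Omega> (P.D w) (P.num w) \<le> m y1 + \<epsilon> + C * (\<bar>P.D w / real n - d a\<bar> + \<bar>P.num w / real n - P.q\<bar>)"
          by (simp add: xy)
      qed
      then show "alloc n \<le> m y1 + \<epsilon> + C * noise n"
        by (simp add: alloc_def expected_allocation_def P.deviation_def noise_def demand_deviation_def)
    qed
  qed
  then show ?thesis using C by blast
qed

lemma alloc_lower:
  assumes y1: "0 < y1" and \<epsilon>: "0 < \<epsilon>"
  shows "\<exists>C\<ge>0. \<forall>\<^sub>F n in sequentially. fraction n \<le> y1 \<longrightarrow> m y1 - \<epsilon> - C * noise n \<le> alloc n"
proof -
  obtain C where C: "0 \<le> C" and ev: "\<forall>\<^sub>F n in sequentially. \<forall>x\<ge>0. \<forall>y\<ge>0.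
      \<bar>\<Omega> (real n * x) (real n * y) - m y1\<bar> \<le> \<epsilon> + C * (\<bar>x - d a\<bar> + \<bar>y - y1\<bar>)"
    using allocation_approx[OF d_pos[OF a] y1 \<epsilon>] by blast
  have "\<forall>\<^sub>F n in sequentially. fraction n \<le> y1 \<longrightarrow> m y1 - \<epsilon> - C * noise n \<le> alloc n"
    using ev eventually_ge_at_top[of 1]
  proof eventually_elim
    case (elim n)
    show ?case
    proof
      assume le: "fraction n \<le> y1"
      obtain K where "perturbed_system \<A> \<B> \<delta> \<nu> f \<Omega> n p \<zeta> (X n) a K"
        using perturbed_systems a elim(2) \<zeta> by blast
      then interpret P: perturbed_system \<A> \<B> \<delta> \<nu> f \<Omega> n p \<zeta> "X n" a K .
      note di = demand_integrable[OF elim(2) a]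
      have q: "P.q = fraction n"
        by (simp add: P.q_def fraction_def mean_choice_def response_def alloc_def)
      have i: "integrable P.M (\<lambda>w. - \<Omega> (P.D w) (P.num w))" using P.integrable_allocation by simp
      \<comment> \<open>A lower bound on the allocation is obtained from the one-sided upper bound
        applied to its negative.\<close>
      have "(\<integral>w. - \<Omega> (P.D w) (P.num w) \<partial>P.M) \<le> (\<epsilon> - m y1) + C * P.deviation (d a) P.q"
      proof (rule P.expectation_le_deviation[OF di i C])
        fix w assume w: "w \<in> space P.M"
        define x y where xy: "x = P.D w / real n" "y = P.num w / real n"
        note sc = P.scaled_range[OF w, folded xy]
        have "m y1 - (\<epsilon> + C * (\<bar>x - d a\<bar> + \<bar>y - P.q\<bar>)) \<le> m y1 - (\<epsilon> + C * (\<bar>x - d a\<bar> + \<bar>max y y1 - y1\<bar>))"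
          using le q C by (intro diff_left_mono add_left_mono mult_left_mono) auto
        also have "\<dots> \<le> \<Omega> (real n * x) (real n * max y y1)"
        proof -
          have "0 \<le> max y y1" using sc y1 by simp
          with elim(1) sc(1) have "\<bar>\<Omega> (real n * x) (real n * max y y1) - m y1\<bar>
              \<le> \<epsilon> + C * (\<bar>x - d a\<bar> + \<bar>max y y1 - y1\<bar>)" by blast
          then show ?thesis by linarith
        qed
        also have "\<dots> = \<Omega> (P.D w) (real n * max y y1)" using sc by simp
        also have "\<dots> \<le> \<Omega> (P.D w) (P.num w)"
        proof (rule \<Omega>_antimono)
          have "real n * y \<le> real n * max y y1" by (intro mult_left_mono) auto
          then show "P.num w \<le> real n * max y y1" using sc by simp
        qed (use P.num_range[OF w] P.demand_nonneg'[OF w] in auto)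
        finally show "- \<Omega> (P.D w) (P.num w) \<le> (\<epsilon> - m y1) + C * (\<bar>P.D w / real n - d a\<bar> + \<bar>P.num w / real n - P.q\<bar>)"
          by (simp add: xy)
      qed
      then show "m y1 - \<epsilon> - C * noise n \<le> alloc n"
        by (simp add: alloc_def expected_allocation_def P.deviation_def noise_def demand_deviation_def)
    qed
  qed
  then show ?thesis using C by blast
qed

lemma noise_small:
  assumes "0 < s"
  shows "\<forall>\<^sub>F n in sequentially. C * noise n < s"
proof -
  have "(\<lambda>n. C * noise n) \<longlonglongrightarrow> C * 0" by (intro tendsto_intros noise_tendsto)
  then show ?thesis using assms by (intro order_tendstoD(2)) auto
qed

context
  fixes q
  assumes q: "0 \<le> q" and equilibrium: "q = G (m q)"
begin

text \<open>If the fraction stayed above some y1 > q, the allocation would be at most m q up to a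
  small error, and G, being monotone and Lipschitz, would return a fraction below y1; the other side
  is symmetric. Any nonnegative root q of the equation is thus shown to be the limit.\<close>

lemma fraction_tendsto: "fraction \<longlonglongrightarrow> q"
proof -
  obtain L where L: "0 \<le> L" and lip: "\<And>y y'. 0 \<le> y \<Longrightarrow> 0 \<le> y' \<Longrightarrow> \<bar>G y - G y'\<bar> \<le> L * \<bar>y - y'\<bar>"
    using mean_lipschitz[OF a \<zeta>] by blast
  have small: "L * (2 * (s / (2 * (L + 1)))) < s" if "0 < s" for s
    using that L by (simp add: field_simps)
  have close: "\<bar>G y - q\<bar> < s" if "0 < s" "0 \<le> y" "\<bar>y - m q\<bar> \<le> 2 * (s / (2 * (L + 1)))" for s y
  proof -
    have "\<bar>G y - q\<bar> \<le> L * \<bar>y - m q\<bar>"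
      using lip[OF that(2), of "m q"] mean_field_range[OF q] equilibrium by simp
    also have "\<dots> \<le> L * (2 * (s / (2 * (L + 1))))" using that L by (intro mult_left_mono)
    also have "\<dots> < s" by (rule small[OF that(1)])
    finally show ?thesis .
  qed
  show ?thesis
  proof (rule order_tendstoI)
    fix y1 assume y1: "q < y1"
    \<comment> \<open>Chosen so that an allocation error of 2 * \<epsilon> moves G by less than y1 -
      q; the summand 1 covers L = 0.\<close>
    define \<epsilon> where "\<epsilon> = (y1 - q) / (2 * (L + 1))"
    have \<epsilon>: "0 < \<epsilon>" using y1 L by (simp add: \<epsilon>_def)
    obtain C where "\<forall>\<^sub>F n in sequentially. y1 \<le> fraction n \<longrightarrow> alloc n \<le> m y1 + \<epsilon> + C * noise n"
      using alloc_upper[of y1 \<epsilon>] y1 q \<epsilon> by fastforce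
    with noise_small[OF \<epsilon>, of C] eventually_ge_at_top[of 1]
    show "\<forall>\<^sub>F n in sequentially. fraction n < y1"
    proof eventually_elim
      case (elim n)
      show ?case
      proof (rule ccontr)
        assume ge: "\<not> fraction n < y1"
        have "m y1 \<le> m q"
          using mean_field_allocation_antimono[OF regular _ q, of "d a" y1] d_pos[OF a] y1 by simp
        with ge elim have up: "alloc n \<le> m q + 2 * \<epsilon>" by linarith
        \<comment> \<open>Below m q monotonicity of G alone suffices; above it the allocation is
          within 2 * \<epsilon> of m q and the Lipschitz bound applies.\<close>
        have "fraction n < y1"
        proof (cases "alloc n \<le> m q")
          case True
          then have "fraction n \<le> q"
            unfolding fraction_def by (subst equilibrium) (rule mean_choice_mono[OF a \<zeta> alloc_nonneg[OF elim(2)]])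
          then show ?thesis using y1 by simp
        next
          case False
          then have "\<bar>alloc n - m q\<bar> \<le> 2 * ((y1 - q) / (2 * (L + 1)))" using up by (simp add: \<epsilon>_def)
          from close[OF _ alloc_nonneg[OF elim(2)] this] y1 show ?thesis by (simp add: fraction_def)
        qed
        then show False using ge by simp
      qed
    qed
  next
    fix s assume s: "s < q"
    show "\<forall>\<^sub>F n in sequentially. s < fraction n"
    proof (cases "q = 0")
      case True
      show ?thesis using eventually_ge_at_top[of 1]
        by eventually_elim (use fraction_range s True in force)
    next
      case False
      \<comment> \<open>The level must be positive, since the approximation of \<Omega> needs a
        positive centre; s itself may be negative.\<close>
      define y1 where "y1 = max s (q / 2)"
      have y1: "0 < y1" "y1 < q" "s \<le> y1" using s False q by (auto simp: y1_def)
      define \<epsilon> where "\<epsilon> = (q - y1) / (2 * (L + 1))"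
      have \<epsilon>: "0 < \<epsilon>" using y1 L by (simp add: \<epsilon>_def)
      obtain C where "\<forall>\<^sub>F n in sequentially. fraction n \<le> y1 \<longrightarrow> m y1 - \<epsilon> - C * noise n \<le> alloc n"
        using alloc_lower[OF y1(1) \<epsilon>] by blast
      with noise_small[OF \<epsilon>, of C] eventually_ge_at_top[of 1]
      show ?thesis
      proof eventually_elim
        case (elim n)
        have "y1 < fraction n"
        proof (rule ccontr)
          assume le: "\<not> y1 < fraction n"
          have "m q \<le> m y1"
            using mean_field_allocation_antimono[OF regular, of "d a" y1 q] d_pos[OF a] y1 by simp
          with le elim have low: "m q - 2 * \<epsilon> \<le> alloc n" by linarith
          have "y1 < fraction n"
          proof (cases "m q \<le> alloc n")
            case True
            then have "q \<le> fraction n"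
              unfolding fraction_def using mean_choice_mono[OF a \<zeta>, of "m q" "alloc n"] mean_field_range[OF q] equilibrium
              by simp
            then show ?thesis using y1 by simp
          next
            case False
            then have "\<bar>alloc n - m q\<bar> \<le> 2 * ((q - y1) / (2 * (L + 1)))" using low by (simp add: \<epsilon>_def)
            from close[OF _ alloc_nonneg[OF elim(2)] this] y1 show ?thesis by (simp add: fraction_def)
          qed
          then show False using le by simp
        qed
        then show ?case using y1 by simp
      qed
    qed
  qed
qed

text \<open>The quantity \<open>deviation (d a) q\<close> of the n-th system, written without
  reference to its probability space.\<close>

definition spread :: "nat \<Rightarrow> real" where "spread n = noise n + \<bar>fraction n - q\<bar>"

lemma spread_tendsto: "spread \<longlonglongrightarrow> 0"
proof -
  have "(\<lambda>n. \<bar>fraction n - q\<bar>) \<longlonglongrightarrow> \<bar>q - q\<bar>" by (intro tendsto_intros fraction_tendsto)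
  from tendsto_add[OF noise_tendsto this] show ?thesis by (simp add: spread_def[abs_def])
qed

text \<open>Positivity of q is what places the centre (d a, q) inside the region where the
  lower-order term is controlled.\<close>

lemma alloc_tendsto:
  assumes pos: "0 < q"
  shows "alloc \<longlonglongrightarrow> m q"
proof -
  have "(\<lambda>n. alloc n - m q) \<longlonglongrightarrow> 0"
  proof (rule tendsto_zero_by_deviation[OF spread_tendsto, of 1])
    fix \<epsilon> :: real assume \<epsilon>: "0 < \<epsilon>"
    obtain C where C: "0 \<le> C" and ev: "\<forall>\<^sub>F n in sequentially. \<forall>x\<ge>0. \<forall>y\<ge>0.
        \<bar>\<Omega> (real n * x) (real n * y) - m q\<bar> \<le> \<epsilon> + C * (\<bar>x - d a\<bar> + \<bar>y - q\<bar>)"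
      using allocation_approx[OF d_pos[OF a] pos \<epsilon>] by blast
    have "\<forall>\<^sub>F n in sequentially. \<bar>alloc n - m q\<bar> \<le> 1 * (\<epsilon> + C * spread n)"
      using ev eventually_ge_at_top[of 1]
    proof eventually_elim
      case (elim n)
      obtain K where "perturbed_system \<A> \<B> \<delta> \<nu> f \<Omega> n p \<zeta> (X n) a K"
        using perturbed_systems a elim(2) \<zeta> by blast
      then interpret P: perturbed_system \<A> \<B> \<delta> \<nu> f \<Omega> n p \<zeta> "X n" a K .
      note di = demand_integrable[OF elim(2) a]
      have Pq: "P.q = fraction n"
        by (simp add: P.q_def fraction_def mean_choice_def response_def alloc_def)
      have meas: "(\<lambda>w. \<Omega> (P.D w) (P.num w) - m q) \<in> borel_measurable P.M"
        by (intro borel_measurable_diff P.measurable_allocation borel_measurable_const)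
      have "\<bar>\<integral>w. \<Omega> (P.D w) (P.num w) - m q \<partial>P.M\<bar> \<le> \<epsilon> + C * P.deviation (d a) q"
      proof (rule P.abs_expectation_le_deviation(2)[OF di meas C])
        fix w assume w: "w \<in> space P.M"
        note sc = P.scaled_range[OF w]
        have "\<bar>\<Omega> (real n * (P.D w / real n)) (real n * (P.num w / real n)) - m q\<bar>
            \<le> \<epsilon> + C * (\<bar>P.D w / real n - d a\<bar> + \<bar>P.num w / real n - q\<bar>)"
          using elim(1) sc(1,2) by blast
        then show "\<bar>\<Omega> (P.D w) (P.num w) - m q\<bar> \<le> \<epsilon> + C * (\<bar>P.D w / real n - d a\<bar> + \<bar>P.num w / real n - q\<bar>)"
          unfolding sc(4,5) .
      qed
      moreover have "(\<integral>w. \<Omega> (P.D w) (P.num w) - m q \<partial>P.M) = alloc n - m q"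
        using P.integrable_allocation by (simp add: alloc_def expected_allocation_def P.prob_space)
      moreover have "P.deviation (d a) q = spread n"
        by (simp add: P.deviation_def Pq spread_def noise_def demand_deviation_def)
      ultimately show ?case by simp
    qed
    then show "\<exists>C. \<forall>\<^sub>F n in sequentially. \<bar>alloc n - m q\<bar> \<le> 1 * (\<epsilon> + C * spread n)" by blast
  qed simp
  from tendsto_add[OF this tendsto_const[of "m q"]] show ?thesis by simp
qed

text \<open>For q > 0 this is continuity of H along the allocation. For q = 0 the payout is squeezed
  by 2p times the fraction, so the allocation may behave arbitrarily.\<close>

lemma payout_tendsto: "(\<lambda>n. H (alloc n)) \<longlonglongrightarrow> H (m q)"
proof (cases "q = 0")
  case False
  obtain L where lip: "\<And>y y'. 0 \<le> y \<Longrightarrow> 0 \<le> y' \<Longrightarrow> \<bar>H y - H y'\<bar> \<le> L * \<bar>y - y'\<bar>"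
    using mean_lipschitz[OF a \<zeta>] by blast
  have "(\<lambda>n. \<bar>alloc n - m q\<bar>) \<longlonglongrightarrow> \<bar>m q - m q\<bar>"
    using q False by (intro tendsto_intros alloc_tendsto) simp
  then have lim: "(\<lambda>n. L * \<bar>alloc n - m q\<bar>) \<longlonglongrightarrow> 0" by (intro tendsto_mult_right_zero) simp
  have "(\<lambda>n. H (alloc n) - H (m q)) \<longlonglongrightarrow> 0"
  proof (rule Lim_null_comparison[OF _ lim])
    show "\<forall>\<^sub>F n in sequentially. norm (H (alloc n) - H (m q)) \<le> L * \<bar>alloc n - m q\<bar>"
      using eventually_ge_at_top[of 1]
      by eventually_elim (use lip alloc_nonneg mean_field_range[OF q] in auto)
  qed
  from tendsto_add[OF this tendsto_const[of "H (m q)"]] show ?thesis by simp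
next
  case True
  have "H (m q) = 0"
    using mean_payout_range[OF a \<zeta>, of "m q"] mean_field_range[OF q] equilibrium True by simp
  moreover have lim: "(\<lambda>n. 2 * p * fraction n) \<longlonglongrightarrow> 0"
    using tendsto_mult_right_zero[OF fraction_tendsto[unfolded True]] by simp
  have "(\<lambda>n. H (alloc n)) \<longlonglongrightarrow> 0"
  proof (rule Lim_null_comparison[OF _ lim])
    show "\<forall>\<^sub>F n in sequentially. norm (H (alloc n)) \<le> 2 * p * fraction n"
      using eventually_ge_at_top[of 1]
      by eventually_elim (use mean_payout_range[OF a \<zeta>] alloc_nonneg in \<open>auto simp: fraction_def\<close>)
  qed
  ultimately show ?thesis by simp
qed

text \<open>The utility is compared first with an expression that keeps the finite-n payout
  \<open>H (alloc n)\<close>, because the one-system estimate is exact in the payout; the payout is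
  sent to its limit afterwards.\<close>

lemma utility_tendsto:
  assumes nondeg: "0 < q \<or> bounded (r ` {0..})"
  shows "utility r l\<^sub>R Sys a (perturbed_payment p \<zeta>) \<longlonglongrightarrow> r (d a / q) * q - H (m q) * m q"
proof -
  let ?u = "utility r l\<^sub>R Sys a (perturbed_payment p \<zeta>)"
  let ?\<rho> = "r (d a / q) * q"
  obtain K where "\<And>x y. 0 \<le> x \<Longrightarrow> 0 \<le> y \<Longrightarrow> \<bar>r x - r y\<bar> \<le> K * \<bar>x - y\<bar>" "0 \<le> K"
    using smooth_bounded_derivatives_lipschitz[OF r_smooth] by blast
  then have "K-lipschitz_on {0..} r" by (intro lipschitz_onI) (auto simp: dist_real_def)
  then have rc: "continuous_on {0..} r" by (rule lipschitz_on_continuous_on)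
  have "(\<lambda>n. ?u n - (?\<rho> - H (alloc n) * m q)) \<longlonglongrightarrow> 0"
  proof (rule tendsto_zero_by_deviation[OF spread_tendsto, of "1 + 2 * p"])
    fix \<epsilon> :: real assume \<epsilon>: "0 < \<epsilon>"
    obtain C1 where C1: "0 \<le> C1" and R: "\<forall>\<^sub>F n in sequentially. \<forall>x\<ge>0. \<forall>y\<ge>0. y \<le> 1 \<longrightarrow>
        \<bar>revenue r l\<^sub>R (real n * x) (real n * y) / real n - ?\<rho>\<bar> \<le> \<epsilon> + C1 * (\<bar>x - d a\<bar> + \<bar>y - q\<bar>)"
      using revenue_approx[OF d_pos[OF a] q \<epsilon> nondeg] by blast
    obtain C2 where C2: "0 \<le> C2" and W: "\<forall>\<^sub>F n in sequentially. \<forall>x\<ge>0. \<forall>y\<ge>0. y \<le> 1 \<longrightarrow>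
        y * \<bar>\<Omega> (real n * x) (real n * y) - m q\<bar> \<le> \<epsilon> + C2 * (\<bar>x - d a\<bar> + \<bar>y - q\<bar>)"
      using weighted_allocation_approx[OF d_pos[OF a] q \<epsilon>] by blast
    define C where "C = C1 + C2"
    have C: "0 \<le> C" using C1 C2 by (simp add: C_def)
    have Cle: "C1 * z \<le> C * z" "C2 * z \<le> C * z" if "0 \<le> z" for z
      using that C1 C2 by (auto simp: C_def intro!: mult_right_mono)
    have "\<forall>\<^sub>F n in sequentially. \<bar>?u n - (?\<rho> - H (alloc n) * m q)\<bar> \<le> (1 + 2 * p) * (\<epsilon> + C * spread n)"
      using R W eventually_ge_at_top[of 1]
    proof eventually_elim
      case (elim n)
      obtain K where "perturbed_system \<A> \<B> \<delta> \<nu> f \<Omega> n p \<zeta> (X n) a K"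
        using perturbed_systems a elim(3) \<zeta> by blast
      then interpret P: perturbed_system \<A> \<B> \<delta> \<nu> f \<Omega> n p \<zeta> "X n" a K .
      note di = demand_integrable[OF elim(3) a]
      have Pq: "P.q = fraction n"
        by (simp add: P.q_def fraction_def mean_choice_def response_def alloc_def)
      have Pp: "P.payout = H (alloc n)"
        by (simp add: P.payout_def mean_payout_def response_def alloc_def)
      have dev: "P.deviation (d a) q = spread n"
        by (simp add: P.deviation_def Pq spread_def noise_def demand_deviation_def)
      have "\<bar>1 / real n * (\<integral>w. platform_utility r l\<^sub>R n (X n) w \<partial>P.M) - (?\<rho> - P.payout * m q)\<bar>
          \<le> (1 + 2 * p) * (\<epsilon> + C * P.deviation (d a) q)"
      proof (rule P.platform_utility_approx[OF di rc l\<^sub>R_measurable C])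
        fix x y :: real assume xy: "0 \<le> x" "0 \<le> y" "y \<le> 1"
        have z: "0 \<le> \<bar>x - d a\<bar> + \<bar>y - q\<bar>" by simp
        have "\<bar>revenue r l\<^sub>R (real n * x) (real n * y) / real n - ?\<rho>\<bar> \<le> \<epsilon> + C1 * (\<bar>x - d a\<bar> + \<bar>y - q\<bar>)"
          using elim(1) xy by blast
        then show "\<bar>revenue r l\<^sub>R (real n * x) (real n * y) / real n - ?\<rho>\<bar> \<le> \<epsilon> + C * (\<bar>x - d a\<bar> + \<bar>y - q\<bar>)"
          using Cle(1)[OF z] by linarith
        have "y * \<bar>\<Omega> (real n * x) (real n * y) - m q\<bar> \<le> \<epsilon> + C2 * (\<bar>x - d a\<bar> + \<bar>y - q\<bar>)"
          using elim(2) xy by blast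
        then show "y * \<bar>\<Omega> (real n * x) (real n * y) - m q\<bar> \<le> \<epsilon> + C * (\<bar>x - d a\<bar> + \<bar>y - q\<bar>)"
          using Cle(2)[OF z] by linarith
      qed
      then show ?case unfolding Pp dev utility_def .
    qed
    then show "\<exists>C. \<forall>\<^sub>F n in sequentially. \<bar>?u n - (?\<rho> - H (alloc n) * m q)\<bar> \<le> (1 + 2 * p) * (\<epsilon> + C * spread n)"
      by blast
  qed (use \<zeta> in simp)
  moreover have "(\<lambda>n. ?\<rho> - H (alloc n) * m q) \<longlonglongrightarrow> ?\<rho> - H (m q) * m q"
    by (intro tendsto_intros payout_tendsto)
  ultimately show ?thesis by (rule Lim_transform[rotated])
qed

end

end

text \<open>The map \<open>q \<mapsto> q - mean_choice a p \<zeta> (m q)\<close> has slope at least 1, so a perturbation of order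
  \<open>\<zeta>\<^sup>2\<close> of the mean choice moves its root by at most as much.\<close>

lemma equilibrium_perturbation:
  assumes a: "a \<in> \<A>" and \<zeta>: "0 \<le> \<zeta>" "\<zeta> < p"
    and q0: "0 \<le> q0" "q0 = mean_choice a p 0 (mean_field_allocation \<omega> (d a) q0)"
    and q1: "0 \<le> q1" "q1 = mean_choice a p \<zeta> (mean_field_allocation \<omega> (d a) q1)"
    and c: "\<And>y. 0 \<le> y \<Longrightarrow> y \<le> 1 \<Longrightarrow> \<bar>mean_choice a p \<zeta> y - mean_choice a p 0 y\<bar> \<le> c"
  shows "\<bar>q1 - q0\<bar> \<le> c"
proof -
  let ?m = "mean_field_allocation \<omega> (d a)"
  have m: "0 \<le> ?m q \<and> ?m q \<le> 1" if "0 \<le> q" for q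
    using mean_field_allocation_range[OF regular _ that, of "d a"] d_pos[OF a] by simp
  have dm: "?m q' \<le> ?m q" if "0 \<le> q" "q \<le> q'" for q q'
    using mean_field_allocation_antimono[OF regular _ that, of "d a"] d_pos[OF a] by simp
  have c0: "\<bar>mean_choice a p \<zeta> (?m q0) - q0\<bar> \<le> c" using c[of "?m q0"] m[OF q0(1)] q0(2) by simp
  show ?thesis
  proof (cases "q0 \<le> q1")
    case True
    \<comment> \<open>Going from q0 to the larger q1 lowers the allocation, so q0 \<le> q1 \<le> G(m
      q0) with the perturbed G, and the right-hand side exceeds q0 by at most c.\<close>
    have "q1 \<le> mean_choice a p \<zeta> (?m q0)"
      using mean_choice_mono[OF a \<zeta>, of "?m q1" "?m q0"] dm[OF q0(1) True] m[OF q1(1)] q1(2) by simp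
    then show ?thesis using c0 True by linarith
  next
    case False
    have "mean_choice a p \<zeta> (?m q0) \<le> q1"
      using mean_choice_mono[OF a \<zeta>, of "?m q0" "?m q1"] dm[OF q1(1), of q0] False m[OF q0(1)] q1(2) by simp
    then show ?thesis using c0 False by linarith
  qed
qed

section \<open>Loss for a single state and payment\<close>

text \<open>Convergence is part of the conclusion because \<open>mean_field_utility\<close> is a
  \<open>lim\<close>, which means nothing for a divergent sequence. The constants may depend on the
  state and the payment.\<close>

lemma perturbation_loss:
  assumes a: "a \<in> \<A>" and p: "0 < p"
    and nondeg: "bounded (r ` {0..}) \<or> \<not> (AE b in \<nu> a. f b (p * Lim at_top \<omega>) = 0)"
  shows "\<exists>C\<ge>0. \<exists>\<alpha>>0. \<forall>\<zeta>. 0 \<le> \<zeta> \<and> \<zeta> < \<alpha> \<longrightarrow>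
    \<zeta> < p \<and> convergent (utility r l\<^sub>R Sys a (perturbed_payment p \<zeta>)) \<and>
    mean_field_utility r l\<^sub>R Sys a p 0 - mean_field_utility r l\<^sub>R Sys a p \<zeta> \<le> C * \<zeta>\<^sup>2"
proof -
  let ?m = "mean_field_allocation \<omega> (d a)"
  have m: "0 \<le> ?m q \<and> ?m q \<le> 1" if "0 \<le> q" for q
    using mean_field_allocation_range[OF regular _ that, of "d a"] d_pos[OF a] by simp
  \<comment> \<open>One root is selected for every admissible \<zeta>.\<close>
  have "\<exists>q. \<forall>\<zeta>. 0 \<le> \<zeta> \<longrightarrow> \<zeta> < p \<longrightarrow> 0 \<le> q \<zeta> \<and> q \<zeta> \<le> 1 \<and> q \<zeta> = mean_choice a p \<zeta> (?m (q \<zeta>))"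
  proof (intro choice allI)
    fix \<zeta>
    show "\<exists>y. 0 \<le> \<zeta> \<longrightarrow> \<zeta> < p \<longrightarrow> 0 \<le> y \<and> y \<le> 1 \<and> y = mean_choice a p \<zeta> (?m y)"
      using equilibrium_exists[OF a, of \<zeta> p] by (cases "0 \<le> \<zeta> \<and> \<zeta> < p") auto
  qed
  then obtain q where q: "\<And>\<zeta>. 0 \<le> \<zeta> \<Longrightarrow> \<zeta> < p \<Longrightarrow>
      0 \<le> q \<zeta> \<and> q \<zeta> \<le> 1 \<and> q \<zeta> = mean_choice a p \<zeta> (?m (q \<zeta>))" by blast
  obtain L where L: "0 \<le> L"
    and pert: "\<And>\<zeta> y. 0 \<le> \<zeta> \<Longrightarrow> \<zeta> < p \<Longrightarrow> 0 \<le> y \<Longrightarrow> y \<le> 1 \<Longrightarrow>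
      \<bar>mean_choice a p \<zeta> y - mean_choice a p 0 y\<bar> \<le> L * \<zeta>\<^sup>2 \<and>
      \<bar>mean_payout a p \<zeta> y - mean_payout a p 0 y\<bar> \<le> L * (1 + p) * \<zeta>\<^sup>2"
    using mean_perturbation a by blast
  define q0 where "q0 = q 0"
  have q0: "0 \<le> q0" "q0 \<le> 1" "q0 = mean_choice a p 0 (?m q0)" using q[of 0] p by (auto simp: q0_def)
  have dq: "\<bar>q \<zeta> - q0\<bar> \<le> L * \<zeta>\<^sup>2" if "0 \<le> \<zeta>" "\<zeta> < p" for \<zeta>
    using equilibrium_perturbation[OF a that q0(1,3), of "q \<zeta>" "L * \<zeta>\<^sup>2"] q[OF that] pert[OF that] by blast
  define u where "u \<zeta> = r (d a / q \<zeta>) * q \<zeta> - mean_payout a p \<zeta> (?m (q \<zeta>)) * ?m (q \<zeta>)" for \<zeta>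
  have lim: "utility r l\<^sub>R Sys a (perturbed_payment p \<zeta>) \<longlonglongrightarrow> u \<zeta>"
    if "0 \<le> \<zeta>" "\<zeta> < p" "0 < q \<zeta> \<or> bounded (r ` {0..})" for \<zeta>
    unfolding u_def using q[OF that(1,2)] that(3) by (intro utility_tendsto[OF a that(1,2)]) auto
  have mfu: "mean_field_utility r l\<^sub>R Sys a p \<zeta> = u \<zeta>"
    if "0 \<le> \<zeta>" "\<zeta> < p" "0 < q \<zeta> \<or> bounded (r ` {0..})" for \<zeta>
    unfolding mean_field_utility_def using lim[OF that] by (rule limI)
  show ?thesis
  proof (cases "q0 = 0")
    case True
    \<comment> \<open>With nobody active, the allocation is the limit of \<omega> and the mean
      response at p times it is 0, so f vanishes there almost surely; the other alternative of
      \<open>nondeg\<close> is then excluded.\<close>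
    have "bounded (r ` {0..})"
    proof (rule ccontr)
      assume "\<not> bounded (r ` {0..})"
      with nondeg have "\<not> (AE b in \<nu> a. f b (p * Lim at_top \<omega>) = 0)" by simp
      moreover have z: "0 \<le> p * Lim at_top \<omega>" using p Lim_regular_allocation_range[OF regular] by simp
      moreover have "(\<integral>b. f b (p * Lim at_top \<omega>) \<partial>\<nu> a) = 0"
        using q0(3) True by (simp add: mean_choice_def response_def mean_field_allocation_def)
      moreover have "AE b in \<nu> a. 0 \<le> f b (p * Lim at_top \<omega>)"
        using choice_range z by (intro AE_I2) (auto simp: space_feature[OF a])
      ultimately show False
        using integral_nonneg_eq_0_iff_AE[OF integrable_response[OF a z]] by simp
    qed
    then obtain B where B: "\<And>x. 0 \<le> x \<Longrightarrow> \<bar>r x\<bar> \<le> B" unfolding bounded_iff by auto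
    have B0: "0 \<le> B" using B[of 0] by simp
    have H0: "mean_payout a p 0 (?m q0) = 0"
      using mean_payout_range[OF a order_refl p, of "?m q0"] m[OF q0(1)] q0(3) True by simp
    then have u0: "u 0 = 0" using True by (simp add: u_def q0_def)
    have "u 0 - u \<zeta> \<le> (B + 2 * p) * L * \<zeta>\<^sup>2" if z: "0 \<le> \<zeta>" "\<zeta> < p" for \<zeta>
    proof -
      note qz = q[OF z]
      have "\<bar>r (d a / q \<zeta>) * q \<zeta>\<bar> \<le> B * q \<zeta>"
        using B[of "d a / q \<zeta>"] qz d_pos[OF a] by (simp add: abs_mult mult_right_mono)
      moreover have "mean_payout a p \<zeta> (?m (q \<zeta>)) * ?m (q \<zeta>) \<le> 2 * p * q \<zeta> * 1"
        using mean_payout_range[OF a z, of "?m (q \<zeta>)"] m[of "q \<zeta>"] qz by (intro mult_mono) auto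
      \<comment> \<open>Here the unperturbed utility is 0 and the perturbed one is at most a
        multiple of q \<zeta> in size on the loss side; q \<zeta> itself is of order \<zeta>^2
        because q0 = 0.\<close>
      ultimately have "- u \<zeta> \<le> B * q \<zeta> + 2 * p * q \<zeta>" unfolding u_def by linarith
      also have "\<dots> = (B + 2 * p) * q \<zeta>" by (simp add: algebra_simps)
      also have "\<dots> \<le> (B + 2 * p) * (L * \<zeta>\<^sup>2)"
        using dq[OF z] True B0 p by (intro mult_left_mono) auto
      finally show ?thesis by (simp add: u0 mult.assoc)
    qed
    moreover have "convergent (utility r l\<^sub>R Sys a (perturbed_payment p \<zeta>)) \<and> mean_field_utility r l\<^sub>R Sys a p \<zeta> = u \<zeta>"
      if "0 \<le> \<zeta>" "\<zeta> < p" for \<zeta>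
      using lim[OF that] mfu[OF that] \<open>bounded (r ` {0..})\<close> by (auto simp: convergent_def)
    moreover have "0 \<le> (B + 2 * p) * L" using p B0 L by simp
    ultimately have "\<forall>\<zeta>. 0 \<le> \<zeta> \<and> \<zeta> < p \<longrightarrow>
        \<zeta> < p \<and> convergent (utility r l\<^sub>R Sys a (perturbed_payment p \<zeta>)) \<and>
        mean_field_utility r l\<^sub>R Sys a p 0 - mean_field_utility r l\<^sub>R Sys a p \<zeta> \<le> (B + 2 * p) * L * \<zeta>\<^sup>2"
      using p by simp
    with p \<open>0 \<le> (B + 2 * p) * L\<close> show ?thesis by blast
  next
    case False
    then have q0p: "0 < q0" using q0 by simp
    \<comment> \<open>\<zeta> < 1 gives L * \<zeta>^2 \<le> (L + 1) * \<zeta> < q0, so the root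
      moves by less than q0 and stays positive.\<close>
    define \<alpha> where "\<alpha> = min 1 (min p (q0 / (L + 1)))"
    have \<alpha>: "0 < \<alpha>" using p q0p L by (simp add: \<alpha>_def)
    have z: "\<zeta> < p" "0 < q \<zeta>" if "0 \<le> \<zeta>" "\<zeta> < \<alpha>" for \<zeta>
    proof -
      have z': "\<zeta> < 1" "\<zeta> < p" "\<zeta> < q0 / (L + 1)" using that by (auto simp: \<alpha>_def)
      show "\<zeta> < p" by (rule z'(2))
      have "L * \<zeta>\<^sup>2 \<le> L * \<zeta>"
        using L that z'(1) by (intro mult_left_mono) (auto simp: power2_eq_square mult_left_le)
      also have "\<dots> \<le> (L + 1) * \<zeta>" using that by (intro mult_right_mono) auto
      also have "\<dots> < q0" using z'(3) L by (simp add: field_simps)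
      finally show "0 < q \<zeta>" using dq[OF that(1) z'(2)] by linarith
    qed
    obtain K where K: "0 \<le> K" "\<And>x y. 0 \<le> x \<Longrightarrow> 0 \<le> y \<Longrightarrow> \<bar>r x - r y\<bar> \<le> K * \<bar>x - y\<bar>"
      using smooth_bounded_derivatives_lipschitz[OF r_smooth] by blast
    obtain C1 where C1: "0 \<le> C1" "\<And>x y. 0 \<le> x \<Longrightarrow> 0 \<le> y \<Longrightarrow>
        \<bar>r (x / y) * y - r (d a / q0) * q0\<bar> \<le> C1 * (\<bar>x - d a\<bar> + \<bar>y - q0\<bar>)"
      using perspective_approx[OF K(2) K(1) d_pos[OF a] q0p] by blast
    obtain C2 where C2: "0 \<le> C2" "\<And>x y. 0 \<le> x \<Longrightarrow> 0 \<le> y \<Longrightarrow>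
        \<bar>mean_field_allocation \<omega> x y - \<omega> (d a / q0)\<bar> \<le> C2 * (\<bar>x - d a\<bar> + \<bar>y - q0\<bar>)"
      using mean_field_allocation_approx[OF regular d_pos[OF a] q0p] by blast
    obtain L' where L': "0 \<le> L'" "\<And>y y'. 0 \<le> y \<Longrightarrow> 0 \<le> y' \<Longrightarrow>
        \<bar>mean_payout a p 0 y - mean_payout a p 0 y'\<bar> \<le> L' * \<bar>y - y'\<bar>"
      using mean_lipschitz[OF a order_refl p] by blast
    \<comment> \<open>The summands stem from the revenue, from the change of the payout function at
      fixed allocation, and from the shift of the allocation, which acts inside the payout (L') and
      as its factor (2 * p).\<close>
    define C where "C = C1 * L + (L * (1 + p) + (L' + 2 * p) * (C2 * L))"
    have C: "0 \<le> C" using C1 C2 L L' p by (simp add: C_def)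
    have "u 0 - u \<zeta> \<le> C * \<zeta>\<^sup>2" if \<zeta>: "0 \<le> \<zeta>" "\<zeta> < \<alpha>" for \<zeta>
    proof -
      note zp = z(1)[OF \<zeta>]
      note qz = q[OF \<zeta>(1) zp]
      define m0 m1 where mm: "m0 = ?m q0" "m1 = ?m (q \<zeta>)"
      define h0 h1 h where hh:
        "h0 = mean_payout a p 0 m0" "h1 = mean_payout a p 0 m1" "h = mean_payout a p \<zeta> m1"
      note hm = mm hh
      have mr: "0 \<le> m0" "m0 \<le> 1" "0 \<le> m1" "m1 \<le> 1" using m[OF q0(1)] m[of "q \<zeta>"] qz by (auto simp: hm)
      have "\<bar>m1 - m0\<bar> \<le> C2 * \<bar>q \<zeta> - q0\<bar>"
        using C2(2)[of "d a" "q \<zeta>"] d_pos[OF a] qz q0p by (simp add: hm mean_field_allocation_def)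
      also have "\<dots> \<le> C2 * (L * \<zeta>\<^sup>2)" using dq[OF \<zeta>(1) zp] C2 by (intro mult_left_mono)
      finally have dm: "\<bar>m1 - m0\<bar> \<le> C2 * (L * \<zeta>\<^sup>2)" .
      have "\<bar>h1 - h0\<bar> \<le> L' * \<bar>m1 - m0\<bar>" unfolding hm(3,4) using mr by (intro L'(2))
      also have "\<dots> \<le> L' * (C2 * (L * \<zeta>\<^sup>2))" using dm L' by (intro mult_left_mono)
      finally have dh: "\<bar>h1 - h0\<bar> \<le> L' * (C2 * (L * \<zeta>\<^sup>2))" .
      have dh': "\<bar>h - h1\<bar> \<le> L * (1 + p) * \<zeta>\<^sup>2" unfolding hm(4,5) using pert[OF \<zeta>(1) zp mr(3,4)] by simp
      have "h0 \<le> 2 * p * mean_choice a p 0 m0" "0 \<le> h0"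
        unfolding hm(3) using mean_payout_range[OF a order_refl p mr(1)] by auto
      moreover have "2 * p * mean_choice a p 0 m0 \<le> 2 * p * 1"
        using mean_choice_range[OF a order_refl p mr(1)] p by (intro mult_left_mono) auto
      ultimately have h0: "\<bar>h0\<bar> \<le> 2 * p" by simp
      \<comment> \<open>Three changes are separated: the payout function, its argument, and the
        allocation multiplying it.\<close>
      have "\<bar>h * m1 - h0 * m0\<bar> = \<bar>(h - h1) * m1 + (h1 - h0) * m1 + h0 * (m1 - m0)\<bar>"
        by (simp add: algebra_simps)
      also have "\<dots> \<le> \<bar>(h - h1) * m1\<bar> + \<bar>(h1 - h0) * m1\<bar> + \<bar>h0 * (m1 - m0)\<bar>" by linarith
      also have "\<dots> \<le> L * (1 + p) * \<zeta>\<^sup>2 + L' * (C2 * (L * \<zeta>\<^sup>2)) + 2 * p * (C2 * (L * \<zeta>\<^sup>2))"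
      proof (intro add_mono)
        show "\<bar>(h - h1) * m1\<bar> \<le> L * (1 + p) * \<zeta>\<^sup>2"
          using dh' mr mult_right_le_one_le[of "\<bar>h - h1\<bar>" m1] by (simp add: abs_mult)
        show "\<bar>(h1 - h0) * m1\<bar> \<le> L' * (C2 * (L * \<zeta>\<^sup>2))"
          using dh mr mult_right_le_one_le[of "\<bar>h1 - h0\<bar>" m1] by (simp add: abs_mult)
        show "\<bar>h0 * (m1 - m0)\<bar> \<le> 2 * p * (C2 * (L * \<zeta>\<^sup>2))"
          unfolding abs_mult using h0 dm p by (intro mult_mono) auto
      qed
      finally have pay: "\<bar>h * m1 - h0 * m0\<bar> \<le> (L * (1 + p) + (L' + 2 * p) * (C2 * L)) * \<zeta>\<^sup>2"
        by (simp add: algebra_simps)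
      have "\<bar>r (d a / q \<zeta>) * q \<zeta> - r (d a / q0) * q0\<bar> \<le> C1 * \<bar>q \<zeta> - q0\<bar>"
        using C1(2)[of "d a" "q \<zeta>"] d_pos[OF a] qz by simp
      also have "\<dots> \<le> C1 * (L * \<zeta>\<^sup>2)" using dq[OF \<zeta>(1) zp] C1 by (intro mult_left_mono)
      finally have rev: "\<bar>r (d a / q \<zeta>) * q \<zeta> - r (d a / q0) * q0\<bar> \<le> C1 * L * \<zeta>\<^sup>2" by simp
      have "u 0 = r (d a / q0) * q0 - h0 * m0" "u \<zeta> = r (d a / q \<zeta>) * q \<zeta> - h * m1"
        by (simp_all add: u_def hm q0_def)
      then have "u 0 - u \<zeta> \<le> C1 * L * \<zeta>\<^sup>2 + (L * (1 + p) + (L' + 2 * p) * (C2 * L)) * \<zeta>\<^sup>2"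
        using pay rev by linarith
      then show ?thesis by (simp add: C_def distrib_right)
    qed
    moreover have "mean_field_utility r l\<^sub>R Sys a p 0 = u 0"
      using q0p p by (intro mfu) (auto simp: q0_def)
    moreover have "convergent (utility r l\<^sub>R Sys a (perturbed_payment p \<zeta>)) \<and> mean_field_utility r l\<^sub>R Sys a p \<zeta> = u \<zeta>"
      if "0 \<le> \<zeta>" "\<zeta> < \<alpha>" for \<zeta>
      using lim[of \<zeta>] mfu[of \<zeta>] z[OF that] that by (auto simp: convergent_def)
    ultimately have "\<forall>\<zeta>. 0 \<le> \<zeta> \<and> \<zeta> < \<alpha> \<longrightarrow>
        \<zeta> < p \<and> convergent (utility r l\<^sub>R Sys a (perturbed_payment p \<zeta>)) \<and>
        mean_field_utility r l\<^sub>R Sys a p 0 - mean_field_utility r l\<^sub>R Sys a p \<zeta> \<le> C * \<zeta>\<^sup>2"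
      using z by simp
    with C \<alpha> show ?thesis by blast
  qed
qed

end

section \<open>Average over the periods\<close>

theorem theorem9:
  fixes \<A> :: "'s set"
    and \<B> :: "'b measure"
    and Sys :: "nat \<Rightarrow> real measure \<Rightarrow> ('w, 's, 'b) system"
    and A :: "nat \<Rightarrow> 's"
    and p :: "nat \<Rightarrow> real"
    and T :: nat
  assumes "market_model \<A> \<B> d \<delta> \<nu> f \<Omega> \<omega> l r l\<^sub>R Sys"
    and "1 \<le> T"
    and "\<And>t. t \<in> {1..T} \<Longrightarrow> A t \<in> \<A>"
    and "\<And>t. t \<in> {1..T} \<Longrightarrow> 0 < p t"
    and nondegenerate:
      "bounded (r ` {0..}) \<or>
       (\<forall>t\<in>{1..T}. \<not> (AE b in \<nu> (A t). f b (p t * Lim at_top \<omega>) = 0))"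
  shows "\<exists>C>0. \<exists>\<alpha>>0. \<forall>\<zeta>. 0 \<le> \<zeta> \<and> \<zeta> < \<alpha> \<longrightarrow>
    (\<forall>t\<in>{1..T}. \<zeta> < p t \<and> convergent (utility r l\<^sub>R Sys (A t) (perturbed_payment (p t) \<zeta>))) \<and>
    1 / real T * (\<Sum>t=1..T. mean_field_utility r l\<^sub>R Sys (A t) (p t) 0
                            - mean_field_utility r l\<^sub>R Sys (A t) (p t) \<zeta>) \<le> C * \<zeta>\<^sup>2"
proof -
  interpret market_model \<A> \<B> d \<delta> \<nu> f \<Omega> \<omega> l r l\<^sub>R Sys by fact
  let ?loss = "\<lambda>t \<zeta>. mean_field_utility r l\<^sub>R Sys (A t) (p t) 0 - mean_field_utility r l\<^sub>R Sys (A t) (p t) \<zeta>"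
  have "\<forall>t\<in>{1..T}. \<exists>C \<alpha>. 0 \<le> C \<and> 0 < \<alpha> \<and> (\<forall>\<zeta>. 0 \<le> \<zeta> \<and> \<zeta> < \<alpha> \<longrightarrow> \<zeta> < p t \<and>
      convergent (utility r l\<^sub>R Sys (A t) (perturbed_payment (p t) \<zeta>)) \<and> ?loss t \<zeta> \<le> C * \<zeta>\<^sup>2)"
  proof
    fix t assume t: "t \<in> {1..T}"
    have "bounded (r ` {0..}) \<or> \<not> (AE b in \<nu> (A t). f b (p t * Lim at_top \<omega>) = 0)"
      using nondegenerate t by blast
    from perturbation_loss[OF assms(3,4)[OF t] this]
    show "\<exists>C \<alpha>. 0 \<le> C \<and> 0 < \<alpha> \<and> (\<forall>\<zeta>. 0 \<le> \<zeta> \<and> \<zeta> < \<alpha> \<longrightarrow> \<zeta> < p t \<and>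
      convergent (utility r l\<^sub>R Sys (A t) (perturbed_payment (p t) \<zeta>)) \<and> ?loss t \<zeta> \<le> C * \<zeta>\<^sup>2)" by blast
  qed
  then obtain c \<alpha> where c: "\<And>t. t \<in> {1..T} \<Longrightarrow> 0 \<le> c t" and \<alpha>: "\<And>t. t \<in> {1..T} \<Longrightarrow> 0 < \<alpha> t"
    and main: "\<And>t \<zeta>. t \<in> {1..T} \<Longrightarrow> 0 \<le> \<zeta> \<Longrightarrow> \<zeta> < \<alpha> t \<Longrightarrow> \<zeta> < p t \<and>
      convergent (utility r l\<^sub>R Sys (A t) (perturbed_payment (p t) \<zeta>)) \<and> ?loss t \<zeta> \<le> c t * \<zeta>\<^sup>2"
    unfolding bchoice_iff by metis
  \<comment> \<open>The summand 1 makes C strictly positive even if all the c t vanish.\<close>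
  define C where "C = 1 + (\<Sum>t=1..T. c t) / real T"
  define \<beta> where "\<beta> = Min (\<alpha> ` {1..T})"
  have "0 \<le> (\<Sum>t=1..T. c t)" by (intro sum_nonneg c)
  then have C: "0 < C" unfolding C_def by (intro add_pos_nonneg) auto
  have ne: "{1..T} \<noteq> {}" using assms(2) by simp
  have \<beta>: "0 < \<beta>" using \<alpha> ne by (simp add: \<beta>_def)
  have \<beta>le: "\<beta> \<le> \<alpha> t" if "t \<in> {1..T}" for t using that by (simp add: \<beta>_def)
  show ?thesis
  proof (rule exI[of _ C], rule conjI[OF C], rule exI[of _ \<beta>], rule conjI[OF \<beta>], intro conjI allI impI ballI)
    fix \<zeta> t assume "0 \<le> \<zeta> \<and> \<zeta> < \<beta>" "t \<in> {1..T}"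
    then show "\<zeta> < p t" "convergent (utility r l\<^sub>R Sys (A t) (perturbed_payment (p t) \<zeta>))"
      using main[of t \<zeta>] \<beta>le[of t] by auto
  next
    fix \<zeta> assume \<zeta>: "0 \<le> \<zeta> \<and> \<zeta> < \<beta>"
    have "(\<Sum>t=1..T. ?loss t \<zeta>) \<le> (\<Sum>t=1..T. c t * \<zeta>\<^sup>2)"
    proof (rule sum_mono)
      fix t assume t: "t \<in> {1..T}"
      show "?loss t \<zeta> \<le> c t * \<zeta>\<^sup>2" using main[OF t, of \<zeta>] \<beta>le[OF t] \<zeta> by linarith
    qed
    then have "1 / real T * (\<Sum>t=1..T. ?loss t \<zeta>) \<le> 1 / real T * (\<Sum>t=1..T. c t * \<zeta>\<^sup>2)"
      by (rule mult_left_mono) simp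
    also have "\<dots> = (C - 1) * \<zeta>\<^sup>2" by (simp add: C_def sum_distrib_right)
    also have "\<dots> \<le> C * \<zeta>\<^sup>2" by (intro mult_right_mono) auto
    finally show "1 / real T * (\<Sum>t=1..T. ?loss t \<zeta>) \<le> C * \<zeta>\<^sup>2" .
  qed
qed

end
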